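(* Let $\Phi\in C^\infty(\mathbb R^n\setminus\{0\})$ be a real-valued function such that (i) $|\nabla\Phi(\xi)|\neq 0$ for all $\xi\ne 0$; (ii) there is a constant $\mu\ge 1$ such that $\mu^{-1}\le|\Phi(\xi)|\le\mu$ for all $\xi$ with $|\xi|=1$; (iii) there is a constant $m\ge 1$ such that $\Phi(\lambda\xi)=\lambda^m\Phi(\xi)$ for all $\lambda>0$ and all $\xi\neq 0$; (iv) the Hessian $H_\Phi(\xi)$ of $\Phi$ has rank at least $1$ for all $\xi\ne0$. Then for $1<r<\infty$, $$\big\|e^{it\Phi(D)}f(x)\big\|_{L_t^r(\mathbb R)}\le C_{m,\mu}\bigg\|\bigg(\sum_{\substack{j,k\in\mathbb Z:\\|k-j|\le\frac{\log_2\mu}m+2}}\big|\widetilde{P_j}\,e^{it\Phi(D)}P_kf(x)\big|^2\bigg)^{1/2}\bigg\|_{L_t^r(\mathbb R)}$$ for all functions $f$ and all $x\in\mathbb R^n$.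
   Context: The dispersive operator is given (formally) by $$e^{it\Phi(D)}f(x)=\frac1{(2\pi)^n}\int_{\mathbb R^n}e^{i(x\cdot\xi+t\Phi(\xi))}\hat f(\xi)\,d\xi,\qquad x\in\mathbb R^n,\ t\in\mathbb R.$$ Let $\phi\in C_0^\infty([\frac12,2])$ be a cut-off function with $\sum_{k\in\mathbb Z}\phi(2^{-k}y)=1$ for $y>0$. The Littlewood–Paley projection operators $P_k$ (acting on functions on $\mathbb R^n$) and $\widetilde{P_k}$ (acting on functions of $t\in\mathbb R$) are defined by $$\widehat{P_kf}(\xi)=\phi(2^{-k}|\xi|)\hat f(\xi),\qquad \widehat{\widetilde{P_k}g}(\tau)=\phi(2^{-mk}|\tau|)\hat g(\tau)$$ for $\xi\in\mathbb R^n$ and $\tau\in\mathbb R$, respectively, the Fourier transform in $t$ being taken in the distributional sense. In $\widetilde{P_j}e^{it\Phi(D)}P_kf(x)$ the operator $\widetilde{P_j}$ acts in the variable $t$ with $x$ fixed. The constant $C_{m,\mu}$ depends on $m$ and $\mu$ (and possibly on $n$ and $r$), but not on $f$ or $x$.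
   Formalization: The time projections use the multiplier φ(2^{-k}|τ|^{1/m}) instead of φ(2^{-mk}|τ|) (the same for m=1), since with the latter the claim fails, e.g. for Φ(ξ)=|ξ|^3, n=1; "all functions f" means f and its Fourier transform are integrable. *)

theory Defs
  imports "HOL-Analysis.Analysis"
begin

subsection \<open>Smoothness, gradient and Hessian\<close>

text \<open>For open \<open>S\<close>, \<open>Ck_on k S f\<close> says that all iterated partial derivatives of \<open>f\<close> up to
  order \<open>k\<close> exist and are continuous on \<open>S\<close>.\<close>

fun Ck_on :: "nat \<Rightarrow> 'a::euclidean_space set \<Rightarrow> ('a \<Rightarrow> 'b::real_normed_vector) \<Rightarrow> bool" where
  "Ck_on 0 S f \<longleftrightarrow> continuous_on S f"
| "Ck_on (Suc k) S f \<longleftrightarrow> (\<forall>x\<in>S. f differentiable (at x)) \<and>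
     (\<forall>b\<in>Basis. Ck_on k S (\<lambda>x. frechet_derivative f (at x) b))"

definition smooth_on :: "'a::euclidean_space set \<Rightarrow> ('a \<Rightarrow> 'b::real_normed_vector) \<Rightarrow> bool" where
  "smooth_on S f \<longleftrightarrow> (\<forall>k. Ck_on k S f)"

definition partial :: "'n::finite \<Rightarrow> (real^'n \<Rightarrow> real) \<Rightarrow> real^'n \<Rightarrow> real" where
  "partial i f x = frechet_derivative f (at x) (axis i 1)"

definition grad :: "(real^'n::finite \<Rightarrow> real) \<Rightarrow> real^'n \<Rightarrow> real^'n" where
  "grad f x = (\<chi> i. partial i f x)"

definition hessian :: "(real^'n::finite \<Rightarrow> real) \<Rightarrow> real^'n \<Rightarrow> real^'n^'n" where
  "hessian f x = (\<chi> i j. partial i (partial j f) x)"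

subsection \<open>Fourier transform, dispersive operator, spatial projections\<close>

definition fourier :: "('a::euclidean_space \<Rightarrow> complex) \<Rightarrow> 'a \<Rightarrow> complex" where
  "fourier f \<xi> = (LINT x|lborel. cis (- (x \<bullet> \<xi>)) * f x)"

definition inv_fourier :: "('a::euclidean_space \<Rightarrow> complex) \<Rightarrow> 'a \<Rightarrow> complex" where
  "inv_fourier g x = 1 / (2 * pi) ^ DIM('a) * (LINT \<xi>|lborel. cis (x \<bullet> \<xi>) * g \<xi>)"

definition dispersive ::
  "('a::euclidean_space \<Rightarrow> real) \<Rightarrow> real \<Rightarrow> ('a \<Rightarrow> complex) \<Rightarrow> 'a \<Rightarrow> complex" where
  "dispersive \<Phi> t f x =
     1 / (2 * pi) ^ DIM('a) * (LINT \<xi>|lborel. cis (x \<bullet> \<xi> + t * \<Phi> \<xi>) * fourier f \<xi>)"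

definition LP_cutoff :: "(real \<Rightarrow> real) \<Rightarrow> bool" where
  "LP_cutoff \<phi> \<longleftrightarrow> smooth_on UNIV \<phi> \<and> (\<forall>y. y \<notin> {1/2..2} \<longrightarrow> \<phi> y = 0) \<and>
     (\<forall>y>0. ((\<lambda>k::int. \<phi> (2 powr (- of_int k) * y)) has_sum 1) UNIV)"

definition LP_space ::
  "(real \<Rightarrow> real) \<Rightarrow> int \<Rightarrow> ('a::euclidean_space \<Rightarrow> complex) \<Rightarrow> 'a \<Rightarrow> complex" where
  "LP_space \<phi> k f =
     inv_fourier (\<lambda>\<xi>. of_real (\<phi> (2 powr (- of_int k) * norm \<xi>)) * fourier f \<xi>)"

subsection \<open>Projections in the time variable\<close>

definition schwartz :: "(real \<Rightarrow> complex) \<Rightarrow> bool" where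
  "schwartz h \<longleftrightarrow> smooth_on UNIV h \<and>
     (\<forall>a b::nat. bounded (range (\<lambda>t. of_real (t ^ a) *
        ((\<lambda>u s. vector_derivative u (at s)) ^^ b) h t)))"

text \<open>The functions of \<open>t\<close> of interest are bounded and continuous but need not be integrable, so
  their Fourier transform is that of tempered distributions, \<open>\<langle>fourier g, h\<rangle> = \<langle>g, fourier h\<rangle>\<close>.
  Hence \<open>fourier G = a * fourier g\<close>, with \<open>a \<tau> = \<psi> (2 powr (- m k) \<bar>\<tau>\<bar>)\<close>, means
  \<open>\<langle>G, fourier h\<rangle> = \<langle>g, fourier (a * h)\<rangle>\<close> for all test functions \<open>h\<close>. As \<open>a\<close> has compact
  support, the distribution \<open>G\<close> is a smooth function, bounded if \<open>g\<close> is bounded; continuity picks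
  it from its class modulo null sets.\<close>

definition LP_time ::
  "(real \<Rightarrow> real) \<Rightarrow> real \<Rightarrow> int \<Rightarrow> (real \<Rightarrow> complex) \<Rightarrow> real \<Rightarrow> complex" where
  "LP_time \<psi> m k g = (THE G. continuous_on UNIV G \<and> bounded (range G) \<and>
     (\<forall>h. schwartz h \<longrightarrow>
        (LINT t|lborel. G t * fourier h t) =
        (LINT t|lborel. g t *
           fourier (\<lambda>\<tau>. of_real (\<psi> (2 powr (- m * of_int k) * \<bar>\<tau>\<bar>)) * h \<tau>) t)))"

text \<open>The time frequencies are decomposed with ratio \<open>2 powr m\<close> rather than 2. For the
  projections \<open>LP_time \<psi> m k\<close> to sum to the identity, \<open>\<psi>\<close> has to be a partition of unity for that
  ratio. The function \<open>\<phi>\<close> itself is one only for \<open>m = 1\<close>; for \<open>m > 2\<close> its dilates by powers of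
  \<open>2 powr m\<close> do not even cover the positive half-line (\<open>dilates_gap\<close>). The
  cut-off \<open>\<phi>\<close> is therefore transported to the ratio \<open>2 powr m\<close> by \<open>s \<mapsto> s powr (1/m)\<close>, so that
  the multiplier of the \<open>k\<close>-th projection is \<open>\<phi> (2 powr (-k) * \<bar>\<tau>\<bar> powr (1/m))\<close>. For \<open>m = 1\<close>
  this is \<open>\<phi> (2 powr (-k) * \<bar>\<tau>\<bar>)\<close>.\<close>

definition time_cutoff :: "real \<Rightarrow> (real \<Rightarrow> real) \<Rightarrow> real \<Rightarrow> real" where
  "time_cutoff m \<phi> s = \<phi> (s powr (1 / m))"

lemma time_cutoff_partition:
  assumes "LP_cutoff \<phi>" "m \<ge> 1" "y > 0"
  shows "((\<lambda>k::int. time_cutoff m \<phi> (2 powr (- m * of_int k) * y)) has_sum 1) UNIV"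
proof -
  have "(2 powr (- m * of_int k) * y) powr (1 / m) = 2 powr (- of_int k) * y powr (1 / m)"
    for k :: int
    using assms by (simp add: powr_mult powr_powr)
  moreover have "y powr (1 / m) > 0" using assms by simp
  ultimately show ?thesis
    using assms(1) unfolding LP_cutoff_def time_cutoff_def by simp
qed

lemma time_cutoff_1: "s \<ge> 0 \<Longrightarrow> time_cutoff 1 \<phi> s = \<phi> s"
  by (simp add: time_cutoff_def)

lemma dilates_gap:
  assumes "LP_cutoff \<phi>" "m > 2" "2 < \<tau>" "\<tau> < 2 powr (m - 1)"
  shows "\<phi> (2 powr (- m * of_int k) * \<tau>) = 0"
proof (cases "k \<le> 0")
  case True
  then have "2 powr (- m * of_int k) \<ge> (1::real)"
    using assms by (intro ge_one_powr_ge_zero) (auto simp: mult_le_0_iff)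
  then have "1 * \<tau> \<le> 2 powr (- m * of_int k) * \<tau>"
    using assms by (intro mult_right_mono) auto
  with assms(3) have "2 < 2 powr (- m * of_int k) * \<tau>" by linarith
  then have "2 powr (- m * of_int k) * \<tau> \<notin> {1/2..2}" by simp
  then show ?thesis using assms(1) unfolding LP_cutoff_def by blast
next
  case False
  then have "2 powr (- m * of_int k) \<le> (2::real) powr (- m)"
    using assms by (intro powr_mono) auto
  then have "2 powr (- m * of_int k) * \<tau> \<le> 2 powr (- m) * \<tau>"
    using assms by (intro mult_right_mono) auto
  also have "\<dots> < 2 powr (- m) * 2 powr (m - 1)"
    using assms by simp
  also have "\<dots> = 1 / 2" by (simp add: powr_diff powr_minus_divide)
  finally have "2 powr (- m * of_int k) * \<tau> \<notin> {1/2..2}" by simp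
  then show ?thesis using assms(1) unfolding LP_cutoff_def by blast
qed

subsection \<open>Norms\<close>

definition enn_powr :: "ennreal \<Rightarrow> real \<Rightarrow> ennreal" where
  "enn_powr x p = (if x = \<infinity> then \<infinity> else ennreal (enn2real x powr p))"

text \<open>The \<open>L\<^sup>r(\<real>)\<close> norm of a function with values in \<open>[0, \<infinity>]\<close>, possibly infinite
  (for \<open>r > 0\<close>).\<close>

definition Lr_norm :: "real \<Rightarrow> (real \<Rightarrow> ennreal) \<Rightarrow> ennreal" where
  "Lr_norm r G = enn_powr (\<integral>\<^sup>+ t. enn_powr (G t) r \<partial>lborel) (1 / r)"

end

theory Submission
  imports Defs "HOL-Probability.Probability"
begin

text \<open>For fixed \<open>x\<close>, \<open>t \<mapsto> dispersive \<Phi> t f x\<close> is an oscillatory integral of the form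
  \<open>\<integral> cis (t * \<Phi> \<xi>) * g \<xi>\<close> with integrable \<open>g\<close>. The time projections act on such integrals by
  multiplying \<open>g \<xi>\<close> by the cut-off evaluated at \<open>\<Phi> \<xi>\<close>, the space projections by the cut-off evaluated
  at \<open>norm \<xi>\<close>. By homogeneity \<open>\<bar>\<Phi> \<xi>\<bar> powr (1 / m)\<close> and \<open>norm \<xi>\<close> agree up to a factor
  \<open>\<mu> powr (1 / m)\<close>, so that a time frequency \<open>j\<close> only meets the space frequencies \<open>k\<close> with
  \<open>\<bar>k - j\<bar> \<le> log 2 \<mu> / m + 2\<close>. By Cauchy-Schwarz it remains to bound the function of \<open>t\<close> by its
  Littlewood-Paley square function.

  Random signs turn the square function into operators \<open>\<Sum>j. \<plusminus> ker j *\<close>. Their kernels satisfy the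
  Calderon-Zygmund conditions uniformly in the signs: the \<open>L\<^sup>2\<close> bound holds because the symbols have
  bounded overlap, and Hormander's condition because the kernels are dilates of one rapidly decaying
  kernel. They are hence bounded on \<open>L\<^sup>p\<close> for \<open>1 < p \<le> 2\<close>, and by duality for all \<open>p\<close>. Khinchine's
  inequality yields the bound of the square function by the function, and a second duality argument
  reverses it.\<close>

subsection \<open>Fourier analysis on Euclidean spaces\<close>

text \<open>For fixed x the function of t is bounded and continuous, but in general it is not
  integrable and not known to lie in L^r; its spectrum is the image of a density under \<Phi>. This
  shapes the proof: operators in time act by pairing or by convolution with integrable kernels,
  norms are integrals with values in [0, \<infinity>], and duality uses bounded test functions of
  compact support. \<Phi>, f and x enter the square function estimate only through an integrable
  density, so its constants depend on the cut-off, m and r alone. The constant \<mu> enters at the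
  very end, as the number of k that can meet a given j. Signed sums run over finite index sets, with
  bounds that do not depend on the set; the passage to all frequencies is made once, by Fatou's
  lemma. The kernels are those of widened multipliers, because a projection does not reproduce its
  own range and the reversal of the square function estimate needs operators that do.\<close>

lemma borel_measurable_cis [measurable]: "cis \<in> borel_measurable borel"
  by (intro borel_measurable_continuous_onI continuous_intros)

lemma continuous_on_LINT:
  fixes g :: "'a::metric_space \<Rightarrow> 'b \<Rightarrow> 'c::{banach, second_countable_topology}"
  assumes cont: "\<And>y. continuous_on UNIV (\<lambda>x. g x y)"
    and [measurable]: "\<And>x. g x \<in> borel_measurable M"
    and bnd: "\<And>x y. norm (g x y) \<le> w y" and w: "integrable M w"
  shows "continuous_on UNIV (\<lambda>x. LINT y|M. g x y)"
proof (rule continuous_at_imp_continuous_on, rule ballI)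
  fix x
  show "isCont (\<lambda>x. LINT y|M. g x y) x"
    unfolding continuous_at_sequentially comp_def
  proof (intro allI impI)
    fix X assume X: "X \<longlonglongrightarrow> x"
    show "(\<lambda>n. LINT y|M. g (X n) y) \<longlonglongrightarrow> (LINT y|M. g x y)"
    proof (rule integral_dominated_convergence[OF _ _ w])
      show "AE y in M. (\<lambda>n. g (X n) y) \<longlonglongrightarrow> g x y"
      proof (rule AE_I2)
        fix y
        have "isCont (\<lambda>x. g x y) x"
          using cont[of y] by (simp add: continuous_on_eq_continuous_at)
        then show "(\<lambda>n. g (X n) y) \<longlonglongrightarrow> g x y"
          by (rule isCont_tendsto_compose) (rule X)
      qed
    qed (use bnd in auto)
  qed
qed

text \<open>Justifies the Fubini exchanges whose integrand is a product of two integrable functions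
  up to a bounded oscillating factor.\<close>

lemma integrable_pair_bound:
  fixes u :: "'a::euclidean_space \<Rightarrow> complex" and v :: "'b::euclidean_space \<Rightarrow> complex"
    and w :: "'a \<times> 'b \<Rightarrow> complex"
  assumes u: "integrable lborel u" and v: "integrable lborel v"
    and w: "w \<in> borel_measurable (lborel \<Otimes>\<^sub>M lborel)"
    and bnd: "\<And>x y. norm (w (x, y)) \<le> norm (u x) * norm (v y)"
  shows "integrable (lborel \<Otimes>\<^sub>M lborel) w"
proof -
  have [measurable]: "u \<in> borel_measurable borel" "v \<in> borel_measurable borel"
    using u v by auto
  have "integrable (lborel \<Otimes>\<^sub>M lborel) (\<lambda>p. u (fst p) * v (snd p))"
    by (rule lborel_pair.Fubini_integrable)
       (use u v in \<open>auto simp: norm_mult\<close>)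
  then show ?thesis
    by (rule Bochner_Integration.integrable_bound)
       (use w bnd in \<open>auto simp: norm_mult\<close>)
qed

lemma integrable_translate:
  fixes f :: "'a::euclidean_space \<Rightarrow> 'b::{banach, second_countable_topology}"
  assumes "c \<noteq> 0"
  shows "integrable lborel (\<lambda>x. f (t + c *\<^sub>R x)) \<longleftrightarrow> integrable lborel f"
proof -
  have *: "integrable lborel (\<lambda>x. f (t + c *\<^sub>R x))" if "integrable lborel f" "c \<noteq> 0" for t c and f :: "'a \<Rightarrow> 'b"
  proof -
    have [measurable]: "f \<in> borel_measurable borel" using that by auto
    have "integrable (density (distr lborel borel (\<lambda>x. t + c *\<^sub>R x)) (\<lambda>_. ennreal (\<bar>c\<bar>^DIM('a)))) f"
      using lborel_affine[OF that(2), of t] that(1) by simp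
    then have "integrable lborel (\<lambda>x. \<bar>c\<bar>^DIM('a) *\<^sub>R f (t + c *\<^sub>R x))"
      by (simp add: integrable_density integrable_distr_eq)
    then have "integrable lborel (\<lambda>x. inverse (\<bar>c\<bar>^DIM('a)) *\<^sub>R (\<bar>c\<bar>^DIM('a) *\<^sub>R f (t + c *\<^sub>R x)))"
      by (rule integrable_scaleR_right)
    then show ?thesis
      using that(2) by simp
  qed
  from *[of f c t] *[of "\<lambda>x. f (t + c *\<^sub>R x)" "1/c" "- (t /\<^sub>R c)"] show ?thesis
    using assms by (auto simp: algebra_simps)
qed

lemma LINT_translate:
  fixes f :: "'a::euclidean_space \<Rightarrow> 'b::{banach, second_countable_topology}"
  assumes "c \<noteq> 0"
  shows "(LINT x|lborel. f x) = \<bar>c\<bar>^DIM('a) *\<^sub>R (LINT x|lborel. f (t + c *\<^sub>R x))"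
proof (cases "integrable lborel f")
  case True
  have [measurable]: "f \<in> borel_measurable borel" using True by auto
  have "(LINT x|lborel. f x) = integral\<^sup>L (density (distr lborel borel (\<lambda>x. t
      + c *\<^sub>R x)) (\<lambda>_. ennreal (\<bar>c\<bar>^DIM('a)))) f"
    using lborel_affine[OF assms, of t] by simp
  then show ?thesis
    by (simp add: integral_density integral_distr)
next
  case False
  then show ?thesis using integrable_translate[OF assms, of f t] by (simp add: not_integrable_integral_eq)
qed

lemma LINT_reflect:
  fixes f :: "'a::euclidean_space \<Rightarrow> 'b::{banach, second_countable_topology}"
  shows "(LINT x|lborel. f (t - x)) = (LINT x|lborel. f x)"
  using LINT_translate[of "-1" f t] by simp

lemma integrable_reflect:
  fixes f :: "'a::euclidean_space \<Rightarrow> 'b::{banach, second_countable_topology}"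
  shows "integrable lborel (\<lambda>x. f (t - x)) \<longleftrightarrow> integrable lborel f"
  using integrable_translate[of "-1" f t] by simp

text \<open>The convolution counterpart of \<open>integrable_pair_bound\<close>: the majorant is not
  a product in x and y, but becomes one after a translation of the inner variable.\<close>

lemma integrable_pair_convolution:
  fixes k f :: "'a::euclidean_space \<Rightarrow> complex" and w :: "'a \<times> 'a \<Rightarrow> complex"
  assumes k: "integrable lborel k" and f: "integrable lborel f"
    and w: "w \<in> borel_measurable (lborel \<Otimes>\<^sub>M lborel)"
    and bnd: "\<And>x y. norm (w (x, y)) \<le> norm (k (x - y)) * norm (f y)"
  shows "integrable (lborel \<Otimes>\<^sub>M lborel) w"
proof -
  have [measurable]: "k \<in> borel_measurable borel" "f \<in> borel_measurable borel"
    using k f by auto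
  have "integrable (lborel \<Otimes>\<^sub>M lborel) (\<lambda>(y, x). k (x - y) * f y)"
  proof (rule lborel_pair.Fubini_integrable)
    have eq: "(LINT x|lborel. norm (k (x - y) * f y)) = (LINT x|lborel. norm (k x)) * norm (f y)" for y
      using LINT_translate[of 1 "\<lambda>x. norm (k x)" "- y"] by (simp add: norm_mult)
    show "integrable lborel (\<lambda>x. LINT y|lborel. norm (case (x, y) of (y, x) \<Rightarrow> k (x - y) * f y))"
      using f by (simp add: eq)
    show "AE x in lborel. integrable lborel (\<lambda>y. case (x, y) of (y, x) \<Rightarrow> k (x - y) * f y)"
    proof (rule AE_I2)
      fix y
      show "integrable lborel (\<lambda>x. case (y, x) of (y, x) \<Rightarrow> k (x - y) * f y)"
        using integrable_translate[of 1 k "- y"] k by simp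
    qed
  qed measurable
  then have "integrable (lborel \<Otimes>\<^sub>M lborel) (\<lambda>(x, y). k (x - y) * f y)"
    by (subst (asm) lborel_pair.integrable_product_swap_iff[symmetric]) (simp add: split_def)
  then show ?thesis
    by (rule Bochner_Integration.integrable_bound)
       (use w bnd in \<open>auto simp: norm_mult\<close>)
qed

text \<open>Lebesgue measure is the product over \<open>Basis\<close> of Lebesgue measures on the
  line. This reduces Gaussians and decay weights to dimension one.\<close>

lemma
  fixes f :: "'a::euclidean_space \<Rightarrow> real \<Rightarrow> complex"
  assumes f: "\<And>b. b \<in> Basis \<Longrightarrow> integrable lborel (f b)"
  shows integrable_lborel_prod: "integrable lborel (\<lambda>x::'a. \<Prod>b\<in>Basis. f b (x \<bullet> b))"
    and LINT_lborel_prod: "(LINT x|(lborel::'a measure). (\<Prod>b\<in>Basis. f b (x \<bullet> b)))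
        = (\<Prod>b\<in>Basis. LINT x|lborel. f b x)"
proof -
  interpret product_sigma_finite "\<lambda>_::'a. lborel :: real measure" ..
  have [measurable]: "b \<in> Basis \<Longrightarrow> f b \<in> borel_measurable borel" for b
    using f[of b] by auto
  have eq: "(\<Prod>b\<in>Basis. f b ((\<Sum>b\<in>Basis. x b *\<^sub>R b) \<bullet> b)) = (\<Prod>b\<in>Basis. f b (x b))" for x :: "'a \<Rightarrow> real"
    by (intro prod.cong refl) (simp add: inner_sum_left_Basis)
  show "integrable lborel (\<lambda>x::'a. \<Prod>b\<in>Basis. f b (x \<bullet> b))"
    using product_integrable_prod[of Basis f] f
    by (subst lborel_eq) (simp add: integrable_distr_eq eq)
  show "(LINT x|(lborel::'a measure). (\<Prod>b\<in>Basis. f b (x \<bullet> b))) = (\<Prod>b\<in>Basis. LINT x|lborel. f b x)"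
    using product_integral_prod[of Basis f] f
    by (subst lborel_eq) (simp add: integral_distr eq)
qed

section \<open>Gaussians and approximate identities\<close>

definition gauss :: "'a::euclidean_space \<Rightarrow> real" where
  "gauss x = (\<Prod>b\<in>Basis. std_normal_density (x \<bullet> b))"

text \<open>The Fourier transform of \<open>gauss\<close>. Its value at 0 is 1, so that
  \<open>gexp (\<epsilon> *\<^sub>R \<xi>)\<close> is a summability factor tending to 1.\<close>

definition gexp :: "'a::euclidean_space \<Rightarrow> real" where
  "gexp x = exp (- (norm x)\<^sup>2 / 2)"

lemma gauss_pos: "gauss x > 0"
  unfolding gauss_def by (intro prod_pos) (auto simp: std_normal_density_def)

lemma gauss_minus [simp]: "gauss (- x) = gauss x"
  by (simp add: gauss_def std_normal_density_def)

lemma gexp_pos: "gexp x > 0" and gexp_le_1: "gexp x \<le> 1" and gexp_0 [simp]: "gexp 0 = 1"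
  by (simp_all add: gexp_def)

lemma prod_exp_inner:
  fixes x :: "'a::euclidean_space"
  shows "(\<Prod>b\<in>Basis. exp (- (x \<bullet> b)\<^sup>2 / 2)) = gexp x"
  unfolding gexp_def power2_norm_eq_inner euclidean_inner[of x x]
  by (simp flip: exp_sum add: sum_negf sum_divide_distrib power2_eq_square)

lemma gauss_eq_gexp: "gauss (x::'a::euclidean_space) = (1 / sqrt (2 * pi)) ^ DIM('a) * gexp x"
  unfolding gauss_def std_normal_density_def prod.distrib prod_exp_inner by simp

lemma continuous_gexp [continuous_intros]: "continuous_on A g \<Longrightarrow> continuous_on A (\<lambda>x. gexp (g x))"
  unfolding gexp_def by (intro continuous_intros) auto

lemma measurable_gauss [measurable]: "gauss \<in> borel_measurable borel"
  unfolding gauss_def by measurable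

lemma measurable_gexp [measurable]: "gexp \<in> borel_measurable borel"
  unfolding gexp_def by measurable

lemma cis_sum: "cis (\<Sum>i\<in>I. f i) = (\<Prod>i\<in>I. cis (f i))"
  by (induction I rule: infinite_finite_induct) (auto simp flip: cis_mult)

text \<open>In one variable this is the characteristic function of the standard normal distribution;
  the density and the character both factor over the coordinates. Integrability and total mass are
  the case \<open>t = 0\<close>.\<close>

lemma
  shows integrable_gauss: "integrable lborel (gauss :: 'a::euclidean_space \<Rightarrow> real)"
    and LINT_gauss: "(LINT x|lborel. gauss (x::'a)) = 1"
    and fourier_gauss: "(LINT x|lborel. cis (t \<bullet> x) * of_real (gauss (x::'a))) = of_real (gexp t)"
proof -
  have i1: "integrable lborel (\<lambda>x. cis (s * x) * complex_of_real (std_normal_density x))" for s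
    by (rule Bochner_Integration.integrable_bound[OF integrable_normal_density[of 1 0]])
       (auto simp: norm_mult)
  have e1: "(LINT x|lborel. cis (s * x) * complex_of_real (std_normal_density x))
      = of_real (exp (- s\<^sup>2 / 2))" for s
  proof -
    have "of_real (exp (- s\<^sup>2 / 2)) = char std_normal_distribution s"
      by (simp add: char_std_normal_distribution)
    also have "\<dots> = (LINT x|lborel. cis (s * x) * complex_of_real (std_normal_density x))"
      unfolding char_def
      by (subst integral_density) (auto simp: cis_conv_exp scaleR_conv_of_real mult.commute mult.left_commute)
    finally show ?thesis by simp
  qed
  have eq: "cis (t \<bullet> x) * of_real (gauss x)
      = (\<Prod>b\<in>Basis. cis ((t \<bullet> b) * (x \<bullet> b)) * complex_of_real (std_normal_density (x \<bullet> b)))" for x t :: 'a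
    unfolding gauss_def by (subst euclidean_inner) (simp add: cis_sum prod.distrib)
  have i2: "integrable lborel (\<lambda>x::'a. cis (t \<bullet> x) * complex_of_real (gauss x))" for t
    unfolding eq by (rule integrable_lborel_prod[of "\<lambda>b x. cis ((t \<bullet> b) * x)
        * complex_of_real (std_normal_density x)"]) (rule i1)
  show e2: "(LINT x|lborel. cis (t \<bullet> x) * of_real (gauss (x::'a))) = of_real (gexp t)" for t
    unfolding eq
    using LINT_lborel_prod[of "\<lambda>b x. cis ((t \<bullet> b) * x) * complex_of_real (std_normal_density x)"] i1
    by (simp add: e1 flip: prod_exp_inner)
  show g: "integrable lborel (gauss :: 'a \<Rightarrow> real)"
    using i2[of 0] complex_of_real_integrable_eq[of lborel "gauss :: 'a \<Rightarrow> real"] by simp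
  have "complex_of_real (LINT x|lborel. gauss (x::'a)) = 1"
    using e2[of 0] by simp
  then show "(LINT x|lborel. gauss (x::'a)) = 1" by simp
qed

lemma integrable_gexp:
  assumes "\<epsilon> > 0"
  shows "integrable lborel (\<lambda>x::'a::euclidean_space. gexp (\<epsilon> *\<^sub>R x))"
proof -
  have "integrable lborel (gexp :: 'a \<Rightarrow> real)"
    using integrable_gauss[where 'a='a] unfolding gauss_eq_gexp by simp
  then show ?thesis using integrable_translate[of \<epsilon> "gexp :: 'a \<Rightarrow> real" 0] assms by simp
qed

text \<open>The Fourier transform of \<open>gexp (\<epsilon> *\<^sub>R \<xi>)\<close>: an
  approximate identity of width \<epsilon> with mass \<open>(2 * pi) ^ DIM('a)\<close> instead of 1,
  whence the constant in Fourier inversion.\<close>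

definition gker :: "real \<Rightarrow> 'a::euclidean_space \<Rightarrow> real" where
  "gker \<epsilon> y = (2 * pi) ^ DIM('a) / \<epsilon> ^ DIM('a) * gauss (y /\<^sub>R \<epsilon>)"

lemma gker_nonneg: "\<epsilon> > 0 \<Longrightarrow> gker \<epsilon> y \<ge> 0"
  unfolding gker_def by (intro mult_nonneg_nonneg) (auto simp: gauss_pos less_imp_le)

lemma gker_minus [simp]: "gker \<epsilon> (- y) = gker \<epsilon> y"
  by (simp add: gker_def)

lemma measurable_gker [measurable]: "gker \<epsilon> \<in> borel_measurable borel"
  unfolding gker_def by measurable

lemma fourier_gexp:
  assumes "\<epsilon> > 0"
  shows "(LINT \<xi>|lborel. cis (y \<bullet> \<xi>) * of_real (gexp (\<epsilon> *\<^sub>R \<xi>))) = of_real (gker \<epsilon> (y::'a::euclidean_space))"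
proof -
  let ?n = "DIM('a)"
  have "(LINT \<xi>|lborel. cis (y \<bullet> \<xi>) * of_real (gexp (\<epsilon> *\<^sub>R \<xi>))) =
     (1 / \<epsilon> ^ ?n) *\<^sub>R (LINT \<xi>|lborel. cis (y \<bullet> (\<xi> /\<^sub>R \<epsilon>)) * of_real (gexp \<xi>))"
    using LINT_translate[of "1/\<epsilon>" "\<lambda>\<xi>. cis (y \<bullet> \<xi>) * complex_of_real (gexp (\<epsilon> *\<^sub>R \<xi>))" 0] assms
    by (simp add: power_inverse divide_inverse)
  also have "(\<lambda>\<xi>. cis (y \<bullet> (\<xi> /\<^sub>R \<epsilon>)) * complex_of_real (gexp \<xi>)) =
     (\<lambda>\<xi>. of_real (sqrt (2 * pi) ^ ?n) * (cis ((y /\<^sub>R \<epsilon>) \<bullet> \<xi>) * complex_of_real (gauss \<xi>)))"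
    by (simp add: gauss_eq_gexp fun_eq_iff power_one_over)
  also have "(LINT \<xi>|lborel. of_real (sqrt (2 * pi) ^ ?n) * (cis ((y /\<^sub>R \<epsilon>) \<bullet> \<xi>) * complex_of_real (gauss \<xi>)))
     = of_real (sqrt (2 * pi) ^ ?n * gexp (y /\<^sub>R \<epsilon>))"
    by (simp only: fourier_gauss integral_mult_right_zero of_real_mult)
  also have "sqrt (2 * pi) ^ ?n * gexp (y /\<^sub>R \<epsilon>) = (2 * pi) ^ ?n * gauss (y /\<^sub>R \<epsilon>)"
  proof -
    have "(2 * pi) ^ ?n = (sqrt (2 * pi) * sqrt (2 * pi)) ^ ?n"
      by simp
    then have "(2 * pi) ^ ?n = sqrt (2 * pi) ^ ?n * sqrt (2 * pi) ^ ?n"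
      by (simp only: power_mult_distrib)
    then show ?thesis by (simp add: gauss_eq_gexp power_one_over del: real_sqrt_mult)
  qed
  finally show ?thesis
    by (simp add: gker_def scaleR_conv_of_real)
qed

lemma gker_LINT:
  fixes u :: "'a::euclidean_space \<Rightarrow> complex"
  assumes "\<epsilon> > 0"
  shows "(LINT y|lborel. u y * of_real (gker \<epsilon> (x - y))) =
     (2 * pi) ^ DIM('a) * (LINT z|lborel. u (x - \<epsilon> *\<^sub>R z) * of_real (gauss z))"
proof -
  have "(LINT y|lborel. u y * of_real (gker \<epsilon> (x - y)))
      = \<epsilon> ^ DIM('a) *\<^sub>R (LINT z|lborel. u (x - \<epsilon> *\<^sub>R z) * of_real (gker \<epsilon> (\<epsilon> *\<^sub>R z)))"
    using LINT_translate[of "- \<epsilon>" "\<lambda>y. u y * complex_of_real (gker \<epsilon> (x - y))" x] assms by simp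
  also have "(\<lambda>z. u (x - \<epsilon> *\<^sub>R z) * complex_of_real (gker \<epsilon> (\<epsilon> *\<^sub>R z))) =
     (\<lambda>z. ((2 * pi) ^ DIM('a) / \<epsilon> ^ DIM('a)) * (u (x - \<epsilon> *\<^sub>R z) * of_real (gauss z)))"
    using assms by (simp add: gker_def fun_eq_iff)
  finally show ?thesis using assms
    by (simp add: scaleR_conv_of_real)
qed

lemma integrable_gker:
  assumes "\<epsilon> > 0"
  shows "integrable lborel (gker \<epsilon> :: 'a::euclidean_space \<Rightarrow> real)"
    and "(LINT y|lborel. gker \<epsilon> (y::'a)) = (2 * pi) ^ DIM('a)"
proof -
  show "integrable lborel (gker \<epsilon> :: 'a \<Rightarrow> real)"
    unfolding gker_def using integrable_gauss assms integrable_translate[of "inverse \<epsilon>" "gauss :: 'a \<Rightarrow> real" 0]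
    by auto
  have "complex_of_real (LINT y|lborel. gker \<epsilon> (y::'a)) = (LINT y|lborel. 1 * of_real (gker \<epsilon> (0 - (y::'a))))"
    by simp
  also have "\<dots> = of_real ((2 * pi) ^ DIM('a))"
    by (subst gker_LINT[OF assms]) (simp add: LINT_gauss)
  finally show "(LINT y|lborel. gker \<epsilon> (y::'a)) = (2 * pi) ^ DIM('a)"
    using of_real_eq_iff by blast
qed

text \<open>Dominated convergence with majorant \<open>B * gauss\<close>. Continuity of
  \<open>u\<close> gives the limit at every point, on which the pointwise identification of the time
  projections rests.\<close>

lemma gauss_average_tendsto:
  fixes u :: "'a::euclidean_space \<Rightarrow> complex"
  assumes "continuous_on UNIV u" "bounded (range u)"
  shows "(\<lambda>n. LINT z|lborel. u (x - (1 / Suc n) *\<^sub>R z) * of_real (gauss z)) \<longlonglongrightarrow> u x"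
proof -
  obtain B where B: "\<And>x. norm (u x) \<le> B" using assms(2) by (auto simp: bounded_iff)
  have [measurable]: "u \<in> borel_measurable borel"
    using assms(1) by (rule borel_measurable_continuous_onI)
  have "(\<lambda>n. LINT z|lborel. u (x - (1 / Suc n) *\<^sub>R z) * of_real (gauss z))
      \<longlonglongrightarrow> (LINT z|lborel. u x * of_real (gauss (z::'a)))"
  proof (rule integral_dominated_convergence[where w="\<lambda>z. B * gauss z"])
    show "AE z in lborel. (\<lambda>n. u (x - (1 / real (Suc n)) *\<^sub>R z) * complex_of_real (gauss z))
        \<longlonglongrightarrow> u x * complex_of_real (gauss z)"
    proof (intro AE_I2 tendsto_intros)
      fix z :: 'a
      have "(\<lambda>n. x - (1 / real (Suc n)) *\<^sub>R z) \<longlonglongrightarrow> x - 0 *\<^sub>R z"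
        by (intro tendsto_intros LIMSEQ_Suc lim_1_over_n)
      then show "(\<lambda>n. u (x - (1 / real (Suc n)) *\<^sub>R z)) \<longlonglongrightarrow> u x"
        using assms(1) by (intro isCont_tendsto_compose[of x u]) (auto simp: continuous_on_eq_continuous_at)
    qed
    show "AE z in lborel. norm (u (x - (1 / real (Suc n)) *\<^sub>R z) * complex_of_real (gauss z)) \<le> B * gauss z" for n
      by (intro AE_I2) (auto simp: norm_mult gauss_pos less_imp_le intro!: mult_mono B)
  qed (use integrable_gauss in auto)
  then show ?thesis by (simp add: LINT_gauss)
qed

section \<open>Fourier inversion and Bessel's inequality\<close>

lemma continuous_fourier: "integrable lborel f \<Longrightarrow> continuous_on UNIV (fourier f)"
  unfolding fourier_def
  by (rule continuous_on_LINT[where w="\<lambda>x. norm (f x)"]) (auto simp: norm_mult intro!: continuous_intros)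

lemma norm_fourier_le: "integrable lborel f \<Longrightarrow> norm (fourier f x) \<le> (LINT x|lborel. norm (f x))"
  unfolding fourier_def
  by (rule order_trans[OF integral_norm_bound]) (auto simp: norm_mult)

lemma integrable_cis_mult:
  fixes f :: "'a \<Rightarrow> complex"
  assumes "integrable M f" and [measurable]: "g \<in> borel_measurable M"
  shows "integrable M (\<lambda>x. cis (g x) * f x)"
proof (rule Bochner_Integration.integrable_bound[OF assms(1)])
  show "(\<lambda>x. cis (g x) * f x) \<in> borel_measurable M"
    using assms(1)[THEN borel_measurable_integrable] by measurable
qed (auto simp: norm_mult)

lemma fourier_mult_formula:
  fixes u v :: "'a::euclidean_space \<Rightarrow> complex"
  assumes u: "integrable lborel u" and v: "integrable lborel v"
  shows "(LINT \<xi>|lborel. fourier u \<xi> * v \<xi>) = (LINT y|lborel. u y * fourier v y)"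
proof -
  have [measurable]: "u \<in> borel_measurable borel" "v \<in> borel_measurable borel" using u v by auto
  have "(LINT \<xi>|lborel. fourier u \<xi> * v \<xi>) = (LINT \<xi>|lborel. LINT y|lborel. cis (- (y \<bullet> \<xi>)) * (u y * v \<xi>))"
    unfolding fourier_def by (simp flip: integral_mult_left_zero add: mult.assoc)
  also have "\<dots> = (LINT y|lborel. LINT \<xi>|lborel. cis (- (y \<bullet> \<xi>)) * (u y * v \<xi>))"
    by (rule lborel_pair.Fubini_integral, rule integrable_pair_bound[OF u v])
       (auto simp: norm_mult split_def)
  also have "\<dots> = (LINT y|lborel. u y * fourier v y)"
    unfolding fourier_def by (simp flip: integral_mult_right_zero add: mult_ac inner_commute)
  finally show ?thesis .
qed

text \<open>A Gaussian factor makes the multiplication formula applicable, which turns the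
  regularised integral into a Gaussian average of \<open>u\<close>. Both sides converge as the width
  tends to 0.\<close>

theorem fourier_inversion:
  fixes u :: "'a::euclidean_space \<Rightarrow> complex"
  assumes u: "integrable lborel u" "continuous_on UNIV u" "bounded (range u)"
    and fu: "integrable lborel (fourier u)"
  shows "(LINT \<xi>|lborel. cis (x \<bullet> \<xi>) * fourier u \<xi>) = (2 * pi) ^ DIM('a) * u x"
proof -
  have [measurable]: "u \<in> borel_measurable borel" "fourier u \<in> borel_measurable borel" using u fu by auto
  define e where "e n = 1 / real (Suc n)" for n
  have e: "e n > 0" for n by (simp add: e_def)
  have eq: "(LINT \<xi>|lborel. cis (x \<bullet> \<xi>) * fourier u \<xi> * of_real (gexp (e n *\<^sub>R \<xi>))) =
     (2 * pi) ^ DIM('a) * (LINT z|lborel. u (x - e n *\<^sub>R z) * of_real (gauss z))" for n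
  proof -
    let ?v = "\<lambda>\<xi>. cis (x \<bullet> \<xi>) * complex_of_real (gexp (e n *\<^sub>R \<xi>))"
    have "integrable lborel (\<lambda>\<xi>::'a. gexp (e n *\<^sub>R \<xi>))"
      by (rule integrable_gexp[OF e])
    then have v: "integrable lborel ?v"
      by (intro integrable_cis_mult) auto
    have fv: "fourier ?v y = of_real (gker (e n) (x - y))" for y
    proof -
      have "- (\<xi> \<bullet> y) + x \<bullet> \<xi> = (x - y) \<bullet> \<xi>" for \<xi>
        by (simp add: inner_diff_left inner_commute[of \<xi> y])
      then have eq: "cis (- (\<xi> \<bullet> y)) * (cis (x \<bullet> \<xi>) * c) = cis ((x - y) \<bullet> \<xi>) * c" for \<xi> c
        by (metis cis_mult mult.assoc)
      show ?thesis
        unfolding fourier_def fourier_gexp[OF e, symmetric] eq ..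
    qed
    have "(LINT \<xi>|lborel. cis (x \<bullet> \<xi>) * fourier u \<xi> * of_real (gexp (e n *\<^sub>R \<xi>)))
        = (LINT \<xi>|lborel. fourier u \<xi> * ?v \<xi>)"
      by (simp add: mult_ac)
    also have "\<dots> = (LINT y|lborel. u y * of_real (gker (e n) (x - y)))"
      by (subst fourier_mult_formula[OF u(1) v]) (simp add: fv)
    also have "\<dots> = (2 * pi) ^ DIM('a) * (LINT z|lborel. u (x - e n *\<^sub>R z) * of_real (gauss z))"
      by (rule gker_LINT[OF e])
    finally show ?thesis .
  qed
  have "(\<lambda>n. LINT \<xi>|lborel. cis (x \<bullet> \<xi>) * fourier u \<xi> * of_real (gexp (e n *\<^sub>R \<xi>)))
      \<longlonglongrightarrow> (LINT \<xi>|lborel. cis (x \<bullet> \<xi>) * fourier u \<xi>)"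
  proof (rule integral_dominated_convergence[where w="\<lambda>z. norm (fourier u z)"])
    show "AE \<xi> in lborel. (\<lambda>n. cis (x \<bullet> \<xi>) * fourier u \<xi> * complex_of_real (gexp (e n *\<^sub>R \<xi>)))
        \<longlonglongrightarrow> cis (x \<bullet> \<xi>) * fourier u \<xi>"
    proof (intro AE_I2)
      fix \<xi> :: 'a
      have "(\<lambda>n. e n *\<^sub>R \<xi>) \<longlonglongrightarrow> 0 *\<^sub>R \<xi>"
        unfolding e_def by (intro tendsto_intros LIMSEQ_Suc lim_1_over_n)
      then have "(\<lambda>n. gexp (e n *\<^sub>R \<xi>)) \<longlonglongrightarrow> gexp (0 *\<^sub>R \<xi>)"
        by (intro isCont_tendsto_compose[of "0 *\<^sub>R \<xi>" gexp])
           (use continuous_gexp[OF continuous_on_id[of UNIV]] in \<open>auto simp: continuous_on_eq_continuous_at\<close>)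
      then have "(\<lambda>n. cis (x \<bullet> \<xi>) * fourier u \<xi> * complex_of_real (gexp (e n *\<^sub>R \<xi>)))
          \<longlonglongrightarrow> cis (x \<bullet> \<xi>) * fourier u \<xi> * of_real (gexp (0 *\<^sub>R \<xi>))"
        by (intro tendsto_intros)
      then show "(\<lambda>n. cis (x \<bullet> \<xi>) * fourier u \<xi> * complex_of_real (gexp (e n *\<^sub>R \<xi>))) \<longlonglongrightarrow> cis (x \<bullet> \<xi>) * fourier u \<xi>"
        by simp
    qed
    show "AE \<xi> in lborel. norm (cis (x \<bullet> \<xi>) * fourier u \<xi> * complex_of_real (gexp (e n *\<^sub>R \<xi>)))
        \<le> norm (fourier u \<xi>)" for n
      by (intro AE_I2) (auto simp: norm_mult gexp_pos less_imp_le gexp_le_1 intro!: mult_left_le)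
  qed (use fu in auto)
  moreover have "(\<lambda>n. (2 * pi) ^ DIM('a) * (LINT z|lborel. u (x - e n *\<^sub>R z) * of_real (gauss z)))
      \<longlonglongrightarrow> (2 * pi) ^ DIM('a) * u x"
    unfolding e_def by (intro tendsto_intros gauss_average_tendsto u)
  ultimately show ?thesis
    unfolding eq using LIMSEQ_unique by blast
qed


text \<open>For a non-integrable function the Bochner integral is 0 by convention and the bound is
  trivial.\<close>

lemma norm_integral_le_nn_integral:
  fixes f :: "'a \<Rightarrow> 'b::{banach, second_countable_topology}"
  shows "ennreal (norm (integral\<^sup>L M f)) \<le> (\<integral>\<^sup>+x. ennreal (norm (f x)) \<partial>M)"
  by (cases "integrable M f") (auto intro: integral_norm_bound_ennreal simp: not_integrable_integral_eq)

lemma nn_integral_Fatou_bound: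
  fixes f :: "nat \<Rightarrow> 'a \<Rightarrow> ennreal"
  assumes [measurable]: "\<And>n. f n \<in> borel_measurable M"
    and lim: "\<And>x. (\<lambda>n. f n x) \<longlonglongrightarrow> g x" and bnd: "\<And>n. (\<integral>\<^sup>+x. f n x \<partial>M) \<le> C n"
    and C: "C \<longlonglongrightarrow> c"
  shows "(\<integral>\<^sup>+x. g x \<partial>M) \<le> c"
proof -
  have "(\<integral>\<^sup>+x. g x \<partial>M) = (\<integral>\<^sup>+x. liminf (\<lambda>n. f n x) \<partial>M)"
    by (intro nn_integral_cong lim_imp_Liminf[symmetric] lim) simp
  also have "\<dots> \<le> liminf (\<lambda>n. \<integral>\<^sup>+x. f n x \<partial>M)"
    by (rule nn_integral_liminf) auto
  also have "\<dots> \<le> liminf C"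
    by (intro Liminf_mono always_eventually allI bnd)
  also have "\<dots> = c" using C by (simp add: lim_imp_Liminf)
  finally show ?thesis .
qed

lemma nn_integral_gker:
  fixes y :: "'a::euclidean_space"
  assumes "\<epsilon> > 0"
  shows "(\<integral>\<^sup>+z. ennreal (gker \<epsilon> (y - z)) \<partial>lborel) = ennreal ((2 * pi) ^ DIM('a))" (is ?A)
    and "(\<integral>\<^sup>+z. ennreal (gker \<epsilon> (z - y)) \<partial>lborel) = ennreal ((2 * pi) ^ DIM('a))" (is ?B)
proof -
  have *: "integrable lborel (\<lambda>z::'a. gker \<epsilon> (y - z))"
    using integrable_reflect[of "gker \<epsilon> :: 'a \<Rightarrow> real" y] integrable_gker(1)[OF assms, where 'a='a] by simp
  have "(LINT z|lborel. gker \<epsilon> (y - (z::'a))) = (2 * pi) ^ DIM('a)"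
    using LINT_reflect[of "gker \<epsilon> :: 'a \<Rightarrow> real" y] integrable_gker(2)[OF assms, where 'a='a] by simp
  then show ?A
    using assms by (subst nn_integral_eq_integral[OF *]) (auto simp: gker_nonneg)
  also have "(\<integral>\<^sup>+z. ennreal (gker \<epsilon> (y - z)) \<partial>lborel) = (\<integral>\<^sup>+z. ennreal (gker \<epsilon> (z - y)) \<partial>lborel)"
    using gker_minus[of \<epsilon> "_ - y"] by (intro nn_integral_cong) (metis minus_diff_eq gker_minus)
  finally show ?B .
qed

text \<open>With the Gaussian factor the left side is a quadratic form in \<open>u\<close> with
  kernel \<open>gker\<close>. The inequality between arithmetic and geometric mean separates the two
  values of \<open>u\<close>, and the kernel has mass \<open>(2 * pi) ^ DIM('a)\<close> in either
  variable. An integrable \<open>u\<close> need not be square integrable, hence the extended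
  integrals.\<close>

lemma fourier_regularised_le:
  fixes u :: "'a::euclidean_space \<Rightarrow> complex"
  assumes u: "integrable lborel u" and e: "\<epsilon> > 0"
  shows "(\<integral>\<^sup>+\<xi>. ennreal ((norm (fourier u \<xi>))\<^sup>2 * gexp (\<epsilon> *\<^sub>R \<xi>)) \<partial>lborel)
     \<le> ennreal ((2 * pi) ^ DIM('a)) * (\<integral>\<^sup>+y. ennreal ((norm (u y))\<^sup>2) \<partial>lborel)"
proof -
  have [measurable]: "u \<in> borel_measurable borel" using u by auto
  have [measurable]: "fourier u \<in> borel_measurable borel"
    using continuous_fourier[OF u] by (rule borel_measurable_continuous_onI)
  let ?c = "ennreal ((2 * pi) ^ DIM('a))"
  let ?g = "\<lambda>\<xi>::'a. gexp (\<epsilon> *\<^sub>R \<xi>)"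
  define v where "v \<xi> = cnj (fourier u \<xi>) * of_real (?g \<xi>)" for \<xi>
  obtain B where B: "\<And>x. norm (fourier u x) \<le> B" using norm_fourier_le[OF u] by auto
  have ig: "integrable lborel ?g" by (rule integrable_gexp[OF e])
  have v: "integrable lborel v"
    unfolding v_def
  proof (rule Bochner_Integration.integrable_bound[OF integrable_mult_right[OF ig, of B]])
    show "AE \<xi> in lborel. norm (cnj (fourier u \<xi>) * complex_of_real (?g \<xi>)) \<le> norm (B * ?g \<xi>)"
    proof (rule AE_I2)
      fix \<xi> :: 'a
      have "norm (fourier u \<xi>) * ?g \<xi> \<le> \<bar>B\<bar> * ?g \<xi>"
        using B[of \<xi>] gexp_pos[of "\<epsilon> *\<^sub>R \<xi>"] by (intro mult_right_mono) auto
      then show "norm (cnj (fourier u \<xi>) * complex_of_real (?g \<xi>)) \<le> norm (B * ?g \<xi>)"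
        using gexp_pos[of "\<epsilon> *\<^sub>R \<xi>"] by (simp add: norm_mult abs_mult)
    qed
    have "(\<lambda>\<xi>. cnj (fourier u \<xi>) * complex_of_real (?g \<xi>)) \<in> borel_measurable borel"
      by (intro borel_measurable_continuous_onI continuous_intros continuous_fourier u)
    then show "(\<lambda>\<xi>. cnj (fourier u \<xi>) * complex_of_real (?g \<xi>)) \<in> borel_measurable lborel"
      by simp
  qed
  \<comment> \<open>Conjugation and reflection of \<open>u\<close> conjugate its transform, so the
    conjugate factor in \<open>v\<close> is again a Fourier transform.\<close>
  define ut where "ut z = cnj (u (- z))" for z
  have ut: "integrable lborel ut"
    using u integrable_reflect[of u 0] by (simp add: ut_def[abs_def])
  have fut: "fourier ut \<xi> = cnj (fourier u \<xi>)" for \<xi>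
  proof -
    have "cnj (fourier u \<xi>) = (LINT x|lborel. cnj (cis (- (x \<bullet> \<xi>)) * u x))"
      unfolding fourier_def by (rule Bochner_Integration.integral_cnj[symmetric])
    also have "\<dots> = fourier ut \<xi>"
      unfolding fourier_def ut_def
      using LINT_reflect[of "\<lambda>x. cnj (cis (- (x \<bullet> \<xi>)) * u x)" 0] by (simp add: cis_cnj)
    finally show ?thesis by simp
  qed
  have fv: "fourier v y = (LINT z|lborel. ut z * of_real (gker \<epsilon> (z + y)))" for y
  proof -
    have iw: "integrable lborel (\<lambda>\<xi>. cis (- (y \<bullet> \<xi>)) * complex_of_real (?g \<xi>))"
      by (intro integrable_cis_mult) (use ig in auto)
    have fw: "fourier (\<lambda>\<xi>. cis (- (y \<bullet> \<xi>)) * complex_of_real (?g \<xi>)) z = of_real (gker \<epsilon> (z + y))" for z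
    proof -
      have "- (\<xi> \<bullet> z) + - (y \<bullet> \<xi>) = (- (z + y)) \<bullet> \<xi>" for \<xi>
        by (simp add: inner_diff_left inner_commute[of \<xi> z])
      then have eq: "cis (- (\<xi> \<bullet> z)) * (cis (- (y \<bullet> \<xi>)) * c) = cis ((- (z + y)) \<bullet> \<xi>) * c" for \<xi> c
        by (metis cis_mult mult.assoc)
      have "fourier (\<lambda>\<xi>. cis (- (y \<bullet> \<xi>)) * complex_of_real (?g \<xi>)) z = of_real (gker \<epsilon> (- (z + y)))"
        unfolding fourier_def fourier_gexp[OF e, symmetric] eq ..
      then show ?thesis by (simp only: gker_minus)
    qed
    have "fourier v y = (LINT \<xi>|lborel. fourier ut \<xi> * (cis (- (y \<bullet> \<xi>)) * complex_of_real (?g \<xi>)))"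
      unfolding fourier_def[of v] v_def fut by (simp add: mult_ac inner_commute)
    also have "\<dots> = (LINT z|lborel. ut z * fourier (\<lambda>\<xi>. cis (- (y \<bullet> \<xi>)) * complex_of_real (?g \<xi>)) z)"
      by (rule fourier_mult_formula[OF ut iw])
    finally show ?thesis unfolding fw .
  qed
  have nfv: "ennreal (norm (fourier v y)) \<le> (\<integral>\<^sup>+z. ennreal (norm (u z) * gker \<epsilon> (y - z)) \<partial>lborel)" for y
  proof -
    have "(LINT z|lborel. ut z * of_real (gker \<epsilon> (z + y)))
        = (LINT z|lborel. cnj (u z) * of_real (gker \<epsilon> (y - z)))"
      using LINT_reflect[of "\<lambda>z. cnj (u z) * complex_of_real (gker \<epsilon> (y - z))" 0]
          by (simp add: ut_def add.commute)
    then have "ennreal (norm (fourier v y)) \<le> (\<integral>\<^sup>+z. ennreal (norm (cnj (u z)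
        * complex_of_real (gker \<epsilon> (y - z)))) \<partial>lborel)"
      unfolding fv by (simp add: norm_integral_le_nn_integral)
    then show ?thesis using e by (simp add: norm_mult gker_nonneg)
  qed
  have "complex_of_real (LINT \<xi>|lborel. (norm (fourier u \<xi>))\<^sup>2 * ?g \<xi>) = (LINT \<xi>|lborel. fourier u \<xi> * v \<xi>)"
    unfolding v_def integral_complex_of_real[symmetric] of_real_mult complex_norm_square
        by (simp only: mult.assoc)
  also have "\<dots> = (LINT y|lborel. u y * fourier v y)"
    by (rule fourier_mult_formula[OF u v])
  finally have eq: "complex_of_real (LINT \<xi>|lborel. (norm (fourier u \<xi>))\<^sup>2 * ?g \<xi>)
      = (LINT y|lborel. u y * fourier v y)" .
  have nn: "(norm (fourier u \<xi>))\<^sup>2 * ?g \<xi> \<ge> 0" for \<xi>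
    by (simp add: gexp_pos less_imp_le)
  have int: "integrable lborel (\<lambda>\<xi>. (norm (fourier u \<xi>))\<^sup>2 * ?g \<xi>)"
    by (rule Bochner_Integration.integrable_bound[OF integrable_mult_right[OF ig, of "B\<^sup>2"]])
       (use B gexp_pos in \<open>auto simp: norm_mult abs_mult less_imp_le intro!: mult_mono power_mono\<close>)
  have "(\<integral>\<^sup>+\<xi>. ennreal ((norm (fourier u \<xi>))\<^sup>2 * ?g \<xi>) \<partial>lborel)
      = ennreal (LINT \<xi>|lborel. (norm (fourier u \<xi>))\<^sup>2 * ?g \<xi>)"
    using int nn by (intro nn_integral_eq_integral) auto
  also have "\<dots> = ennreal (norm (LINT y|lborel. u y * fourier v y))"
    using nn unfolding eq[symmetric] by (simp add: abs_of_nonneg Bochner_Integration.integral_nonneg)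
  also have "\<dots> \<le> (\<integral>\<^sup>+y. ennreal (norm (u y * fourier v y)) \<partial>lborel)"
    by (rule norm_integral_le_nn_integral)
  also have "\<dots> \<le> (\<integral>\<^sup>+y. (\<integral>\<^sup>+z. ennreal (norm (u y) * norm (u z) * gker \<epsilon> (y - z)) \<partial>lborel) \<partial>lborel)"
  proof (rule nn_integral_mono)
    fix y
    have "ennreal (norm (u y * fourier v y)) \<le> ennreal (norm (u y)) * (\<integral>\<^sup>+z. ennreal (norm (u z)
        * gker \<epsilon> (y - z)) \<partial>lborel)"
      using nfv[of y] by (auto simp: norm_mult ennreal_mult intro!: mult_left_mono)
    also have "\<dots> = (\<integral>\<^sup>+z. ennreal (norm (u y) * norm (u z) * gker \<epsilon> (y - z)) \<partial>lborel)"
      using e by (subst nn_integral_cmult[symmetric]) (auto simp: gker_nonneg mult.assoc simp flip: ennreal_mult)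
    finally show "ennreal (norm (u y * fourier v y)) \<le> \<dots>" .
  qed
  also have "\<dots> \<le> (\<integral>\<^sup>+y. (\<integral>\<^sup>+z. ennreal ((norm (u y))\<^sup>2 / 2) * ennreal (gker \<epsilon> (y - z))
      + ennreal ((norm (u z))\<^sup>2 / 2) * ennreal (gker \<epsilon> (y - z)) \<partial>lborel) \<partial>lborel)"
  proof (intro nn_integral_mono)
    fix y z
    have "norm (u y) * norm (u z) * gker \<epsilon> (y - z) \<le> ((norm (u y))\<^sup>2 / 2 + (norm (u z))\<^sup>2 / 2) * gker \<epsilon> (y - z)"
      using e sum_squares_bound[of "norm (u y)" "norm (u z)"] by (intro mult_right_mono) (auto simp: gker_nonneg)
    then have "ennreal (norm (u y) * norm (u z) * gker \<epsilon> (y - z))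
        \<le> ennreal ((norm (u y))\<^sup>2 / 2 * gker \<epsilon> (y - z) + (norm (u z))\<^sup>2 / 2 * gker \<epsilon> (y - z))"
      by (intro ennreal_leI) (simp add: algebra_simps)
    then show "ennreal (norm (u y) * norm (u z) * gker \<epsilon> (y - z))
        \<le> ennreal ((norm (u y))\<^sup>2 / 2) * ennreal (gker \<epsilon> (y - z))
        + ennreal ((norm (u z))\<^sup>2 / 2) * ennreal (gker \<epsilon> (y - z))"
      using e by (simp add: ennreal_mult[symmetric] gker_nonneg)
  qed
  also have "\<dots> = (\<integral>\<^sup>+y. (\<integral>\<^sup>+z. ennreal ((norm (u y))\<^sup>2 / 2) * ennreal (gker \<epsilon> (y - z)) \<partial>lborel) \<partial>lborel)
      + (\<integral>\<^sup>+y. (\<integral>\<^sup>+z. ennreal ((norm (u z))\<^sup>2 / 2) * ennreal (gker \<epsilon> (y - z)) \<partial>lborel) \<partial>lborel)"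
    by (subst nn_integral_add[symmetric]) (auto intro!: nn_integral_cong nn_integral_add)
  also have "(\<integral>\<^sup>+y. (\<integral>\<^sup>+z. ennreal ((norm (u z))\<^sup>2 / 2) * ennreal (gker \<epsilon> (y - z)) \<partial>lborel) \<partial>lborel)
     = (\<integral>\<^sup>+z. (\<integral>\<^sup>+y. ennreal ((norm (u z))\<^sup>2 / 2) * ennreal (gker \<epsilon> (y - z)) \<partial>lborel) \<partial>lborel)"
    by (rule lborel_pair.Fubini') measurable
  also have "\<dots> = ?c * (\<integral>\<^sup>+z. ennreal ((norm (u z))\<^sup>2 / 2) \<partial>lborel)"
    by (simp add: nn_integral_cmult nn_integral_multc nn_integral_gker[OF e] del: power_mult_distrib)
        (simp only: mult.commute)
  also have "(\<integral>\<^sup>+y. (\<integral>\<^sup>+z. ennreal ((norm (u y))\<^sup>2 / 2) * ennreal (gker \<epsilon> (y - z)) \<partial>lborel) \<partial>lborel)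
      = ?c * (\<integral>\<^sup>+z. ennreal ((norm (u z))\<^sup>2 / 2) \<partial>lborel)"
    by (simp add: nn_integral_cmult nn_integral_multc nn_integral_gker[OF e] del: power_mult_distrib)
        (simp only: mult.commute)
  also have "?c * (\<integral>\<^sup>+z. ennreal ((norm (u z))\<^sup>2 / 2) \<partial>lborel) + ?c * (\<integral>\<^sup>+z. ennreal ((norm (u z))\<^sup>2 / 2) \<partial>lborel)
     = ?c * (\<integral>\<^sup>+z. ennreal ((norm (u z))\<^sup>2) \<partial>lborel)"
    unfolding distrib_left[symmetric]
    by (subst nn_integral_add[symmetric]) (auto simp flip: ennreal_plus)
  finally show ?thesis .
qed

text \<open>Fatou's lemma as the Gaussian factor tends to 1; the regularised bound does not depend
  on the width.\<close>

theorem fourier_Bessel: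
  fixes u :: "'a::euclidean_space \<Rightarrow> complex"
  assumes u: "integrable lborel u"
  shows "(\<integral>\<^sup>+\<xi>. ennreal ((norm (fourier u \<xi>))\<^sup>2) \<partial>lborel)
     \<le> ennreal ((2 * pi) ^ DIM('a)) * (\<integral>\<^sup>+y. ennreal ((norm (u y))\<^sup>2) \<partial>lborel)"
proof (rule nn_integral_Fatou_bound[where f="\<lambda>n \<xi>. ennreal ((norm (fourier u \<xi>))\<^sup>2 * gexp ((1 / Suc n) *\<^sub>R \<xi>))"
      and C="\<lambda>_. ennreal ((2 * pi) ^ DIM('a)) * (\<integral>\<^sup>+y. ennreal ((norm (u y))\<^sup>2) \<partial>lborel)"])
  have [measurable]: "fourier u \<in> borel_measurable borel"
    using continuous_fourier[OF u] by (rule borel_measurable_continuous_onI)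
  show "(\<lambda>\<xi>. ennreal ((norm (fourier u \<xi>))\<^sup>2 * gexp ((1 / Suc n) *\<^sub>R \<xi>))) \<in> borel_measurable lborel" for n
    by measurable
  fix \<xi> :: 'a
  have "(\<lambda>n. (1 / Suc n) *\<^sub>R \<xi>) \<longlonglongrightarrow> 0 *\<^sub>R \<xi>"
    by (intro tendsto_intros LIMSEQ_Suc lim_1_over_n)
  then have "(\<lambda>n. gexp ((1 / Suc n) *\<^sub>R \<xi>)) \<longlonglongrightarrow> gexp (0 *\<^sub>R \<xi>)"
    by (intro isCont_tendsto_compose[of "0 *\<^sub>R \<xi>" gexp])
       (use continuous_gexp[OF continuous_on_id[of UNIV]] in \<open>auto simp: continuous_on_eq_continuous_at\<close>)
  then have "(\<lambda>n. (norm (fourier u \<xi>))\<^sup>2 * gexp ((1 / Suc n) *\<^sub>R \<xi>)) \<longlonglongrightarrow> (norm (fourier u \<xi>))\<^sup>2 * gexp (0 *\<^sub>R \<xi>)"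
    by (intro tendsto_intros)
  then show "(\<lambda>n. ennreal ((norm (fourier u \<xi>))\<^sup>2 * gexp ((1 / Suc n) *\<^sub>R \<xi>))) \<longlonglongrightarrow> ennreal ((norm (fourier u \<xi>))\<^sup>2)"
    by simp
qed (use fourier_regularised_le[OF u] in auto)

section \<open>Derivatives and decay of Fourier transforms\<close>

lemma has_vector_derivative_cis_affine:
  "((\<lambda>s. cis (p + s * q)) has_vector_derivative \<i> * of_real q * cis (p + s * q)) (at s)"
proof -
  have "((\<lambda>z. exp (\<i> * (of_real p + z * of_real q))) has_field_derivative \<i> * of_real q * exp (\<i> * (of_real p
      + of_real s * of_real q))) (at (of_real s))"
    by (auto intro!: derivative_eq_intros)
  from has_vector_derivative_real_field[OF this] show ?thesis
    by (simp add: cis_conv_exp)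
qed

text \<open>The integral of \<open>U (y + b) - U y\<close> is 0 by translation invariance, and it
  equals the integral of \<open>V\<close> by the fundamental theorem along the segment and Fubini.
  Translation invariance stands in for the vanishing of boundary terms.\<close>

lemma LINT_directional_derivative:
  fixes U V :: "'a::euclidean_space \<Rightarrow> complex"
  assumes U: "integrable lborel U" and V: "integrable lborel V" "continuous_on UNIV V"
    and der: "\<And>x s. ((\<lambda>s. U (x + s *\<^sub>R b)) has_vector_derivative V (x + s *\<^sub>R b)) (at s)"
  shows "(LINT x|lborel. V x) = 0"
proof -
  have [measurable]: "V \<in> borel_measurable borel" using V by auto
  have tr: "integrable lborel (\<lambda>y. f (y + c))" "(LINT y|lborel. f (y + c)) = (LINT y|lborel. f y)" 
    if "integrable lborel f" for f :: "'a \<Rightarrow> complex" and c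
    using integrable_translate[of 1 f c] LINT_translate[of 1 f c] that by (simp_all add: add.commute)
  let ?F = "\<lambda>\<sigma> y. indicator {0..1::real} \<sigma> *\<^sub>R V (y + \<sigma> *\<^sub>R b)"
  have int: "integrable (lborel \<Otimes>\<^sub>M lborel) (\<lambda>(\<sigma>, y). ?F \<sigma> y)"
  proof (rule lborel_pair.Fubini_integrable)
    have "(LINT y|lborel. norm (V (y + c))) = (LINT y|lborel. norm (V y))" for c
      using LINT_translate[of 1 "\<lambda>y. norm (V y)" c] by (simp add: add.commute)
    then show "integrable lborel (\<lambda>\<sigma>. LINT y|lborel. norm (case (\<sigma>, y) of (\<sigma>, y) \<Rightarrow> ?F \<sigma> y))"
      by simp
    show "AE \<sigma> in lborel. integrable lborel (\<lambda>y. case (\<sigma>, y) of (\<sigma>, y) \<Rightarrow> ?F \<sigma> y)"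
      by (intro AE_I2) (simp add: tr(1)[OF V(1)])
  qed measurable
  have FTC: "(LINT \<sigma>|lborel. ?F \<sigma> y) = U (y + b) - U y" for y
  proof -
    have "(LINT \<sigma>|lborel. indicator {0..1::real} \<sigma> *\<^sub>R V (y + \<sigma> *\<^sub>R b)) = U (y + 1 *\<^sub>R b) - U (y + 0 *\<^sub>R b)"
    proof (rule integral_FTC_Icc)
      show "continuous_on {0..1} (\<lambda>\<sigma>. V (y + \<sigma> *\<^sub>R b))"
        by (rule continuous_on_compose2[OF V(2)]) (auto intro!: continuous_intros)
    qed (use der[of y] in \<open>auto intro: has_vector_derivative_at_within\<close>)
    then show ?thesis by simp
  qed
  have "(LINT y|lborel. U (y + b) - U y) = (LINT y|lborel. LINT \<sigma>|lborel. ?F \<sigma> y)"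
    by (simp only: FTC)
  also have "\<dots> = (LINT \<sigma>|lborel. LINT y|lborel. ?F \<sigma> y)"
    by (rule lborel_pair.Fubini_integral[OF int])
  also have "\<dots> = (LINT \<sigma>|lborel. indicator {0..1::real} \<sigma> *\<^sub>R (LINT y|lborel. V y))"
    by (simp add: tr(2)[OF V(1)])
  also have "\<dots> = (LINT y|lborel. V y)"
    by simp
  finally show ?thesis
    using tr[OF U, of b] U by simp
qed

lemma fourier_directional_derivative:
  fixes u v :: "'a::euclidean_space \<Rightarrow> complex"
  assumes u: "integrable lborel u" "continuous_on UNIV u" and v: "integrable lborel v" "continuous_on UNIV v"
    and der: "\<And>x s. ((\<lambda>s. u (x + s *\<^sub>R b)) has_vector_derivative v (x + s *\<^sub>R b)) (at s)"
  shows "fourier v x = \<i> * of_real (x \<bullet> b) * fourier u x"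
proof -
  let ?e = "\<lambda>y. cis (- (y \<bullet> x))"
  have iu: "integrable lborel (\<lambda>y. ?e y * u y)" and iv: "integrable lborel (\<lambda>y. ?e y * v y)"
    by (intro integrable_cis_mult u v; simp)+
  have "(LINT y|lborel. ?e y * v y - \<i> * of_real (x \<bullet> b) * (?e y * u y)) = 0"
  proof (rule LINT_directional_derivative[where U="\<lambda>y. ?e y * u y" and b=b])
    show "integrable lborel (\<lambda>y. ?e y * v y - \<i> * of_real (x \<bullet> b) * (?e y * u y))"
      using iu iv by auto
    show "continuous_on UNIV (\<lambda>y. ?e y * v y - \<i> * of_real (x \<bullet> b) * (?e y * u y))"
      by (intro continuous_intros u v)
    fix y and s :: real
    have eq: "?e (y + s *\<^sub>R b) = cis (- (y \<bullet> x) + s * (- (x \<bullet> b)))" for s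
      by (simp add: inner_add_left inner_commute algebra_simps)
    have "((\<lambda>s. ?e (y + s *\<^sub>R b) * u (y + s *\<^sub>R b)) has_vector_derivative
       ?e (y + s *\<^sub>R b) * v (y + s *\<^sub>R b) + \<i> * of_real (- (x \<bullet> b)) * ?e (y + s *\<^sub>R b) * u (y + s *\<^sub>R b)) (at s)"
      unfolding eq by (rule has_vector_derivative_mult[OF has_vector_derivative_cis_affine der])
    then show "((\<lambda>s. ?e (y + s *\<^sub>R b) * u (y + s *\<^sub>R b)) has_vector_derivative
       ?e (y + s *\<^sub>R b) * v (y + s *\<^sub>R b) - \<i> * of_real (x \<bullet> b) * (?e (y + s *\<^sub>R b) * u (y + s *\<^sub>R b))) (at s)"
      by (simp add: mult.assoc)
  qed (rule iu)
  then show ?thesis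
    using iu iv by (simp add: fourier_def)
qed

text \<open>\<open>Wk k u\<close> only asks for iterated derivatives along \<open>Basis\<close> that are continuous and integrable;
  this is what integration by parts needs.\<close>

fun Wk :: "nat \<Rightarrow> ('a::euclidean_space \<Rightarrow> complex) \<Rightarrow> bool" where
  "Wk 0 u \<longleftrightarrow> continuous_on UNIV u \<and> integrable lborel u"
| "Wk (Suc k) u \<longleftrightarrow> continuous_on UNIV u \<and> integrable lborel u \<and>
     (\<forall>b\<in>Basis. \<exists>v. Wk k v \<and> (\<forall>x s. ((\<lambda>s. u (x + s *\<^sub>R b)) has_vector_derivative v (x + s *\<^sub>R b)) (at s)))"

lemma Wk_base: "Wk k u \<Longrightarrow> continuous_on UNIV u \<and> integrable lborel u"
  by (cases k) auto

lemma Wk_Suc_imp: "Wk (Suc k) u \<Longrightarrow> Wk k u"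
proof (induction k arbitrary: u)
  case (Suc k)
  then show ?case by (metis Wk.simps(2))
qed auto

lemma Wk_add: "Wk k u \<Longrightarrow> Wk k v \<Longrightarrow> Wk k (\<lambda>x. u x + v x)"
proof (induction k arbitrary: u v)
  case (Suc k)
  have "\<exists>w. Wk k w \<and> (\<forall>x s. ((\<lambda>s. u (x + s *\<^sub>R b) + v (x + s *\<^sub>R b)) has_vector_derivative w (x + s *\<^sub>R b)) (at s))"
    if b: "b \<in> Basis" for b
  proof -
    obtain u' v' where *: "Wk k u'" "Wk k v'"
      "\<And>x s. ((\<lambda>s. u (x + s *\<^sub>R b)) has_vector_derivative u' (x + s *\<^sub>R b)) (at s)"
      "\<And>x s. ((\<lambda>s. v (x + s *\<^sub>R b)) has_vector_derivative v' (x + s *\<^sub>R b)) (at s)"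
      using Suc.prems b unfolding Wk.simps by blast
    show ?thesis
      by (intro exI[of _ "\<lambda>x. u' x + v' x"] conjI allI has_vector_derivative_add *(3,4) Suc.IH *(1,2))
  qed
  then show ?case using Suc.prems by (auto intro!: continuous_intros)
qed (auto intro!: continuous_intros)

lemma Wk_cmult: "Wk k u \<Longrightarrow> Wk k (\<lambda>x. c * u x)"
proof (induction k arbitrary: u)
  case (Suc k)
  have "\<exists>w. Wk k w \<and> (\<forall>x s. ((\<lambda>s. c * u (x + s *\<^sub>R b)) has_vector_derivative w (x + s *\<^sub>R b)) (at s))"
    if b: "b \<in> Basis" for b
  proof -
    obtain u' where *: "Wk k u'"
      "\<And>x s. ((\<lambda>s. u (x + s *\<^sub>R b)) has_vector_derivative u' (x + s *\<^sub>R b)) (at s)"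
      using Suc.prems b unfolding Wk.simps by blast
    show ?thesis
      by (intro exI[of _ "\<lambda>x. c * u' x"] conjI allI has_vector_derivative_mult_right *(2) Suc.IH *(1))
  qed
  then show ?case using Suc.prems by (auto intro!: continuous_intros)
qed (auto intro!: continuous_intros)

text \<open>The witness is \<open>u\<close> minus its second derivative along \<open>b\<close>. Two
  orders of smoothness thus buy one factor \<open>1 + (x \<bullet> b)\<^sup>2\<close>, whose inverse
  is integrable on the line.\<close>

lemma Wk_fourier_decay_step:
  assumes "Wk (Suc (Suc k)) u" "b \<in> Basis"
  obtains w where "Wk k w" "\<And>x. fourier w x = of_real (1 + (x \<bullet> b)\<^sup>2) * fourier u x"
proof -
  obtain v where v: "Wk (Suc k) v" 
    "\<And>x s. ((\<lambda>s. u (x + s *\<^sub>R b)) has_vector_derivative v (x + s *\<^sub>R b)) (at s)"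
    using assms unfolding Wk.simps(2)[of "Suc k"] by blast
  obtain w where w: "Wk k w" 
    "\<And>x s. ((\<lambda>s. v (x + s *\<^sub>R b)) has_vector_derivative w (x + s *\<^sub>R b)) (at s)"
    using assms(2) v(1) unfolding Wk.simps(2)[of k] by blast
  note base = Wk_base[OF assms(1)] Wk_base[OF v(1)] Wk_base[OF w(1)]
  have fv: "fourier v x = \<i> * of_real (x \<bullet> b) * fourier u x" for x
    using base v(2) by (intro fourier_directional_derivative) auto
  have fw: "fourier w x = \<i> * of_real (x \<bullet> b) * fourier v x" for x
    using base w(2) by (intro fourier_directional_derivative) auto
  show ?thesis
  proof
    show "Wk k (\<lambda>x. u x + (-1) * w x)"
      by (rule Wk_add[OF Wk_Suc_imp[OF Wk_Suc_imp[OF assms(1)]] Wk_cmult[OF w(1)]])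
    fix x
    have "fourier (\<lambda>x. u x + (-1) * w x) x = fourier u x - fourier w x"
      using base integrable_cis_mult[of lborel u "\<lambda>y. - (y \<bullet> x)"] integrable_cis_mult[of lborel w "\<lambda>y. - (y \<bullet> x)"]
      by (simp add: fourier_def algebra_simps)
    then show "fourier (\<lambda>x. u x + (-1) * w x) x = of_real (1 + (x \<bullet> b)\<^sup>2) * fourier u x"
    proof -
      have "f - \<i> * a * (\<i> * a * f) = (1 + a\<^sup>2) * f" for a f :: complex
        using i_squared by algebra
      then show ?thesis
        unfolding \<open>fourier (\<lambda>x. u x + (-1) * w x) x = _\<close> fw fv by simp
    qed
  qed
qed

text \<open>One coordinate at a time. The weight is a product rather than a power of the norm, so
  that the product formula for integrals makes its inverse integrable in every dimension.\<close>

lemma Wk_fourier_decay: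
  fixes u :: "'a::euclidean_space \<Rightarrow> complex"
  assumes "finite B" "B \<subseteq> Basis" "Wk (2 * card B) u"
  shows "\<exists>C. \<forall>x. norm (fourier u x) * (\<Prod>b\<in>B. 1 + (x \<bullet> b)\<^sup>2) \<le> C"
  using assms
proof (induction B arbitrary: u rule: finite_induct)
  case empty
  then show ?case using norm_fourier_le[of u] by auto
next
  case (insert b B)
  have "Wk (Suc (Suc (2 * card B))) u" using insert by simp
  then obtain w where w: "Wk (2 * card B) w" "\<And>x. fourier w x = of_real (1 + (x \<bullet> b)\<^sup>2) * fourier u x"
    using Wk_fourier_decay_step[of "2 * card B" u b] insert.prems by auto
  have nw: "norm (fourier w x) = (1 + (x \<bullet> b)\<^sup>2) * norm (fourier u x)" for x
  proof -
    have "1 + (x \<bullet> b)\<^sup>2 \<ge> 0" by simp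
    then show ?thesis unfolding w(2) norm_mult norm_of_real by simp
  qed
  obtain C where C: "\<And>x. norm (fourier w x) * (\<Prod>b\<in>B. 1 + (x \<bullet> b)\<^sup>2) \<le> C"
    using insert.IH[OF _ w(1)] insert.prems by auto
  have "norm (fourier u x) * (\<Prod>b\<in>insert b B. 1 + (x \<bullet> b)\<^sup>2) \<le> C" for x
  proof -
    have "norm (fourier u x) * (\<Prod>b\<in>insert b B. 1 + (x \<bullet> b)\<^sup>2) = norm (fourier w x) * (\<Prod>b\<in>B. 1 + (x \<bullet> b)\<^sup>2)"
      unfolding nw prod.insert[OF insert.hyps] by (simp only: mult_ac)
    with C[of x] show ?thesis by simp
  qed
  then show ?case by blast
qed

lemma integrable_inverse_1_plus_square: "integrable lborel (\<lambda>x::real. inverse (1 + x\<^sup>2))"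
proof -
  let ?f = "\<lambda>x::real. indicator {0<..} x *\<^sub>R (1 / (1 + x\<^sup>2))"
  have "einterval 0 \<infinity> = {0::real<..}" by (auto simp: einterval_def zero_ereal_def)
  then have f: "integrable lborel ?f"
    using integrable_I0i_1_div_plus_square
    by (simp add: interval_lebesgue_integrable_def set_integrable_def zero_ereal_def)
  then have "integrable lborel (\<lambda>x. ?f x + ?f (0 - x))"
    by (intro Bochner_Integration.integrable_add) (simp_all only: integrable_reflect[of ?f 0])
  moreover have "AE x in lborel. ?f x + ?f (0 - x) = inverse (1 + x\<^sup>2)"
    using AE_lborel_singleton[of 0] by eventually_elim (auto simp: indicator_def divide_inverse)
  ultimately show ?thesis
    by (subst (asm) integrable_cong_AE) auto
qed

lemma Wk_fourier_integrable:
  fixes u :: "'a::euclidean_space \<Rightarrow> complex"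
  assumes "Wk (2 * DIM('a)) u"
  shows "integrable lborel (fourier u)"
proof -
  obtain C where C: "\<And>x. norm (fourier u x) * (\<Prod>b\<in>Basis. 1 + (x \<bullet> b)\<^sup>2) \<le> C"
    using Wk_fourier_decay[of Basis u] assms by auto
  have "integrable lborel (\<lambda>x::'a. \<Prod>b\<in>Basis. complex_of_real (inverse (1 + (x \<bullet> b)\<^sup>2)))"
    by (intro integrable_lborel_prod integrable_of_real integrable_inverse_1_plus_square)
  then have i: "integrable lborel (\<lambda>x::'a. of_real C * (\<Prod>b\<in>Basis. complex_of_real (inverse (1 + (x \<bullet> b)\<^sup>2))))"
    by (rule integrable_mult_right)
  show ?thesis
  proof (rule Bochner_Integration.integrable_bound[OF i])
    show "fourier u \<in> borel_measurable lborel"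
      using continuous_fourier[of u] Wk_base[OF assms] borel_measurable_continuous_onI by auto
    have bnd: "norm (fourier u x) \<le> \<bar>C\<bar> * (\<Prod>b\<in>Basis. inverse (1 + (x \<bullet> b)\<^sup>2))" for x
    proof -
      have pos: "(\<Prod>b\<in>Basis. 1 + (x \<bullet> b)\<^sup>2) > 0"
        by (intro prod_pos) (auto simp: add_pos_nonneg)
      have "norm (fourier u x) * (\<Prod>b\<in>Basis. 1 + (x \<bullet> b)\<^sup>2) \<le> \<bar>C\<bar>"
        using C[of x] by linarith
      moreover have "(\<Prod>b\<in>Basis. inverse (1 + (x \<bullet> b)\<^sup>2)) = inverse (\<Prod>b\<in>Basis. 1 + (x \<bullet> b)\<^sup>2)"
        using prod_inversef[of "\<lambda>b. 1 + (x \<bullet> b)\<^sup>2" Basis] by (simp add: comp_def)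
      ultimately show ?thesis using pos
        by (simp only: divide_inverse[symmetric] pos_le_divide_eq)
    qed
    then show "AE x in lborel. norm (fourier u x)
        \<le> norm (of_real C * (\<Prod>b\<in>Basis. complex_of_real (inverse (1 + (x \<bullet> b)\<^sup>2))))"
    proof (intro AE_I2)
      fix x :: 'a
      have "(\<Prod>b\<in>Basis. inverse (1 + (x \<bullet> b)\<^sup>2)) \<ge> 0"
        by (intro prod_nonneg) (auto simp: add_nonneg_nonneg)
      then show "norm (fourier u x) \<le> norm (of_real C * (\<Prod>b\<in>Basis. complex_of_real (inverse (1 + (x \<bullet> b)\<^sup>2))))"
        using bnd[of x]
        unfolding of_real_prod[symmetric] of_real_mult[symmetric] norm_of_real abs_mult by simp
    qed
  qed
qed

subsection \<open>Cut-off symbols and Littlewood-Paley projections\<close>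

definition iter_deriv :: "nat \<Rightarrow> (real \<Rightarrow> 'b::real_normed_vector) \<Rightarrow> real \<Rightarrow> 'b" where
  "iter_deriv b f = ((\<lambda>u s. vector_derivative u (at s)) ^^ b) f"

lemma iter_deriv_0 [simp]: "iter_deriv 0 f = f"
  by (simp add: iter_deriv_def)

lemma iter_deriv_Suc: "iter_deriv (Suc b) f x = vector_derivative (iter_deriv b f) (at x)"
  by (simp add: iter_deriv_def)

lemma frechet_derivative_one:
  fixes f :: "real \<Rightarrow> 'b::real_normed_vector"
  assumes "(f has_vector_derivative d) (at x)"
  shows "frechet_derivative f (at x) 1 = d"
  using frechet_derivative_at[OF assms[unfolded has_vector_derivative_def]] by (metis scaleR_one)

lemma Ck_on_real_Suc:
  fixes f :: "real \<Rightarrow> 'b::real_normed_vector"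
  shows "Ck_on (Suc k) UNIV f \<longleftrightarrow> (\<forall>x. f differentiable (at x)) \<and> Ck_on k UNIV (iter_deriv 1 f)"
proof -
  have "(\<lambda>x. frechet_derivative f (at x) 1) = iter_deriv 1 f" if "\<forall>x. f differentiable (at x)"
  proof
    fix x
    have "(f has_vector_derivative vector_derivative f (at x)) (at x)"
      using that by (simp add: vector_derivative_works[symmetric])
    then show "frechet_derivative f (at x) 1 = iter_deriv 1 f x"
      by (simp add: frechet_derivative_one iter_deriv_def)
  qed
  then show ?thesis by auto
qed

lemma Ck_on_real_iter_deriv:
  fixes f :: "real \<Rightarrow> 'b::real_normed_vector"
  assumes "smooth_on UNIV f"
  shows "Ck_on k UNIV (iter_deriv b f)"
proof (induction b arbitrary: k)
  case 0
  then show ?case using assms by (simp add: smooth_on_def)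
next
  case (Suc b)
  have "iter_deriv 1 (iter_deriv b f) = iter_deriv (Suc b) f"
    by (simp add: iter_deriv_def)
  then show ?case using Suc[of "Suc k"] unfolding Ck_on_real_Suc by simp
qed

lemma has_vector_derivative_iter_deriv:
  fixes f :: "real \<Rightarrow> 'b::real_normed_vector"
  assumes "smooth_on UNIV f"
  shows "(iter_deriv b f has_vector_derivative iter_deriv (Suc b) f x) (at x)"
  using Ck_on_real_iter_deriv[OF assms, of 1 b] 
  by (simp add: iter_deriv_Suc vector_derivative_works[symmetric])

lemma continuous_on_iter_deriv:
  fixes f :: "real \<Rightarrow> 'b::real_normed_vector"
  assumes "smooth_on UNIV f"
  shows "continuous_on UNIV (iter_deriv b f)"
  using Ck_on_real_iter_deriv[OF assms, of 0 b] by simp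

lemma iter_deriv_zero_on_open:
  fixes f :: "real \<Rightarrow> 'b::real_normed_vector"
  assumes "smooth_on UNIV f" "open S" "\<And>x. x \<in> S \<Longrightarrow> f x = 0" "x \<in> S"
  shows "iter_deriv b f x = 0"
  using assms(4)
proof (induction b arbitrary: x)
  case 0
  then show ?case using assms by simp
next
  case (Suc b)
  have "((\<lambda>_. 0) has_vector_derivative 0) (at x)" by simp
  then have "(iter_deriv b f has_vector_derivative 0) (at x)"
    by (rule has_vector_derivative_transform_within_open[OF _ assms(2)]) (use Suc in auto)
  then show ?case by (simp add: iter_deriv_Suc vector_derivative_at)
qed

text \<open>All derivatives vanish on the open rays outside the interval, hence on their closures by
  continuity. Including the endpoints 1/2 and 2 makes the later frequency localisation
  strict.\<close>

lemma LP_cutoff_iter_deriv_zero: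
  assumes "LP_cutoff \<phi>" "y \<le> 1/2 \<or> 2 \<le> y"
  shows "iter_deriv b \<phi> y = 0"
proof -
  have sm: "smooth_on UNIV \<phi>" and z: "\<And>y. y \<notin> {1/2..2} \<Longrightarrow> \<phi> y = 0"
    using assms by (auto simp: LP_cutoff_def)
  have *: "iter_deriv b \<phi> y = 0" if "y \<in> closure S" "open S" "S \<inter> {1/2..2} = {}" for S y
  proof -
    have "iter_deriv b \<phi> x = 0" if "x \<in> S" for x
      by (rule iter_deriv_zero_on_open[OF sm \<open>open S\<close> _ that]) (use z \<open>S \<inter> _ = _\<close> in blast)
    moreover have "continuous_on (closure S) (iter_deriv b \<phi>)"
      using continuous_on_iter_deriv[OF sm] continuous_on_subset by blast
    ultimately show ?thesis
      using continuous_constant_on_closure that(1) by metis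
  qed
  have "{..<1/2::real} \<inter> {1/2..2} = {}" "{2<..} \<inter> {1/2..2::real} = {}" by auto
  moreover have "y \<in> closure {..<1/2} \<or> y \<in> closure {2<..}"
    using assms(2) by simp
  ultimately show ?thesis
    using *[of y "{..<1/2}"] *[of y "{2<..}"] open_lessThan open_greaterThan by blast
qed

text \<open>A class of compactly supported symbols that is closed under differentiation. All its members
  therefore satisfy \<open>Wk k\<close> for every \<open>k\<close>. It contains the multipliers of both kinds of
  projections, in space with \<open>q = 1\<close> and in time with \<open>q = 1 / m\<close>. At \<open>\<xi> = 0\<close> the factor
  \<open>norm \<xi> powr a\<close> is harmless because all derivatives of \<open>\<phi>\<close> vanish near 0.\<close>

inductive cutoff_sym :: "(real \<Rightarrow> real) \<Rightarrow> real \<Rightarrow> real \<Rightarrow> ('a::euclidean_space \<Rightarrow> complex) \<Rightarrow> bool"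
  for \<phi> c q where
  base: "cutoff_sym \<phi> c q (\<lambda>\<xi>. of_real (norm \<xi> powr a * iter_deriv b \<phi> (c * norm \<xi> powr q)))"
| add: "cutoff_sym \<phi> c q u \<Longrightarrow> cutoff_sym \<phi> c q v \<Longrightarrow> cutoff_sym \<phi> c q (\<lambda>\<xi>. u \<xi> + v \<xi>)"
| cmult: "cutoff_sym \<phi> c q u \<Longrightarrow> cutoff_sym \<phi> c q (\<lambda>\<xi>. s * u \<xi>)"
| coord: "cutoff_sym \<phi> c q u \<Longrightarrow> cutoff_sym \<phi> c q (\<lambda>\<xi>. of_real (\<xi> \<bullet> e) * u \<xi>)"

context
  fixes \<phi> :: "real \<Rightarrow> real" and c q :: real
  assumes phi: "LP_cutoff \<phi>" and c: "c > 0" and q: "q > 0"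
begin

lemma cutoff_sym_zero:
  "cutoff_sym \<phi> c q u \<Longrightarrow> c * norm \<xi> powr q \<le> 1/2 \<or> 2 \<le> c * norm \<xi> powr q \<Longrightarrow> u \<xi> = 0"
  by (induction rule: cutoff_sym.induct) (auto simp: LP_cutoff_iter_deriv_zero[OF phi])

text \<open>The gradient of the norm contributes \<open>\<xi> \<bullet> e\<close> over
  \<open>norm \<xi>\<close>. Merging that denominator with the other powers of the norm leaves a
  coordinate times a combination of generators of the class.\<close>

lemma cutoff_sym_base_derivative:
  assumes "\<xi> \<noteq> (0::'a::euclidean_space)"
  shows "((\<lambda>\<xi>::'a. complex_of_real (norm \<xi> powr a * iter_deriv b \<phi> (c * norm \<xi> powr q))) has_derivative
    (\<lambda>e. of_real (\<xi> \<bullet> e) * (of_real a * of_real (norm \<xi> powr (a - 2) * iter_deriv b \<phi> (c * norm \<xi> powr q))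
      + of_real (c * q) * of_real (norm \<xi> powr (a + q - 2) * iter_deriv (Suc b) \<phi> (c * norm \<xi> powr q))))) (at \<xi>)"
proof -
  have sm: "smooth_on UNIV \<phi>" using phi by (simp add: LP_cutoff_def)
  let ?n = "norm \<xi>"
  have n: "?n > 0" using assms by simp
  let ?g = "\<lambda>s. s powr a * iter_deriv b \<phi> (c * s powr q)"
  let ?d = "a * ?n powr (a - 1) * iter_deriv b \<phi> (c * ?n powr q)
      + iter_deriv (Suc b) \<phi> (c * ?n powr q) * (c * (q * ?n powr (q - 1))) * ?n powr a"
  have 1: "(iter_deriv b \<phi> has_real_derivative iter_deriv (Suc b) \<phi> x) (at x)" for x
    using has_vector_derivative_iter_deriv[OF sm] by (simp add: has_real_derivative_iff_has_vector_derivative)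
  have 2: "((\<lambda>s. s powr p) has_real_derivative p * ?n powr (p - 1)) (at ?n)" for p
    using n by (rule has_real_derivative_powr)
  have nd: "(norm has_derivative (\<lambda>e. sgn \<xi> \<bullet> e)) (at \<xi>)"
    using GDERIV_norm[OF assms] by (simp add: gderiv_def inner_commute)
  have "(?g has_real_derivative ?d) (at ?n)"
    by (intro DERIV_mult 2 DERIV_chain2[OF 1] DERIV_cmult)
  then have "((\<lambda>\<xi>. ?g (norm \<xi>)) has_derivative (\<lambda>e. ?d * (sgn \<xi> \<bullet> e))) (at \<xi>)"
    unfolding has_field_derivative_def
    by (rule has_derivative_compose[rotated]) (rule nd)
  then have "((\<lambda>\<xi>. complex_of_real (?g (norm \<xi>))) has_derivative (\<lambda>e. of_real (?d * (sgn \<xi> \<bullet> e)))) (at \<xi>)"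
    by (rule has_derivative_of_real)
  moreover have "?d * (sgn \<xi> \<bullet> e) = (\<xi> \<bullet> e) * (a * (?n powr (a - 2) * iter_deriv b \<phi> (c * ?n powr q))
      + (c * q) * (?n powr (a + q - 2) * iter_deriv (Suc b) \<phi> (c * ?n powr q)))" for e
  proof -
    have 1: "?n powr (a - 1) = ?n * ?n powr (a - 2)" and 2: "?n powr (q - 1) * ?n powr a
        = ?n * ?n powr (a + q - 2)"
      using n by (simp_all add: powr_mult_base powr_add[symmetric] algebra_simps)
    have "?d = ?n * (a * (?n powr (a - 2) * iter_deriv b \<phi> (c * ?n powr q))
      + (c * q) * (?n powr (a + q - 2) * iter_deriv (Suc b) \<phi> (c * ?n powr q)))"
    proof -
      have "a * (n * x) * y + z * (c * (q * w)) * v = n * (a * (x * y) + (c * q) * (p * z))"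
        if "w * v = n * p" for n x y z w v p :: real
      proof -
        have "z * (c * (q * w)) * v = z * c * q * (w * v)" by (simp only: mult_ac)
        then show ?thesis unfolding that by (simp add: algebra_simps)
      qed
      from this[OF 2] show ?thesis unfolding 1 .
    qed
    moreover have "?n * (sgn \<xi> \<bullet> e) = \<xi> \<bullet> e"
      using n by (simp add: sgn_div_norm)
    moreover have "d * s = t * X" if "d = n * X" "n * s = t" for d n X s t :: real
      unfolding that(1) that(2)[symmetric] by (simp only: mult_ac)
    ultimately show ?thesis by blast
  qed
  ultimately show ?thesis
    by (simp only: of_real_mult of_real_add)
qed

text \<open>All directions are treated in one induction: the derivative is kept as a function of the
  direction \<open>e\<close> with values in the class.\<close>

lemma cutoff_sym_derivative:
  fixes u :: "'a::euclidean_space \<Rightarrow> complex"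
  assumes "cutoff_sym \<phi> c q u"
  shows "\<exists>V. (\<forall>e. cutoff_sym \<phi> c q (V e)) \<and> (\<forall>\<xi>. (u has_derivative (\<lambda>e. V e \<xi>)) (at \<xi>))"
  using assms
proof (induction rule: cutoff_sym.induct)
  case (base a b)
  let ?u = "\<lambda>\<xi>::'a. complex_of_real (norm \<xi> powr a * iter_deriv b \<phi> (c * norm \<xi> powr q))"
  let ?V = "\<lambda>e \<xi>::'a. of_real (\<xi> \<bullet> e) * (of_real a * of_real (norm \<xi> powr (a - 2) * iter_deriv b \<phi> (c
      * norm \<xi> powr q))
      + of_real (c * q) * of_real (norm \<xi> powr (a
          + q - 2) * iter_deriv (Suc b) \<phi> (c * norm \<xi> powr q))) :: complex"
  have "(?u has_derivative (\<lambda>e. ?V e \<xi>)) (at \<xi>)" for \<xi>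
  proof (cases "\<xi> = 0")
    case True
    \<comment> \<open>At the origin both sides are 0: the symbol vanishes where
      \<open>c * norm \<xi> powr q < 1/2\<close>, and the proposed derivative carries the factor
      \<open>\<xi> \<bullet> e\<close>.\<close>
    have "continuous_on UNIV (\<lambda>\<xi>::'a. c * norm \<xi> powr q)"
      using q by (intro continuous_intros continuous_on_powr') auto
    then have op: "open {\<xi>::'a. c * norm \<xi> powr q < 1/2}"
      by (intro open_Collect_less) auto
    have "((\<lambda>_. 0) has_derivative (\<lambda>_. 0)) (at (0::'a))" by simp
    then have "(?u has_derivative (\<lambda>_. 0)) (at 0)"
      by (rule has_derivative_transform_within_open[OF _ op])
         (auto simp: LP_cutoff_iter_deriv_zero[OF phi])
    then show ?thesis using True by simp
  next
    case False
    then show ?thesis by (rule cutoff_sym_base_derivative)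
  qed
  moreover have "cutoff_sym \<phi> c q (?V e)" for e
    by (intro cutoff_sym.intros)
  ultimately show ?case by (intro exI[of _ ?V]) auto
next
  case (add u v)
  then obtain V W where "\<forall>e. cutoff_sym \<phi> c q (V e)" "\<forall>\<xi>. (u has_derivative (\<lambda>e. V e \<xi>)) (at \<xi>)"
    "\<forall>e. cutoff_sym \<phi> c q (W e)" "\<forall>\<xi>. (v has_derivative (\<lambda>e. W e \<xi>)) (at \<xi>)"
    by blast
  then show ?case
    by (intro exI[of _ "\<lambda>e \<xi>. V e \<xi> + W e \<xi>"]) (auto intro: cutoff_sym.add has_derivative_add)
next
  case (cmult u s)
  then obtain V where "\<forall>e. cutoff_sym \<phi> c q (V e)" "\<forall>\<xi>. (u has_derivative (\<lambda>e. V e \<xi>)) (at \<xi>)"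
    by blast
  then show ?case
    by (intro exI[of _ "\<lambda>e \<xi>. s * V e \<xi>"]) (auto intro: cutoff_sym.cmult has_derivative_mult_right)
next
  case (coord u f)
  then obtain V where V: "\<forall>e. cutoff_sym \<phi> c q (V e)" "\<forall>\<xi>. (u has_derivative (\<lambda>e. V e \<xi>)) (at \<xi>)"
    by blast
  have "((\<lambda>\<xi>. of_real (\<xi> \<bullet> f) * u \<xi>) has_derivative (\<lambda>e. of_real (\<xi> \<bullet> f) * V e \<xi>
      + of_real (e \<bullet> f) * u \<xi>)) (at \<xi>)" for \<xi>
    using V(2) by (intro has_derivative_mult has_derivative_of_real has_derivative_inner_left
        has_derivative_ident) auto
  moreover have "cutoff_sym \<phi> c q (\<lambda>\<xi>. of_real (\<xi> \<bullet> f) * V e \<xi> + of_real (e \<bullet> f) * u \<xi>)" for e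
    using V(1) coord by (intro cutoff_sym.add cutoff_sym.coord cutoff_sym.cmult) auto
  ultimately show ?case
    by (intro exI[of _ "\<lambda>e \<xi>. of_real (\<xi> \<bullet> f) * V e \<xi> + of_real (e \<bullet> f) * u \<xi>"]) auto
qed

lemma cutoff_sym_continuous:
  fixes u :: "'a::euclidean_space \<Rightarrow> complex"
  assumes "cutoff_sym \<phi> c q u"
  shows "continuous_on UNIV u"
proof -
  obtain V where "\<And>\<xi>. (u has_derivative (\<lambda>e. V e \<xi>)) (at \<xi>)"
    using cutoff_sym_derivative[OF assms] by blast
  then show ?thesis
    using has_derivative_continuous by (metis continuous_at_imp_continuous_on)
qed

lemma cutoff_sym_directional:
  fixes u :: "'a::euclidean_space \<Rightarrow> complex"
  assumes "cutoff_sym \<phi> c q u"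
  shows "\<exists>v. cutoff_sym \<phi> c q v \<and> (\<forall>x s. ((\<lambda>s. u (x + s *\<^sub>R b)) has_vector_derivative v (x + s *\<^sub>R b)) (at s))"
proof -
  obtain V where V: "\<And>e. cutoff_sym \<phi> c q (V e)" "\<And>\<xi>. (u has_derivative (\<lambda>e. V e \<xi>)) (at \<xi>)"
    using cutoff_sym_derivative[OF assms] by blast
  have "((\<lambda>s. u (x + s *\<^sub>R b)) has_vector_derivative V b (x + s *\<^sub>R b)) (at s)" for x s
  proof -
    have "((\<lambda>s. x + s *\<^sub>R b) has_derivative (\<lambda>h. h *\<^sub>R b)) (at s)"
      by (auto intro!: derivative_eq_intros)
    then have "((\<lambda>s. u (x + s *\<^sub>R b)) has_derivative (\<lambda>h. V (h *\<^sub>R b) (x + s *\<^sub>R b))) (at s)"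
      using V(2) by (rule has_derivative_compose)
    moreover have "V (h *\<^sub>R b) (x + s *\<^sub>R b) = h *\<^sub>R V b (x + s *\<^sub>R b)" for h
      using linear_scale[OF has_derivative_linear[OF V(2)]] by blast
    ultimately show ?thesis by (simp add: has_vector_derivative_def)
  qed
  then show ?thesis using V(1) by blast
qed

lemma cutoff_sym_support:
  fixes u :: "'a::euclidean_space \<Rightarrow> complex"
  assumes "cutoff_sym \<phi> c q u" "\<xi> \<notin> cball 0 ((2 / c) powr (1 / q))"
  shows "u \<xi> = 0"
proof -
  have "(2 / c) powr (1 / q) \<le> norm \<xi>" using assms by (simp add: dist_norm)
  then have "((2 / c) powr (1 / q)) powr q \<le> norm \<xi> powr q"
    using q by (intro powr_mono2) auto
  then have "2 / c \<le> norm \<xi> powr q" using q c by (simp add: powr_powr)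
  then have "2 \<le> c * norm \<xi> powr q" using c by (simp add: field_simps)
  then show ?thesis using cutoff_sym_zero[OF assms(1)] by blast
qed

lemma cutoff_sym_integrable_mult:
  fixes u v :: "'a::euclidean_space \<Rightarrow> complex"
  assumes "cutoff_sym \<phi> c q u" "continuous_on UNIV v"
  shows "integrable lborel (\<lambda>\<xi>. u \<xi> * v \<xi>)"
proof -
  let ?S = "cball (0::'a) ((2 / c) powr (1 / q))"
  have "integrable lborel (\<lambda>x. indicator ?S x *\<^sub>R (u x * v x))"
    by (rule borel_integrable_compact)
       (auto intro!: continuous_intros continuous_on_subset[OF cutoff_sym_continuous[OF assms(1)]]
           continuous_on_subset[OF assms(2)])
  also have "(\<lambda>x. indicator ?S x *\<^sub>R (u x * v x)) = (\<lambda>\<xi>. u \<xi> * v \<xi>)"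
    using cutoff_sym_support[OF assms(1)] by (fastforce simp: indicator_def)
  finally show ?thesis .
qed

lemma cutoff_sym_integrable:
  fixes u :: "'a::euclidean_space \<Rightarrow> complex"
  assumes "cutoff_sym \<phi> c q u"
  shows "integrable lborel u"
  using cutoff_sym_integrable_mult[OF assms continuous_on_const[of UNIV 1]] by simp

lemma cutoff_sym_bounded:
  fixes u :: "'a::euclidean_space \<Rightarrow> complex"
  assumes "cutoff_sym \<phi> c q u"
  shows "bounded (range u)"
proof -
  let ?S = "cball (0::'a) ((2 / c) powr (1 / q))"
  have "compact (u ` ?S)"
    by (intro compact_continuous_image continuous_on_subset[OF cutoff_sym_continuous[OF assms]]) auto
  then have "bounded (insert 0 (u ` ?S))" by (simp add: compact_imp_bounded)
  then show ?thesis
    by (rule bounded_subset) (use cutoff_sym_support[OF assms] in blast)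
qed

lemma cutoff_sym_Wk:
  fixes u :: "'a::euclidean_space \<Rightarrow> complex"
  assumes "cutoff_sym \<phi> c q u"
  shows "Wk k u"
  using assms
proof (induction k arbitrary: u)
  case (Suc k)
  then show ?case
    using cutoff_sym_directional[OF Suc.prems] cutoff_sym_continuous cutoff_sym_integrable
    unfolding Wk.simps by metis
qed (auto intro: cutoff_sym_continuous cutoff_sym_integrable)

text \<open>In \<open>LP_time\<close> the multiplier acts on a test function, so the product has to
  have an integrable transform. The index \<open>i\<close> absorbs the derivatives that fall on
  \<open>h\<close>.\<close>

lemma cutoff_sym_Wk_mult:
  fixes u :: "real \<Rightarrow> complex"
  assumes "cutoff_sym \<phi> c q u" and h: "smooth_on UNIV h"
  shows "Wk k (\<lambda>\<tau>. u \<tau> * iter_deriv i h \<tau>)"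
  using assms(1)
proof (induction k arbitrary: u i)
  case 0
  then show ?case
    using cutoff_sym_integrable_mult[OF 0 continuous_on_iter_deriv[OF h]]
      continuous_on_mult[OF cutoff_sym_continuous[OF 0] continuous_on_iter_deriv[OF h]] by simp
next
  case (Suc k)
  obtain v where v: "cutoff_sym \<phi> c q v" "\<forall>x s. ((\<lambda>s. u (x + s *\<^sub>R 1)) has_vector_derivative v (x
      + s *\<^sub>R 1)) (at s)"
    using cutoff_sym_directional[OF Suc.prems] by blast
  have "Wk k (\<lambda>\<tau>. u \<tau> * iter_deriv (Suc i) h \<tau> + v \<tau> * iter_deriv i h \<tau>)"
    by (intro Wk_add Suc.IH Suc.prems v)
  moreover have "((\<lambda>s. u (x + s *\<^sub>R 1) * iter_deriv i h (x + s *\<^sub>R 1)) has_vector_derivative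
     (u (x + s *\<^sub>R 1) * iter_deriv (Suc i) h (x + s *\<^sub>R 1) + v (x + s *\<^sub>R 1) * iter_deriv i h (x
         + s *\<^sub>R 1))) (at s)" for x s :: real
  proof -
    have "((\<lambda>s. x + s *\<^sub>R 1) has_vector_derivative 1) (at s)"
      by (auto intro!: derivative_eq_intros)
    then have "((iter_deriv i h \<circ> (\<lambda>s. x + s *\<^sub>R 1)) has_vector_derivative 1 *\<^sub>R iter_deriv (Suc i) h (x
        + s *\<^sub>R 1)) (at s)"
      by (rule vector_diff_chain_at) (rule has_vector_derivative_iter_deriv[OF h])
    then have "((\<lambda>s. iter_deriv i h (x + s *\<^sub>R 1)) has_vector_derivative iter_deriv (Suc i) h (x + s *\<^sub>R 1)) (at s)"
      by (simp add: comp_def)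
    then show ?thesis using v(2) by (intro has_vector_derivative_mult) auto
  qed
  ultimately show ?case
    using cutoff_sym_integrable_mult[OF Suc.prems continuous_on_iter_deriv[OF h]]
      continuous_on_mult[OF cutoff_sym_continuous[OF Suc.prems] continuous_on_iter_deriv[OF h]] by auto
qed

end

lemma cutoff_sym_space:
  assumes "LP_cutoff \<phi>"
  shows "cutoff_sym \<phi> (2 powr (- of_int k)) 1 (\<lambda>\<xi>::'a::euclidean_space. complex_of_real (\<phi> (2 powr (- of_int k)
      * norm \<xi>)))"
proof -
  \<comment> \<open>At the origin \<open>0 powr 0 = 0\<close> annihilates the generator; the
    multiplier agrees since \<phi> vanishes at 0.\<close>
  have "(\<lambda>\<xi>::'a. complex_of_real (\<phi> (2 powr (- of_int k) * norm \<xi>))) =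
    (\<lambda>\<xi>. complex_of_real (norm \<xi> powr 0 * iter_deriv 0 \<phi> (2 powr (- of_int k) * norm \<xi> powr 1)))"
    using LP_cutoff_iter_deriv_zero[OF assms, of 0 0] by auto
  then show ?thesis by (simp only: cutoff_sym.base)
qed

lemma time_cutoff_dilate:
  assumes "m \<ge> 1"
  shows "time_cutoff m \<phi> (2 powr (- m * of_int k) * \<bar>\<tau>\<bar>) = \<phi> (2 powr (- of_int k) * \<bar>\<tau>\<bar> powr (1 / m))"
  using assms by (simp add: time_cutoff_def powr_mult powr_powr)

lemma cutoff_sym_time:
  assumes "LP_cutoff \<phi>"
  shows "cutoff_sym \<phi> c (1 / m) (\<lambda>\<tau>::real. complex_of_real (\<phi> (c * \<bar>\<tau>\<bar> powr (1 / m))))"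
proof -
  have "(\<lambda>\<tau>::real. complex_of_real (\<phi> (c * \<bar>\<tau>\<bar> powr (1 / m)))) =
    (\<lambda>\<tau>. complex_of_real (norm \<tau> powr 0 * iter_deriv 0 \<phi> (c * norm \<tau> powr (1 / m))))"
    using LP_cutoff_iter_deriv_zero[OF assms, of 0 0] by auto
  then show ?thesis by (simp only: cutoff_sym.base)
qed

section \<open>Convolution and Fourier multipliers\<close>

definition conv :: "('a::euclidean_space \<Rightarrow> complex) \<Rightarrow> ('a \<Rightarrow> complex) \<Rightarrow> 'a \<Rightarrow> complex" where
  "conv k h x = (LINT y|lborel. k (x - y) * h y)"

lemma inv_fourier_eq_fourier:
  "inv_fourier u x = 1 / (2 * pi) ^ DIM('a) * fourier u (- x)" for x :: "'a::euclidean_space"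
  unfolding inv_fourier_def fourier_def by (simp add: inner_commute)

lemma fourier_conv:
  assumes k: "integrable lborel k" and f: "integrable lborel f"
  shows "fourier (conv k f) \<xi> = fourier k \<xi> * fourier f \<xi>"
proof -
  have [measurable]: "k \<in> borel_measurable borel" "f \<in> borel_measurable borel" using k f by auto
  have tr: "(LINT x|lborel. cis (- (x \<bullet> \<xi>)) * (k (x - y) * f y)) = fourier k \<xi> * (cis (- (y \<bullet> \<xi>)) * f y)" for y
  proof -
    have "(LINT x|lborel. cis (- (x \<bullet> \<xi>)) * (k (x - y) * f y))
        = (LINT x|lborel. (cis (- (x \<bullet> \<xi>)) * k x) * (cis (- (y \<bullet> \<xi>)) * f y))"
    proof -
      have "cis (- ((y + x) \<bullet> \<xi>)) = cis (- (x \<bullet> \<xi>)) * cis (- (y \<bullet> \<xi>))" for x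
        by (simp add: inner_add_left cis_mult algebra_simps)
      then show ?thesis
        using LINT_translate[of 1 "\<lambda>x. cis (- (x \<bullet> \<xi>)) * (k (x - y) * f y)" y]
        by (simp add: mult_ac)
    qed
    then show ?thesis by (simp add: fourier_def)
  qed
  have "fourier (conv k f) \<xi> = (LINT x|lborel. LINT y|lborel. cis (- (x \<bullet> \<xi>)) * (k (x - y) * f y))"
    unfolding fourier_def conv_def by simp
  also have "\<dots> = (LINT y|lborel. LINT x|lborel. cis (- (x \<bullet> \<xi>)) * (k (x - y) * f y))"
    by (rule lborel_pair.Fubini_integral[symmetric], rule integrable_pair_convolution[OF k f])
       (auto simp: norm_mult split_def)
  also have "\<dots> = fourier k \<xi> * fourier f \<xi>"
    unfolding tr by (simp add: fourier_def)
  finally show ?thesis .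
qed

lemma inv_fourier_mult:
  assumes u: "integrable lborel u" and f: "integrable lborel f"
  shows "inv_fourier (\<lambda>\<xi>. u \<xi> * fourier f \<xi>) x = conv (inv_fourier u) f x"
proof -
  have [measurable]: "u \<in> borel_measurable borel" "f \<in> borel_measurable borel" using u f by auto
  have "(LINT \<xi>|lborel. cis (x \<bullet> \<xi>) * (u \<xi> * fourier f \<xi>)) =
    (LINT \<xi>|lborel. LINT y|lborel. cis ((x - y) \<bullet> \<xi>) * (u \<xi> * f y))"
  proof -
    have "cis ((x - y) \<bullet> \<xi>) = cis (x \<bullet> \<xi>) * cis (- (y \<bullet> \<xi>))" for y \<xi>
      by (simp add: inner_diff_left cis_mult)
    then show ?thesis
      unfolding fourier_def integral_mult_right_zero[symmetric] by (simp only: mult_ac)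
  qed
  also have "\<dots> = (LINT y|lborel. LINT \<xi>|lborel. cis ((x - y) \<bullet> \<xi>) * (u \<xi> * f y))"
    by (rule lborel_pair.Fubini_integral[symmetric], rule integrable_pair_bound[OF u f])
       (auto simp: norm_mult split_def)
  also have "\<dots> = (LINT y|lborel. (LINT \<xi>|lborel. cis ((x - y) \<bullet> \<xi>) * u \<xi>) * f y)"
    by (simp only: mult.assoc[symmetric] integral_mult_left_zero)
  finally show ?thesis
    unfolding inv_fourier_def conv_def by (simp only: mult.assoc integral_mult_right_zero)
qed

lemma
  fixes u :: "'a::euclidean_space \<Rightarrow> complex"
  assumes u: "integrable lborel u" "continuous_on UNIV u" "bounded (range u)"
    and fu: "integrable lborel (fourier u)"
  shows integrable_inv_fourier: "integrable lborel (inv_fourier u)"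
    and fourier_inv_fourier: "fourier (inv_fourier u) \<xi> = u \<xi>"
proof -
  have "integrable lborel (\<lambda>x. 1 / (2 * pi) ^ DIM('a) * fourier u (0 - x))"
    by (intro integrable_mult_right) (simp only: integrable_reflect fu)
  then show "integrable lborel (inv_fourier u)"
    by (simp add: inv_fourier_eq_fourier[abs_def])
  have "fourier (inv_fourier u) \<xi> = (LINT x|lborel. 1 / (2 * pi) ^ DIM('a) * (cis (- (x \<bullet> \<xi>)) * fourier u (- x)))"
    unfolding fourier_def[of "inv_fourier u"] inv_fourier_eq_fourier by (simp add: mult_ac)
  also have "\<dots> = 1 / (2 * pi) ^ DIM('a) * (LINT x|lborel. cis (- (x \<bullet> \<xi>)) * fourier u (- x))"
    by simp
  also have "(LINT x|lborel. cis (- (x \<bullet> \<xi>)) * fourier u (- x)) = (LINT x|lborel. cis (\<xi> \<bullet> x) * fourier u x)"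
    using LINT_reflect[of "\<lambda>x. cis (\<xi> \<bullet> x) * fourier u x" 0] by (simp add: inner_commute)
  also have "1 / (2 * pi) ^ DIM('a) * (LINT x|lborel. cis (\<xi> \<bullet> x) * fourier u x) = u \<xi>"
    by (subst fourier_inversion[OF u fu]) simp
  finally show "fourier (inv_fourier u) \<xi> = u \<xi>" .
qed

text \<open>\<open>LP_space\<close> ends with an inverse transform and \<open>dispersive\<close>
  begins with a transform. They cancel because the kernel of the smooth compactly supported
  multiplier is integrable, so that the projection is a convolution of integrable functions.\<close>

lemma fourier_LP_space:
  fixes f :: "'a::euclidean_space \<Rightarrow> complex"
  assumes phi: "LP_cutoff \<phi>" and f: "integrable lborel f"
  shows "fourier (LP_space \<phi> k f) \<xi> = of_real (\<phi> (2 powr (- of_int k) * norm \<xi>)) * fourier f \<xi>"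
proof -
  let ?u = "\<lambda>\<xi>::'a. complex_of_real (\<phi> (2 powr (- of_int k) * norm \<xi>))"
  have pos: "2 powr (- real_of_int k) > 0" "(1::real) > 0" by simp_all
  note N = cutoff_sym_space[OF phi, of k, where 'a='a]
  have u: "integrable lborel ?u" "continuous_on UNIV ?u" "bounded (range ?u)" "integrable lborel (fourier ?u)"
    using cutoff_sym_integrable[OF phi pos N] cutoff_sym_continuous[OF phi pos N] cutoff_sym_bounded[OF phi pos N]
      Wk_fourier_integrable[OF cutoff_sym_Wk[OF phi pos N]] by auto
  have "LP_space \<phi> k f = conv (inv_fourier ?u) f"
    unfolding LP_space_def using inv_fourier_mult[OF u(1) f] by auto
  then show ?thesis
    by (simp add: fourier_conv[OF integrable_inv_fourier[OF u] f] fourier_inv_fourier[OF u])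
qed

section \<open>Test functions and the action of the time projections\<close>

text \<open>Modulated Gaussians times polynomials are closed under differentiation and under
  multiplication by powers of the variable. Membership in the Schwartz class thereby reduces to
  boundedness of the class members.\<close>

definition poly_gauss :: "real \<Rightarrow> real \<Rightarrow> complex poly \<Rightarrow> real \<Rightarrow> complex" where
  "poly_gauss \<epsilon> s p \<tau> = poly p (of_real \<tau>) * exp (\<i> * of_real s * of_real \<tau> - of_real (\<epsilon>\<^sup>2 / 2) * (of_real \<tau>)\<^sup>2)"

lemma poly_gauss_derivative:
  "(poly_gauss \<epsilon> s p has_vector_derivative poly_gauss \<epsilon> s (pderiv p
      + [:\<i> * of_real s, - of_real (\<epsilon>\<^sup>2):] * p) \<tau>) (at \<tau>)"
proof -
  let ?H = "\<lambda>z. poly p z * exp (\<i> * of_real s * z - of_real (\<epsilon>\<^sup>2 / 2) * z\<^sup>2)"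
  have "(?H has_field_derivative poly (pderiv p
      + [:\<i> * of_real s, - of_real (\<epsilon>\<^sup>2):] * p) z * exp (\<i> * of_real s * z - of_real (\<epsilon>\<^sup>2 / 2) * z\<^sup>2)) (at z)" for z
    by (auto intro!: derivative_eq_intros poly_DERIV simp: algebra_simps power2_eq_square)
  from has_vector_derivative_real_field[OF this[of "of_real \<tau>"], of UNIV] show ?thesis
    by (simp add: poly_gauss_def[abs_def])
qed

lemma Ck_on_poly_gauss: "Ck_on k UNIV (poly_gauss \<epsilon> s p)"
proof (induction k arbitrary: p)
  case 0
  then show ?case
    unfolding poly_gauss_def[abs_def] by (auto intro!: continuous_intros)
next
  case (Suc k)
  have "iter_deriv 1 (poly_gauss \<epsilon> s p) = poly_gauss \<epsilon> s (pderiv p + [:\<i> * of_real s, - of_real (\<epsilon>\<^sup>2):] * p)"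
    using poly_gauss_derivative by (auto simp: iter_deriv_def vector_derivative_at)
  then show ?case
    using Suc differentiableI_vector[OF poly_gauss_derivative] unfolding Ck_on_real_Suc by metis
qed

lemma bounded_poly_gauss:
  assumes "\<epsilon> > 0"
  shows "bounded (range (poly_gauss \<epsilon> s p))"
proof -
  have nrm: "norm (poly_gauss \<epsilon> s p \<tau>) = norm (poly p (of_real \<tau>)) * exp (- (\<epsilon>\<^sup>2 / 2 * \<tau>\<^sup>2))" for p \<tau>
    by (simp add: poly_gauss_def norm_mult power2_eq_square)
  \<comment> \<open>The bound comes from \<open>(?y / n) ^ n \<le> exp ?y\<close>. Passing to the
    square of \<open>\<bar>\<tau>\<bar> ^ n\<close> first makes even the odd powers expressible in
    \<open>?y\<close>.\<close>
  have mono: "\<bar>\<tau>\<bar> ^ n * exp (- (\<epsilon>\<^sup>2 / 2 * \<tau>\<^sup>2)) \<le> 1 + (2 / \<epsilon>\<^sup>2) ^ n * real n ^ n" for n \<tau>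
  proof -
    let ?y = "\<epsilon>\<^sup>2 / 2 * \<tau>\<^sup>2"
    have y: "?y \<ge> 0" by simp
    have yn: "?y ^ n \<le> real n ^ n * exp ?y"
    proof (cases "n = 0")
      case False
      have "?y / n \<le> exp (?y / n)" using exp_ge_add_one_self[of "?y / n"] by linarith
      then have "(?y / n) ^ n \<le> exp (?y / n) ^ n" using y by (intro power_mono) auto
      also have "\<dots> = exp ?y" using False by (simp flip: exp_of_nat_mult)
      finally show ?thesis using False by (simp add: power_divide field_simps)
    qed simp
    have "\<bar>\<tau>\<bar> ^ n \<le> 1 + (\<bar>\<tau>\<bar> ^ n)\<^sup>2"
      using zero_le_power2[of "\<bar>\<tau>\<bar> ^ n - 1/2"] by (simp add: power2_eq_square algebra_simps)
    also have "(\<bar>\<tau>\<bar> ^ n)\<^sup>2 = (2 / \<epsilon>\<^sup>2) ^ n * ?y ^ n"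
    proof -
      have "(\<bar>\<tau>\<bar> ^ n)\<^sup>2 = (\<bar>\<tau>\<bar>\<^sup>2) ^ n" by (simp only: power_mult[symmetric] mult.commute)
      also have "\<bar>\<tau>\<bar>\<^sup>2 = 2 / \<epsilon>\<^sup>2 * ?y" using assms by simp
      finally show ?thesis by (simp only: power_mult_distrib)
    qed
    also have "1 + (2 / \<epsilon>\<^sup>2) ^ n * ?y ^ n \<le> exp ?y + (2 / \<epsilon>\<^sup>2) ^ n * (real n ^ n * exp ?y)"
      using y by (intro add_mono mult_left_mono yn) auto
    also have "\<dots> = (1 + (2 / \<epsilon>\<^sup>2) ^ n * real n ^ n) * exp ?y"
      by (simp add: algebra_simps)
    finally have "\<bar>\<tau>\<bar> ^ n * exp (- ?y) \<le> (1 + (2 / \<epsilon>\<^sup>2) ^ n * real n ^ n) * exp ?y * exp (- ?y)"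
      by (intro mult_right_mono) auto
    then show ?thesis by (simp add: mult.assoc flip: exp_add)
  qed
  have "\<exists>B. \<forall>\<tau>. \<bar>\<tau>\<bar> ^ n * norm (poly_gauss \<epsilon> s p \<tau>) \<le> B" for n
  proof (induction p arbitrary: n)
    case 0
    then show ?case by (auto simp: poly_gauss_def[abs_def])
  next
    case (pCons a p)
    obtain B where B: "\<And>\<tau>. \<bar>\<tau>\<bar> ^ Suc n * norm (poly_gauss \<epsilon> s p \<tau>) \<le> B" using pCons by blast
    have "\<bar>\<tau>\<bar> ^ n * norm (poly_gauss \<epsilon> s (pCons a p) \<tau>) \<le> norm a * (1 + (2 / \<epsilon>\<^sup>2) ^ n * real n ^ n) + B" for \<tau>
    proof -
      let ?E = "exp (- (\<epsilon>\<^sup>2 / 2 * \<tau>\<^sup>2))"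
      have "norm (poly (pCons a p) (complex_of_real \<tau>)) \<le> norm a + \<bar>\<tau>\<bar> * norm (poly p (complex_of_real \<tau>))"
        using norm_triangle_ineq[of a "of_real \<tau> * poly p (of_real \<tau>)"] by (simp add: norm_mult)
      then have "\<bar>\<tau>\<bar> ^ n * (norm (poly (pCons a p) (complex_of_real \<tau>)) * ?E) \<le>
         \<bar>\<tau>\<bar> ^ n * ((norm a + \<bar>\<tau>\<bar> * norm (poly p (complex_of_real \<tau>))) * ?E)"
        by (intro mult_left_mono mult_right_mono) auto
      also have "\<dots> = norm a * (\<bar>\<tau>\<bar> ^ n * ?E) + \<bar>\<tau>\<bar> ^ Suc n * norm (poly_gauss \<epsilon> s p \<tau>)"
        by (simp add: nrm algebra_simps)
      also have "\<dots> \<le> norm a * (1 + (2 / \<epsilon>\<^sup>2) ^ n * real n ^ n) + B"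
        by (intro add_mono mult_left_mono mono B) auto
      finally show ?thesis by (simp only: nrm)
    qed
    then show ?case by blast
  qed
  from this[of 0] show ?thesis by (auto simp: bounded_iff)
qed

lemma schwartz_poly_gauss:
  assumes "\<epsilon> > 0"
  shows "schwartz (poly_gauss \<epsilon> s p)"
proof -
  have it: "\<exists>p'. iter_deriv b (poly_gauss \<epsilon> s p) = poly_gauss \<epsilon> s p'" for b
  proof (induction b)
    case (Suc b)
    then obtain p' where p': "iter_deriv b (poly_gauss \<epsilon> s p) = poly_gauss \<epsilon> s p'" by blast
    have "iter_deriv (Suc b) (poly_gauss \<epsilon> s p) \<tau>
        = poly_gauss \<epsilon> s (pderiv p' + [:\<i> * of_real s, - of_real (\<epsilon>\<^sup>2):] * p') \<tau>" for \<tau>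
      unfolding iter_deriv_Suc p' by (rule vector_derivative_at[OF poly_gauss_derivative])
    then show ?case by blast
  qed auto
  have "bounded (range (\<lambda>t. of_real (t ^ a) * iter_deriv b (poly_gauss \<epsilon> s p) t))" for a b
  proof -
    obtain p' where p': "iter_deriv b (poly_gauss \<epsilon> s p) = poly_gauss \<epsilon> s p'" using it by blast
    have "(\<lambda>t. of_real (t ^ a) * iter_deriv b (poly_gauss \<epsilon> s p) t) = poly_gauss \<epsilon> s (monom 1 a * p')"
      by (auto simp: p' poly_gauss_def poly_monom)
    then show ?thesis using bounded_poly_gauss[OF assms] by metis
  qed
  then show ?thesis
    unfolding schwartz_def smooth_on_def by (simp add: Ck_on_poly_gauss iter_deriv_def)
qed

text \<open>The transform of a modulated Gaussian is an approximate identity centred at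
  \<open>s\<close>, so the pairings recover the value of a bounded continuous function there. This
  is the uniqueness behind the definite description in \<open>LP_time\<close>.\<close>

lemma gaussian_test_functions_separate:
  fixes D :: "real \<Rightarrow> complex"
  assumes D: "continuous_on UNIV D" "bounded (range D)"
    and zero: "\<And>h. schwartz h \<Longrightarrow> (LINT t|lborel. D t * fourier h t) = 0"
  shows "D s = 0"
proof -
  define e where "e n = 1 / real (Suc n)" for n
  have e: "e n > 0" for n by (simp add: e_def)
  have "(LINT z|lborel. D (s - e n *\<^sub>R z) * of_real (gauss z)) = 0" for n
  proof -
    have h: "poly_gauss (e n) s 1 \<tau> = cis (s * \<tau>) * of_real (gexp (e n *\<^sub>R \<tau>))" for \<tau>
    proof -
      have "gexp (e n *\<^sub>R \<tau>) = exp (- ((e n)\<^sup>2 / 2 * \<tau>\<^sup>2))"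
        by (simp add: gexp_def power_mult_distrib)
      then have "cis (s * \<tau>) * of_real (gexp (e n *\<^sub>R \<tau>))
          = exp (\<i> * of_real (s * \<tau>)) * exp (of_real (- ((e n)\<^sup>2 / 2 * \<tau>\<^sup>2)))"
        by (simp only: cis_conv_exp exp_of_real)
      also have "\<dots> = exp (\<i> * of_real (s * \<tau>) + of_real (- ((e n)\<^sup>2 / 2 * \<tau>\<^sup>2)))"
        by (rule exp_add[symmetric])
      also have "\<dots> = poly_gauss (e n) s 1 \<tau>"
        by (simp add: poly_gauss_def mult.assoc)
      finally show ?thesis ..
    qed
    have "fourier (poly_gauss (e n) s 1) t = of_real (gker (e n) (s - t))" for t
    proof -
      have "- (\<tau> \<bullet> t) + s * \<tau> = (s - t) \<bullet> \<tau>" for \<tau>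
        by (simp add: algebra_simps)
      then have eq: "cis (- (\<tau> \<bullet> t)) * (cis (s * \<tau>) * x) = cis ((s - t) \<bullet> \<tau>) * x" for \<tau> and x :: complex
        by (metis cis_mult mult.assoc)
      show ?thesis
        unfolding fourier_def h fourier_gexp[OF e, symmetric] eq ..
    qed
    then have "(LINT t|lborel. D t * of_real (gker (e n) (s - t))) = 0"
      using zero[OF schwartz_poly_gauss[OF e, of n s 1]] by simp
    then show ?thesis
      using gker_LINT[OF e, of D n s] by simp
  qed
  then have "(\<lambda>n. 0) \<longlonglongrightarrow> D s"
    using gauss_average_tendsto[OF D, of s] by (simp add: e_def)
  then show ?thesis
    using LIMSEQ_unique tendsto_const by blast
qed

lemma integrable_quadratic_decay:
  fixes f :: "real \<Rightarrow> complex"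
  assumes "continuous_on UNIV f" "bounded (range f)" "bounded (range (\<lambda>t. of_real (t ^ 2) * f t))"
  shows "integrable lborel f"
proof -
  obtain A where A: "\<And>t. norm (f t) \<le> A" using assms(2) by (auto simp: bounded_iff)
  obtain B where B: "\<And>t. t\<^sup>2 * norm (f t) \<le> B" using assms(3) by (auto simp: bounded_iff norm_mult norm_power)
  have "norm (f t) \<le> (A + B) * inverse (1 + t\<^sup>2)" for t
  proof -
    have pos: "1 + t\<^sup>2 > 0" by (simp add: add_pos_nonneg)
    have "norm (f t) * (1 + t\<^sup>2) \<le> A + B" using A[of t] B[of t] by (simp add: algebra_simps)
    then show ?thesis using pos by (simp add: field_simps)
  qed
  then show ?thesis
    by (intro Bochner_Integration.integrable_bound[OF integrable_mult_right[OF integrable_inverse_1_plus_square,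
        of "A + B"]])
       (use assms(1) borel_measurable_continuous_onI in \<open>auto intro: order_trans[OF _ abs_ge_self]\<close>)
qed

lemma schwartz_Wk:
  assumes "schwartz h"
  shows "Wk k (iter_deriv b h)"
proof (induction k arbitrary: b)
  have sm: "smooth_on UNIV h" using assms by (simp add: schwartz_def)
  have bd: "bounded (range (\<lambda>t. of_real (t ^ a) * iter_deriv b h t))" for a b
    using assms by (simp add: schwartz_def iter_deriv_def)
  have base: "continuous_on UNIV (iter_deriv b h) \<and> integrable lborel (iter_deriv b h)" for b
    using bd[of 0 b] bd[of 2 b] by (auto intro!: integrable_quadratic_decay continuous_on_iter_deriv[OF sm])
  {
    case 0
    then show ?case using base by simp
  next
    case (Suc k)
    have "((\<lambda>s. iter_deriv b h (x + s *\<^sub>R 1)) has_vector_derivative iter_deriv (Suc b) h (x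
        + s *\<^sub>R 1)) (at s)" for x s :: real
    proof -
      have "((\<lambda>s. x + s *\<^sub>R 1) has_vector_derivative 1) (at s)"
        by (auto intro!: derivative_eq_intros)
      then have "((iter_deriv b h \<circ> (\<lambda>s. x + s *\<^sub>R 1)) has_vector_derivative 1 *\<^sub>R iter_deriv (Suc b) h (x
          + s *\<^sub>R 1)) (at s)"
        by (rule vector_diff_chain_at) (rule has_vector_derivative_iter_deriv[OF sm])
      then show ?thesis by (simp add: comp_def)
    qed
    then have "\<exists>v. Wk k v \<and> (\<forall>x s. ((\<lambda>s. iter_deriv b h (x + s *\<^sub>R 1)) has_vector_derivative v (x
        + s *\<^sub>R 1)) (at s))"
      using Suc by blast
    then show ?case using base by simp
  }
qed

text \<open>The common form of the propagator and of all its frequency pieces. Its spectrum in t is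
  the image of \<open>g\<close> under \<Phi>, so that a multiplier in time acts on \<open>g\<close>
  through composition with \<Phi>.\<close>

definition osc_integral :: "('a::euclidean_space \<Rightarrow> real) \<Rightarrow> ('a \<Rightarrow> complex) \<Rightarrow> real \<Rightarrow> complex" where
  "osc_integral \<Phi> g t = (LINT \<xi>|lborel. cis (t * \<Phi> \<xi>) * g \<xi>)"

lemma osc_integral_continuous:
  assumes [measurable]: "\<Phi> \<in> borel_measurable borel" and g: "integrable lborel g"
  shows "continuous_on UNIV (osc_integral \<Phi> g)"
proof -
  have [measurable]: "g \<in> borel_measurable borel" using g by auto
  show ?thesis
    unfolding osc_integral_def
    by (rule continuous_on_LINT[where w="\<lambda>x. norm (g x)"])
        (use g in \<open>auto simp: norm_mult intro!: continuous_intros\<close>)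
qed

lemma osc_integral_bounded: "norm (osc_integral \<Phi> g t) \<le> (LINT \<xi>|lborel. norm (g \<xi>))"
  unfolding osc_integral_def by (rule order_trans[OF integral_norm_bound]) (auto simp: norm_mult)

text \<open>Fubini, then Fourier inversion in t at the frequency \<open>\<Phi> \<xi>\<close>. A
  distributional pairing in time becomes an ordinary integral over \<xi>.\<close>

lemma osc_integral_pairing:
  fixes u :: "real \<Rightarrow> complex"
  assumes [measurable]: "\<Phi> \<in> borel_measurable borel" and g: "integrable lborel g"
    and u: "integrable lborel u" "continuous_on UNIV u" "bounded (range u)" "integrable lborel (fourier u)"
  shows "(LINT t|lborel. osc_integral \<Phi> g t * fourier u t) = 2 * pi * (LINT \<xi>|lborel. g \<xi> * u (\<Phi> \<xi>))"
proof -
  have [measurable]: "g \<in> borel_measurable borel" "fourier u \<in> borel_measurable borel" using g u by auto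
  have "(LINT t|lborel. osc_integral \<Phi> g t * fourier u t)
      = (LINT t|lborel. LINT \<xi>|lborel. cis (t * \<Phi> \<xi>) * (g \<xi> * fourier u t))"
    unfolding osc_integral_def by (simp flip: integral_mult_left_zero add: mult.assoc)
  also have "\<dots> = (LINT \<xi>|lborel. LINT t|lborel. cis (t * \<Phi> \<xi>) * (g \<xi> * fourier u t))"
    by (rule lborel_pair.Fubini_integral[symmetric], rule integrable_pair_bound[OF u(4) g])
       (auto simp: norm_mult split_def)
  also have "\<dots> = (LINT \<xi>|lborel. g \<xi> * (LINT t|lborel. cis (\<Phi> \<xi> \<bullet> t) * fourier u t))"
    unfolding integral_mult_right_zero[symmetric] by (simp add: mult_ac)
  also have "\<dots> = (LINT \<xi>|lborel. g \<xi> * ((2 * pi) * u (\<Phi> \<xi>)))"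
    by (subst fourier_inversion[OF u]) simp
  also have "\<dots> = 2 * pi * (LINT \<xi>|lborel. g \<xi> * u (\<Phi> \<xi>))"
    unfolding integral_mult_right_zero[symmetric] by (simp add: mult_ac)
  finally show ?thesis .
qed

text \<open>Both pairings in the definition evaluate to the integral of
  \<open>g \<xi> * u (\<Phi> \<xi>) * h (\<Phi> \<xi>)\<close>, up to the same constant. Together
  with separation by Gaussians this identifies the function chosen by
  \<open>LP_time\<close>.\<close>

lemma LP_time_osc_integral:
  fixes g :: "'a::euclidean_space \<Rightarrow> complex"
  assumes phi: "LP_cutoff \<phi>" and m: "m \<ge> 1"
    and Phi[measurable]: "\<Phi> \<in> borel_measurable borel" and g: "integrable lborel g"
  shows "LP_time (time_cutoff m \<phi>) m j (osc_integral \<Phi> g) =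
    osc_integral \<Phi> (\<lambda>\<xi>. of_real (\<phi> (2 powr (- of_int j) * \<bar>\<Phi> \<xi>\<bar> powr (1 / m))) * g \<xi>)"
proof -
  define u where "u \<tau> = complex_of_real (\<phi> (2 powr (- of_int j) * \<bar>\<tau>\<bar> powr (1 / m)))" for \<tau>
  have pos: "2 powr (- real_of_int j) > 0" "1 / m > 0" using m by simp_all
  have N: "cutoff_sym \<phi> (2 powr (- real_of_int j)) (1 / m) u"
    unfolding u_def[abs_def] by (rule cutoff_sym_time[OF phi])
  have [measurable]: "g \<in> borel_measurable borel" "u \<in> borel_measurable borel"
    using g cutoff_sym_integrable[OF phi pos N] by auto
  obtain B where B: "\<And>x. norm (u x) \<le> B" using cutoff_sym_bounded[OF phi pos N] by (auto simp: bounded_iff)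
  let ?G = "osc_integral \<Phi> (\<lambda>\<xi>. u (\<Phi> \<xi>) * g \<xi>)"
  have ug: "integrable lborel (\<lambda>\<xi>. u (\<Phi> \<xi>) * g \<xi>)"
  proof (rule Bochner_Integration.integrable_bound[OF integrable_mult_right[OF integrable_norm[OF g], of B]])
    show "AE \<xi> in lborel. norm (u (\<Phi> \<xi>) * g \<xi>) \<le> norm (B * norm (g \<xi>))"
      using B by (intro AE_I2) (auto simp: norm_mult intro!: mult_right_mono intro: order_trans[OF _ abs_ge_self])
  qed measurable
  have G: "continuous_on UNIV ?G" "bounded (range ?G)"
    using osc_integral_continuous[OF Phi ug] osc_integral_bounded[of \<Phi> "\<lambda>\<xi>. u (\<Phi> \<xi>) * g \<xi>"]
        by (auto simp: bounded_iff)
  have bdd: "bounded (range f)" if "bounded (range (\<lambda>t. of_real (t ^ 0) * f t))" for f :: "real \<Rightarrow> complex"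
    using that by simp
  have pair: "(LINT t|lborel. ?G t * fourier h t)
      = (LINT t|lborel. osc_integral \<Phi> g t * fourier (\<lambda>\<tau>. u \<tau> * h \<tau>) t)"
    if h: "schwartz h" for h
  proof -
    have sm: "smooth_on UNIV h" and bh: "bounded (range h)"
      using h bdd[of h] by (auto simp: schwartz_def dest!: spec[where x=0])
    obtain B' where B': "\<And>x. norm (h x) \<le> B'" using bh by (auto simp: bounded_iff)
    have W1: "Wk 2 h" using schwartz_Wk[OF h, of 2 0] by simp
    have W2: "Wk 2 (\<lambda>\<tau>. u \<tau> * h \<tau>)" using cutoff_sym_Wk_mult[OF phi pos N sm, of 2 0] by simp
    have buh: "bounded (range (\<lambda>\<tau>. u \<tau> * h \<tau>))"
      unfolding bounded_iff using B B' by (auto simp: norm_mult intro!: exI[of _ "B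
          * B'"] mult_mono order_trans[OF norm_ge_zero B])
    have "(LINT t|lborel. ?G t * fourier h t) = 2 * pi * (LINT \<xi>|lborel. (u (\<Phi> \<xi>) * g \<xi>) * h (\<Phi> \<xi>))"
      using Wk_base[OF W1] Wk_fourier_integrable[of h] W1 bh by (intro osc_integral_pairing[OF Phi ug]) auto
    also have "\<dots> = 2 * pi * (LINT \<xi>|lborel. g \<xi> * (u (\<Phi> \<xi>) * h (\<Phi> \<xi>)))"
      by (simp add: mult_ac)
    also have "\<dots> = (LINT t|lborel. osc_integral \<Phi> g t * fourier (\<lambda>\<tau>. u \<tau> * h \<tau>) t)"
      using Wk_base[OF W2] Wk_fourier_integrable[of "\<lambda>\<tau>. u \<tau> * h \<tau>"] W2 buh
      by (intro osc_integral_pairing[OF Phi g, symmetric]) auto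
    finally show ?thesis .
  qed
  have u': "complex_of_real (time_cutoff m \<phi> (2 powr (- m * of_int j) * \<bar>\<tau>\<bar>)) = u \<tau>" for \<tau>
    unfolding u_def time_cutoff_dilate[OF m] ..
  have "(THE G. continuous_on UNIV G \<and> bounded (range G) \<and>
     (\<forall>h. schwartz h \<longrightarrow> (LINT t|lborel. G t * fourier h t) =
        (LINT t|lborel. osc_integral \<Phi> g t * fourier (\<lambda>\<tau>. u \<tau> * h \<tau>) t))) = ?G"
  proof (rule the_equality)
    fix G assume *: "continuous_on UNIV G \<and> bounded (range G) \<and>
     (\<forall>h. schwartz h \<longrightarrow> (LINT t|lborel. G t * fourier h t) =
        (LINT t|lborel. osc_integral \<Phi> g t * fourier (\<lambda>\<tau>. u \<tau> * h \<tau>) t))"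
    have int: "integrable lborel (\<lambda>t. F t * fourier h t)"
      if "continuous_on UNIV F" "bounded (range F)" "schwartz h" for F :: "real \<Rightarrow> complex" and h
    proof -
      note F = that
      have [measurable]: "F \<in> borel_measurable borel" using F(1) by (rule borel_measurable_continuous_onI)
      obtain B where B: "\<And>x. norm (F x) \<le> B" using F(2) by (auto simp: bounded_iff)
      have i: "integrable lborel (fourier h)"
        using Wk_fourier_integrable[of h] schwartz_Wk[OF F(3), of 2 0] by simp
      then have [measurable]: "fourier h \<in> borel_measurable borel" by auto
      show ?thesis
      proof (rule Bochner_Integration.integrable_bound[OF integrable_mult_right[OF integrable_norm[OF i], of B]])
        show "AE t in lborel. norm (F t * fourier h t) \<le> norm (B * norm (fourier h t))"
          using B by (intro AE_I2) (auto simp: norm_mult intro!: mult_right_mono intro: order_trans[OF _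
              abs_ge_self])
      qed measurable
    qed
    have "G s - ?G s = 0" for s
    proof (rule gaussian_test_functions_separate)
      show "continuous_on UNIV (\<lambda>s. G s - ?G s)" using * G by (intro continuous_intros) auto
      show "bounded (range (\<lambda>s. G s - ?G s))" using * G by (intro bounded_minus_comp) auto
      fix h :: "real \<Rightarrow> complex" assume h: "schwartz h"
      have "(LINT t|lborel. (G t - ?G t) * fourier h t)
          = (LINT t|lborel. G t * fourier h t) - (LINT t|lborel. ?G t * fourier h t)"
        unfolding left_diff_distrib using * G h by (intro Bochner_Integration.integral_diff int) auto
      then show "(LINT t|lborel. (G t - ?G t) * fourier h t) = 0"
        using * pair[OF h] h by simp
    qed
    then show "G = ?G" by auto
  qed (use G pair in auto)
  then show ?thesis
    unfolding LP_time_def u' by (simp add: u_def)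
qed

subsection \<open>Calderon-Zygmund kernels on the line\<close>

text \<open>The stopping-time argument behind the Calderon-Zygmund decomposition. It is carried out for
  sequences, hence for step functions only, which makes the Lebesgue differentiation theorem
  unnecessary.\<close>

lemma dyadic_stopping:
  fixes F :: "int \<Rightarrow> real"
  assumes F: "\<And>i. F i \<ge> 0"
  shows "sum F {p..<p + 2 ^ n} \<le> \<alpha> * 2 ^ n \<Longrightarrow> \<exists>Q. finite Q \<and>
    (\<forall>(a, k)\<in>Q. {a..<a + 2 ^ k} \<subseteq> {p..<p + 2 ^ n} \<and> \<alpha> * 2 ^ k < sum F {a..<a + 2 ^ k} \<and>
       sum F {a..<a + 2 ^ k} \<le> 2 * \<alpha> * 2 ^ k) \<and>
    disjoint_family_on (\<lambda>(a, k::nat). {a..<a + 2 ^ k}) Q \<and>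
    (\<forall>i\<in>{p..<p + 2 ^ n} - (\<Union>(a, k)\<in>Q. {a..<a + 2 ^ k}). F i \<le> \<alpha>)"
proof (induction n arbitrary: p)
  case 0
  have "{p..<p + 1} = {p}" by auto
  then show ?case using 0 by (intro exI[of _ "{}"]) (auto simp: disjoint_family_on_def)
next
  case (Suc n)
  let ?D = "\<lambda>(a::int, k::nat). {a..<a + 2 ^ k}"
  let ?P = "\<lambda>p Q. finite Q \<and>
    (\<forall>(a, k)\<in>Q. {a..<a + 2 ^ k} \<subseteq> {p..<p + 2 ^ n} \<and> \<alpha> * 2 ^ k < sum F {a..<a + 2 ^ k} \<and>
       sum F {a..<a + 2 ^ k} \<le> 2 * \<alpha> * 2 ^ k) \<and>
    disjoint_family_on ?D Q \<and>
    (\<forall>i\<in>{p..<p + 2 ^ n} - (\<Union>(a, k)\<in>Q. {a..<a + 2 ^ k}). F i \<le> \<alpha>)"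
  have half: "\<exists>Q. ?P a Q" if "{a..<a + 2 ^ n} \<subseteq> {p..<p + 2 ^ Suc n}" for a
  proof (cases "sum F {a..<a + 2 ^ n} \<le> \<alpha> * 2 ^ n")
    case True
    then show ?thesis using Suc.IH[of a] by blast
  next
    case False
    have "sum F {a..<a + 2 ^ n} \<le> sum F {p..<p + 2 ^ Suc n}"
      using that F by (intro sum_mono2) auto
    then have "sum F {a..<a + 2 ^ n} \<le> 2 * \<alpha> * 2 ^ n"
      using Suc.prems by simp
    then show ?thesis using False
      by (intro exI[of _ "{(a, n)}"]) (auto simp: disjoint_family_on_def)
  qed
  obtain Q1 where Q1: "?P p Q1" using half[of p] by auto
  obtain Q2 where Q2: "?P (p + 2 ^ n) Q2" using half[of "p + 2 ^ n"] by auto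
  have split: "{p..<p + 2 ^ Suc n} = {p..<p + 2 ^ n} \<union> {p + 2 ^ n..<p + 2 ^ n + 2 ^ n}" by auto
  have dis: "{p..<p + 2 ^ n} \<inter> {p + 2 ^ n..<p + 2 ^ n + 2 ^ n} = {}" by auto
  have sub: "?D P \<subseteq> {p..<p + 2 ^ n}" if "P \<in> Q1" for P using Q1 that by auto
  have sub2: "?D P \<subseteq> {p + 2 ^ n..<p + 2 ^ n + 2 ^ n}" if "P \<in> Q2" for P using Q2 that by auto
  have "disjoint_family_on ?D (Q1 \<union> Q2)"
    unfolding disjoint_family_on_def
  proof (intro ballI impI)
    fix P P' assume PP: "P \<in> Q1 \<union> Q2" "P' \<in> Q1 \<union> Q2" "P \<noteq> P'"
    have a: "?D P \<inter> ?D P' = {}" if "P \<in> Q1" "P' \<in> Q1" 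
      using Q1 that PP(3) unfolding disjoint_family_on_def by blast
    have b: "?D P \<inter> ?D P' = {}" if "P \<in> Q2" "P' \<in> Q2" 
      using Q2 that PP(3) unfolding disjoint_family_on_def by blast
    have c: "?D P \<inter> ?D P' = {}" if "P \<in> Q1" "P' \<in> Q2" 
      using sub[OF that(1)] sub2[OF that(2)] dis by blast
    have d: "?D P \<inter> ?D P' = {}" if "P \<in> Q2" "P' \<in> Q1" 
      using sub[OF that(2)] sub2[OF that(1)] dis by blast
    show "?D P \<inter> ?D P' = {}" using a b c d PP by blast
  qed
  then show ?case
    using Q1 Q2 unfolding split by (intro exI[of _ "Q1 \<union> Q2"]) (auto split: prod.splits)
qed

text \<open>The half-open cells from \<open>\<delta> * i\<close> to
  \<open>\<delta> * (i + 1)\<close> match \<open>floor\<close> and the half-open integer intervals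
  of the stopping argument.\<close>

definition step_fun :: "real \<Rightarrow> (int \<Rightarrow> 'b) \<Rightarrow> real \<Rightarrow> 'b" where
  "step_fun \<delta> F x = F \<lfloor>x / \<delta>\<rfloor>"

lemma measurable_step_fun [measurable]: "step_fun \<delta> F \<in> borel_measurable borel"
  unfolding step_fun_def[abs_def] by measurable

lemma step_fun_eq_sum:
  fixes F :: "int \<Rightarrow> 'b::real_vector"
  assumes "\<delta> > 0" "finite S" "\<And>i. i \<notin> S \<Longrightarrow> F i = 0"
  shows "step_fun \<delta> F x = (\<Sum>i\<in>S. indicator {\<delta> * of_int i..<\<delta> * (of_int i + 1)} x *\<^sub>R F i)"
proof -
  have "indicator {\<delta> * of_int i..<\<delta> * (of_int i + 1)} x = (if i = \<lfloor>x / \<delta>\<rfloor> then 1 else 0 :: real)" for i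
  proof -
    have "i = \<lfloor>x / \<delta>\<rfloor> \<longleftrightarrow> of_int i \<le> x / \<delta> \<and> x / \<delta> < of_int i + 1"
      by (metis floor_eq_iff)
    also have "\<dots> \<longleftrightarrow> x \<in> {\<delta> * of_int i..<\<delta> * (of_int i + 1)}"
      using assms(1) by (simp add: field_simps)
    finally show ?thesis by (simp add: indicator_def)
  qed
  then have "(\<Sum>i\<in>S. indicator {\<delta> * of_int i..<\<delta> * (of_int i + 1)} x *\<^sub>R F i) = (\<Sum>i\<in>S. if i
      = \<lfloor>x / \<delta>\<rfloor> then F i else 0)"
    by (intro sum.cong) auto
  also have "\<dots> = step_fun \<delta> F x"
    using assms by (simp add: step_fun_def)
  finally show ?thesis ..
qed

lemma has_integral_step_fun:
  fixes F :: "int \<Rightarrow> 'b::{banach, second_countable_topology}"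
  assumes "\<delta> > 0" "finite S" "\<And>i. i \<notin> S \<Longrightarrow> F i = 0"
  shows "has_bochner_integral lborel (step_fun \<delta> F) (\<delta> *\<^sub>R (\<Sum>i\<in>S. F i))"
proof -
  have "has_bochner_integral lborel (\<lambda>x. \<Sum>i\<in>S. indicator {\<delta> * of_int i..<\<delta> * (of_int i + 1)} x *\<^sub>R F i)
     (\<Sum>i\<in>S. \<delta> *\<^sub>R F i)"
  proof (intro has_bochner_integral_sum has_bochner_integral_scaleR_left)
    fix i
    have "has_bochner_integral lborel (indicator {\<delta> * of_int i..<\<delta> * (of_int i + 1)} :: real \<Rightarrow> real)
      (measure lborel {\<delta> * of_int i..<\<delta> * (of_int i + 1)})"
      using assms(1) by (intro has_bochner_integral_real_indicator) (auto simp: emeasure_lborel_Ico)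
    moreover have "measure lborel {\<delta> * of_int i..<\<delta> * (of_int i + 1)} = \<delta>"
      using assms(1) by (simp add: algebra_simps)
    ultimately show "has_bochner_integral lborel (indicator {\<delta> * of_int i..<\<delta> * (of_int i + 1)} :: real \<Rightarrow> real) \<delta>"
      by simp
  qed
  moreover have "step_fun \<delta> F = (\<lambda>x. \<Sum>i\<in>S. indicator {\<delta> * of_int i..<\<delta> * (of_int i + 1)} x *\<^sub>R F i)"
    using step_fun_eq_sum[OF assms] by (rule ext)
  ultimately show ?thesis
    by (simp only: scaleR_sum_right)
qed

lemma integrable_step_fun:
  fixes F :: "int \<Rightarrow> complex"
  assumes "\<delta> > 0" "finite S" "\<And>i. i \<notin> S \<Longrightarrow> F i = 0"
  shows "integrable lborel (step_fun \<delta> F)"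
  using has_integral_step_fun[OF assms] by (simp add: has_bochner_integral_iff)

lemma nn_integral_step_fun:
  fixes G :: "int \<Rightarrow> real"
  assumes "\<delta> > 0" "finite S" "\<And>i. i \<notin> S \<Longrightarrow> G i = 0" "\<And>i. G i \<ge> 0"
  shows "(\<integral>\<^sup>+x. ennreal (G \<lfloor>x / \<delta>\<rfloor>) \<partial>lborel) = ennreal (\<delta> * (\<Sum>i\<in>S. G i))"
proof -
  have "(\<integral>\<^sup>+x. ennreal (step_fun \<delta> G x) \<partial>lborel) = ennreal (LINT x|lborel. step_fun \<delta> G x)"
    using has_integral_step_fun[of \<delta> S G] assms
    by (intro nn_integral_eq_integral) (auto simp: has_bochner_integral_iff step_fun_def[abs_def])
  then show ?thesis
    using has_integral_step_fun[of \<delta> S G] assms by (simp add: step_fun_def[abs_def] has_bochner_integral_iff)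
qed

lemma bounded_step_fun:
  fixes F :: "int \<Rightarrow> 'b::real_normed_vector"
  assumes "finite S" "\<And>i. i \<notin> S \<Longrightarrow> F i = 0"
  shows "bounded (range (step_fun \<delta> F))"
proof -
  have "range (step_fun \<delta> F) \<subseteq> insert 0 (F ` S)" using assms by (auto simp: step_fun_def)
  then show ?thesis using assms(1) by (meson bounded_subset finite_imp_bounded finite_imageI finite_insert)
qed

lemma measurable_conv [measurable]:
  fixes k h :: "real \<Rightarrow> complex"
  assumes [measurable]: "k \<in> borel_measurable borel" "h \<in> borel_measurable borel"
  shows "conv k h \<in> borel_measurable borel"
  unfolding conv_def[abs_def] by measurable

lemma conv_integrable:
  fixes k h :: "real \<Rightarrow> complex"
  assumes k: "integrable lborel k" and [measurable]: "h \<in> borel_measurable borel" and h: "bounded (range h)"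
  shows "integrable lborel (\<lambda>y. k (x - y) * h y)"
proof -
  have [measurable]: "k \<in> borel_measurable borel" using k by auto
  obtain B where B: "\<And>x. norm (h x) \<le> B" using h by (auto simp: bounded_iff)
  have i: "integrable lborel (\<lambda>y. B *\<^sub>R k (x - y))"
    using k by (intro integrable_scaleR_right) (simp add: integrable_reflect)
  show ?thesis
  proof (rule Bochner_Integration.integrable_bound[OF i])
    show "AE y in lborel. norm (k (x - y) * h y) \<le> norm (B *\<^sub>R k (x - y))"
      using B by (intro AE_I2) (auto simp: norm_mult mult.commute intro!: mult_right_mono intro: order_trans[OF _
          abs_ge_self])
  qed measurable
qed

lemma nn_integral_translate:
  fixes f :: "real \<Rightarrow> ennreal"
  assumes [measurable]: "f \<in> borel_measurable borel"
  shows "(\<integral>\<^sup>+x. f (x + c) \<partial>lborel) = (\<integral>\<^sup>+x. f x \<partial>lborel)"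
  using nn_integral_real_affine[of f 1 c] by (simp add: add.commute)

lemma Markov_nn_integral:
  fixes v :: "real \<Rightarrow> ennreal"
  assumes [measurable]: "v \<in> borel_measurable borel"
  shows "c * emeasure lborel {x. c \<le> v x} \<le> (\<integral>\<^sup>+x. v x \<partial>lborel)"
proof -
  have "c * emeasure lborel {x. c \<le> v x} = (\<integral>\<^sup>+x. c * indicator {x. c \<le> v x} x \<partial>lborel)"
    by (subst nn_integral_cmult_indicator) auto
  also have "\<dots> \<le> (\<integral>\<^sup>+x. v x \<partial>lborel)"
    by (intro nn_integral_mono) (auto simp: indicator_def)
  finally show ?thesis .
qed

text \<open>The layer cake formula is used with levels \<open>exp (- s)\<close>, \<open>s\<close> ranging over the whole line:
  this avoids the derivative of \<open>powr\<close> at 0.\<close>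

lemma nn_integral_exp_atLeast:
  assumes "a > 0"
  shows "(\<integral>\<^sup>+s. ennreal (a * exp (- a * s)) * indicator {c..} s \<partial>lborel) = ennreal (exp (- a * c))"
proof -
  have "(\<integral>\<^sup>+s. ennreal (a * exp (- a * s)) * indicator {c..} s \<partial>lborel) = ennreal (0 - (- exp (- a * c)))"
  proof (rule nn_integral_FTC_atLeast)
    show "((\<lambda>s. - exp (- a * s)) has_real_derivative a * exp (- a * s)) (at s)" for s
      by (auto intro!: derivative_eq_intros)
    have "((\<lambda>s. - exp (- a * s)) \<longlongrightarrow> - 0) at_top"
      using assms by (intro tendsto_minus filterlim_compose[OF exp_at_bot]) real_asymp
    then show "((\<lambda>s. - exp (- a * s)) \<longlongrightarrow> 0) at_top" by simp
  qed (use assms in auto)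
  then show ?thesis by simp
qed

lemma exp_layer_cake:
  assumes "a > 0" "v \<ge> 0"
  shows "(\<integral>\<^sup>+s. ennreal (a * exp (- a * s)) * indicator {s. exp (- s) \<le> v} s \<partial>lborel) = ennreal (v powr a)"
proof (cases "v = 0")
  case False
  then have v: "v > 0" using assms by simp
  have "{s. exp (- s) \<le> v} = {- ln v..}"
  proof -
    have "exp (- s) \<le> v \<longleftrightarrow> - ln v \<le> s" for s
      using ln_ge_iff[OF v, of "- s"] by linarith
    then show ?thesis by auto
  qed
  then show ?thesis
    using nn_integral_exp_atLeast[OF assms(1), of "- ln v"] v by (simp add: powr_def)
qed simp

text \<open>Here the levels lie above \<open>v\<close> and the weight grows with \<open>s\<close>;
  replacing \<open>s\<close> by \<open>- s\<close> gives the same half-line integral as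
  before.\<close>

lemma exp_layer_cake_lower:
  assumes "a > 0" "v > 0"
  shows "(\<integral>\<^sup>+s. ennreal (a * exp (a * s)) * indicator {s. v \<le> exp (- s)} s \<partial>lborel) = ennreal (v powr (- a))"
proof -
  have "{s. v \<le> exp s} = {ln v..}"
    using assms(2) exp_le_cancel_iff[of "ln v"] by auto
  then have "(\<integral>\<^sup>+s. ennreal (a * exp (- a * s)) * indicator {s. v \<le> exp s} s \<partial>lborel) = ennreal (v powr (- a))"
    using nn_integral_exp_atLeast[OF assms(1), of "ln v"] assms(2) by (simp add: powr_def)
  moreover have "(\<integral>\<^sup>+s. ennreal (a * exp (a * s)) * indicator {s. v \<le> exp (- s)} s \<partial>lborel)
     = (\<integral>\<^sup>+s. ennreal (a * exp (- a * s)) * indicator {s. v \<le> exp s} s \<partial>lborel)"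
    by (subst nn_integral_real_affine[of _ "-1" 0]) (auto simp: indicator_def)
  ultimately show ?thesis by simp
qed

section \<open>The weak type (1,1) estimate\<close>

text \<open>Integrability of \<open>k\<close> is qualitative: it makes \<open>conv\<close> an honest
  integral. Only \<open>A\<close>, a bound for the square of the operator norm on L^2, and
  \<open>B\<close> enter the constants, which is what makes them uniform in the signs.\<close>

locale CZ_kernel =
  fixes k :: "real \<Rightarrow> complex" and A B :: real
  assumes k_integrable: "integrable lborel k"
    and A_nonneg: "A \<ge> 0" and B_nonneg: "B \<ge> 0"
    and L2: "\<And>h. integrable lborel h \<Longrightarrow> bounded (range h) \<Longrightarrow>
       (\<integral>\<^sup>+x. ennreal ((norm (conv k h x))\<^sup>2) \<partial>lborel) \<le> ennreal A * (\<integral>\<^sup>+x. ennreal ((norm (h x))\<^sup>2) \<partial>lborel)"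
    and Hormander: "\<And>y. (\<integral>\<^sup>+x. indicator {x. \<bar>x\<bar> > 2 * \<bar>y\<bar>} x * ennreal (norm (k (x - y) - k x)) \<partial>lborel)
        \<le> ennreal B"
begin

lemma k_measurable [measurable]: "k \<in> borel_measurable borel"
  using k_integrable by auto

text \<open>Since \<open>b\<close> has mean zero, \<open>k (x - c)\<close> may be subtracted under
  the integral. After Fubini, Hormander's condition applies for each \<open>y\<close>, because the
  removed interval contains the one of half-width \<open>2 * \<bar>y - c\<bar>\<close>.\<close>

lemma atom_bound:
  assumes [measurable]: "b \<in> borel_measurable borel" and b: "bounded (range b)" "integrable lborel b"
    and mean: "(LINT y|lborel. b y) = 0" and supp: "\<And>y. b y \<noteq> 0 \<Longrightarrow> 2 * \<bar>y - c\<bar> \<le> l"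
  shows "(\<integral>\<^sup>+x. indicator {x. \<bar>x - c\<bar> > l} x * ennreal (norm (conv k b x)) \<partial>lborel)
     \<le> ennreal B * (\<integral>\<^sup>+y. ennreal (norm (b y)) \<partial>lborel)"
proof -
  have "ennreal (norm (conv k b x)) \<le> (\<integral>\<^sup>+y. ennreal (norm (k (x - y) - k (x - c)))
      * ennreal (norm (b y)) \<partial>lborel)" for x
  proof -
    have "conv k b x = (LINT y|lborel. (k (x - y) - k (x - c)) * b y)"
      unfolding conv_def left_diff_distrib
      by (subst Bochner_Integration.integral_diff)
         (use conv_integrable[OF k_integrable _ b(1)] b(2) mean in auto)
    then have "ennreal (norm (conv k b x)) \<le> (\<integral>\<^sup>+y. ennreal (norm ((k (x - y) - k (x - c)) * b y)) \<partial>lborel)"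
      by (simp only: norm_integral_le_nn_integral)
    then show ?thesis by (simp add: norm_mult ennreal_mult)
  qed
  then have "(\<integral>\<^sup>+x. indicator {x. \<bar>x - c\<bar> > l} x * ennreal (norm (conv k b x)) \<partial>lborel)
     \<le> (\<integral>\<^sup>+x. indicator {x. \<bar>x - c\<bar> > l} x * (\<integral>\<^sup>+y. ennreal (norm (k (x - y) - k (x - c)))
         * ennreal (norm (b y)) \<partial>lborel) \<partial>lborel)"
    by (intro nn_integral_mono mult_left_mono) auto
  also have "\<dots> = (\<integral>\<^sup>+x. (\<integral>\<^sup>+y. ennreal (norm (b y)) * (indicator {x. \<bar>x - c\<bar> > l} x
      * ennreal (norm (k (x - y) - k (x - c)))) \<partial>lborel) \<partial>lborel)"
    by (subst nn_integral_cmult[symmetric]) (auto simp: mult_ac)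
  also have "\<dots> = (\<integral>\<^sup>+y. (\<integral>\<^sup>+x. ennreal (norm (b y)) * (indicator {x. \<bar>x - c\<bar> > l} x
      * ennreal (norm (k (x - y) - k (x - c)))) \<partial>lborel) \<partial>lborel)"
    by (rule lborel_pair.Fubini') measurable
  also have "\<dots> \<le> (\<integral>\<^sup>+y. ennreal (norm (b y)) * ennreal B \<partial>lborel)"
  proof (rule nn_integral_mono)
    fix y
    show "(\<integral>\<^sup>+x. ennreal (norm (b y)) * (indicator {x. \<bar>x - c\<bar> > l} x
        * ennreal (norm (k (x - y) - k (x - c)))) \<partial>lborel) \<le> ennreal (norm (b y)) * ennreal B"
    proof (cases "b y = 0")
      case False
      have "(\<integral>\<^sup>+x. indicator {x. \<bar>x - c\<bar> > l} x * ennreal (norm (k (x - y) - k (x - c))) \<partial>lborel)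
        = (\<integral>\<^sup>+x. indicator {x. \<bar>x\<bar> > l} x * ennreal (norm (k (x - (y - c)) - k x)) \<partial>lborel)"
        using nn_integral_translate[of "\<lambda>x. indicator {x. \<bar>x\<bar> > l} x
            * ennreal (norm (k (x - (y - c)) - k x))" "- c"]
        by (simp add: indicator_def)
      also have "\<dots> \<le> (\<integral>\<^sup>+x. indicator {x. \<bar>x\<bar> > 2 * \<bar>y - c\<bar>} x * ennreal (norm (k (x - (y - c)) - k x)) \<partial>lborel)"
        using supp[OF False] by (intro nn_integral_mono mult_right_mono) (auto simp: indicator_def)
      also have "\<dots> \<le> ennreal B" by (rule Hormander)
      finally show ?thesis
        by (subst nn_integral_cmult) (auto intro!: mult_left_mono)
    qed simp
  qed
  also have "\<dots> = ennreal B * (\<integral>\<^sup>+y. ennreal (norm (b y)) \<partial>lborel)"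
    by (subst nn_integral_multc) (auto simp: mult.commute)
  finally show ?thesis .
qed

text \<open>The summands stem, in this order, from the measure of the doubled intervals, from
  Chebyshev's inequality for the good part, and from the atoms.\<close>

definition "weak_const = 2 + 8 * A + 4 * B"

lemma weak_const_nonneg: "weak_const \<ge> 0"
  using A_nonneg B_nonneg by (simp add: weak_const_def)

lemma conv_add:
  assumes [measurable]: "f \<in> borel_measurable borel" "g \<in> borel_measurable borel"
    and "bounded (range f)" "bounded (range g)"
  shows "conv k (\<lambda>x. f x + g x) x = conv k f x + conv k g x"
  unfolding conv_def distrib_left
  by (intro Bochner_Integration.integral_add conv_integrable k_integrable assms)

lemma conv_sum:
  assumes "\<And>i. i \<in> I \<Longrightarrow> f i \<in> borel_measurable borel" "\<And>i. i \<in> I \<Longrightarrow> bounded (range (f i))"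
  shows "conv k (\<lambda>x. \<Sum>i\<in>I. f i x) x = (\<Sum>i\<in>I. conv k (f i) x)"
  unfolding conv_def sum_distrib_left
  by (intro Bochner_Integration.integral_sum conv_integrable k_integrable assms)

text \<open>The Calderon-Zygmund decomposition at height \<alpha>. On the selected intervals the
  good part \<open>Gd\<close> is the average of \<open>F\<close>, and the atoms \<open>Bd\<close>
  are the deviations from it. The good part is treated in L^2, the atoms off the doubled intervals,
  and the union of these intervals by its measure.\<close>

lemma weak_type:
  fixes F :: "int \<Rightarrow> complex"
  assumes d: "\<delta> > 0" and fin: "finite S" and supp: "\<And>i. i \<notin> S \<Longrightarrow> F i = 0" and l: "\<alpha> > 0"
  shows "ennreal \<alpha> * emeasure lborel {x. \<alpha> \<le> norm (conv k (step_fun \<delta> F) x)} \<le>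
    ennreal weak_const * (\<integral>\<^sup>+x. ennreal (norm (step_fun \<delta> F x)) \<partial>lborel)"
proof -
  let ?nF = "\<lambda>i. norm (F i)"
  let ?D = "\<lambda>(a::int, k::nat). {a..<a + 2 ^ k}"
  obtain M :: nat where M: "\<And>i. i \<in> S \<Longrightarrow> \<bar>i\<bar> \<le> int M"
  proof -
    have "finite (abs ` S)" using fin by simp
    then obtain z where "\<And>i. i \<in> S \<Longrightarrow> \<bar>i\<bar> \<le> z" by (meson bdd_above_finite bdd_above_def image_eqI)
    then show thesis using that[of "nat z"] by force
  qed
  obtain n1 :: nat where n1: "int (2 * M + 1) < 2 ^ n1" 
    by (metis of_nat_less_numeral_power_cancel_iff real_arch_pow[of 2 "real
        (2*M+1)"] of_nat_less_iff of_nat_numeral of_nat_power one_less_numeral_iff semiring_norm(76))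
  obtain n2 :: nat where n2: "sum ?nF S / \<alpha> < 2 ^ n2" using real_arch_pow[of 2] by auto
  \<comment> \<open>The starting interval has to contain the support, and be so long that the
    average of \<open>norm (F i)\<close> over it is at most \<alpha>.\<close>
  define n where "n = max n1 n2"
  have n: "int (2 * M + 1) < 2 ^ n" "sum ?nF S / \<alpha> < 2 ^ n"
    using order.strict_trans2[OF n1 power_increasing[of n1 n]] order.strict_trans2[OF n2 power_increasing[of n2
        n]]
    by (simp_all add: n_def)
  let ?p = "- int M"
  let ?R = "{?p..<?p + 2 ^ n}"
  have SR: "S \<subseteq> ?R" using M n(1) by fastforce
  have sumR: "(\<Sum>i\<in>?R. G i) = (\<Sum>i\<in>S. G i)" if "\<And>i. i \<notin> S \<Longrightarrow> G i = 0" for G :: "int \<Rightarrow> real"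
    using that SR by (intro sum.mono_neutral_right) auto
  have "sum ?nF ?R \<le> \<alpha> * 2 ^ n"
    using n(2) l supp by (subst sumR) (auto simp: field_simps)
  from dyadic_stopping[of ?nF, OF _ this] obtain Q where
    Q: "finite Q" "\<And>P. P \<in> Q \<Longrightarrow> ?D P \<subseteq> ?R"
      "\<And>a j. (a, j) \<in> Q \<Longrightarrow> \<alpha> * 2 ^ j < sum ?nF {a..<a + 2 ^ j}"
      "\<And>a j. (a, j) \<in> Q \<Longrightarrow> sum ?nF {a..<a + 2 ^ j} \<le> 2 * \<alpha> * 2 ^ j"
      "disjoint_family_on ?D Q" "\<And>i. i \<in> ?R - (\<Union>P\<in>Q. ?D P) \<Longrightarrow> ?nF i \<le> \<alpha>"
    by fastforce
  define N where "N = \<delta> * (\<Sum>i\<in>S. ?nF i)"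
  have N: "(\<integral>\<^sup>+x. ennreal (norm (step_fun \<delta> F x)) \<partial>lborel) = ennreal N"
    unfolding step_fun_def N_def by (rule nn_integral_step_fun) (use d fin supp in auto)
  have N0: "N \<ge> 0" unfolding N_def using d by (intro mult_nonneg_nonneg sum_nonneg) auto
  define avg where "avg P = (\<Sum>i\<in>?D P. F i) / 2 ^ snd P" for P :: "int \<times> nat"
  define Bd where "Bd P i = (if i \<in> ?D P then F i - avg P else 0)" for P i
  define Gd where "Gd i = F i - (\<Sum>P\<in>Q. Bd P i)" for i
  have card: "card (?D P) = 2 ^ snd P" for P by (cases P) (simp add: nat_power_eq)
  have avg_mult: "2 ^ snd P * norm (avg P) \<le> sum ?nF (?D P)" for P
    unfolding avg_def by (simp add: norm_divide norm_power norm_sum)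
  have sumD: "(\<Sum>P\<in>Q. sum ?nF (?D P)) \<le> sum ?nF S"
  proof -
    have "(\<Sum>P\<in>Q. sum ?nF (?D P)) = sum ?nF (\<Union>P\<in>Q. ?D P)"
      by (rule sum.UNION_disjoint[symmetric]) (use Q(1,5) in \<open>auto simp: disjoint_family_on_def\<close>)
    also have "\<dots> \<le> sum ?nF ?R" using Q(2) by (intro sum_mono2) auto
    also have "\<dots> = sum ?nF S" using supp by (intro sumR) auto
    finally show ?thesis .
  qed
  have lenD: "\<alpha> * (\<Sum>P\<in>Q. \<delta> * 2 ^ snd P) \<le> N"
  proof -
    have "\<alpha> * (\<Sum>P\<in>Q. \<delta> * 2 ^ snd P) = \<delta> * (\<Sum>P\<in>Q. \<alpha> * 2 ^ snd P)"
      by (simp add: sum_distrib_left mult_ac)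
    also have "(\<Sum>P\<in>Q. \<alpha> * 2 ^ snd P) \<le> (\<Sum>P\<in>Q. sum ?nF (?D P))"
      using Q(3) by (intro sum_mono) (auto simp: less_imp_le)
    also have "\<dots> \<le> sum ?nF S" by (rule sumD)
    finally show ?thesis unfolding N_def using d by simp
  qed
  have Gd_in: "Gd i = avg P" if "P \<in> Q" "i \<in> ?D P" for P i
  proof -
    have "(\<Sum>P'\<in>Q. Bd P' i) = (\<Sum>P'\<in>Q. if P' = P then F i - avg P else 0)"
    proof (rule sum.cong)
      fix P' assume P': "P' \<in> Q"
      have "i \<notin> ?D P'" if "P' \<noteq> P"
      proof -
        have "?D P' \<inter> ?D P = {}"
          using Q(5) P' \<open>P \<in> Q\<close> that unfolding disjoint_family_on_def by blast
        then show ?thesis using \<open>i \<in> ?D P\<close> by blast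
      qed
      then show "Bd P' i = (if P' = P then F i - avg P else 0)"
        using that unfolding Bd_def by (cases "P' = P") auto
    qed simp
    then show ?thesis using that(1) Q(1) by (simp add: Gd_def)
  qed
  have Gd_out: "Gd i = F i" if "i \<notin> (\<Union>P\<in>Q. ?D P)" for i
  proof -
    have "Bd P i = 0" if "P \<in> Q" for P
      using that \<open>i \<notin> _\<close> unfolding Bd_def by auto
    then show ?thesis by (simp add: Gd_def)
  qed
  \<comment> \<open>A selected interval carries an average of at most \<open>2 * \<alpha>\<close>,
    since stopping had not yet occurred on an interval of twice its length; elsewhere the values
    themselves are at most \<alpha>.\<close>
  have Gd_le: "norm (Gd i) \<le> 2 * \<alpha>" for i
  proof (cases "i \<in> (\<Union>P\<in>Q. ?D P)")
    case True
    then obtain P where P: "P \<in> Q" "i \<in> ?D P" by auto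
    have "2 ^ snd P * norm (avg P) \<le> sum ?nF (?D P)" by (rule avg_mult)
    also have "\<dots> \<le> 2 * \<alpha> * 2 ^ snd P"
      using Q(4)[of "fst P" "snd P"] P(1) by (simp add: split_def)
    also have "\<dots> = 2 ^ snd P * (2 * \<alpha>)" by simp
    finally have "norm (avg P) \<le> 2 * \<alpha>" by (rule mult_left_le_imp_le) simp
    then show ?thesis unfolding Gd_in[OF P] .
  next
    case False
    then show ?thesis unfolding Gd_out[OF False] using Q(6)[of i] supp[of i] SR l by fastforce
  qed
  have Gd_supp: "Gd i = 0" if "i \<notin> ?R" for i
  proof -
    have "i \<notin> (\<Union>P\<in>Q. ?D P)" "i \<notin> S" using that Q(2) SR by blast+
    then show ?thesis using Gd_out supp by simp
  qed
  have Gd_sum: "(\<Sum>i\<in>?R. norm (Gd i)) \<le> sum ?nF S"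
  proof -
    let ?U = "\<Union>P\<in>Q. ?D P"
    have U: "?U \<subseteq> ?R" using Q(2) by blast
    have "(\<Sum>i\<in>?R. norm (Gd i)) = (\<Sum>i\<in>?R - ?U. norm (Gd i)) + (\<Sum>i\<in>?U. norm (Gd i))"
      using U by (intro sum.subset_diff) auto
    also have "(\<Sum>i\<in>?U. norm (Gd i)) = (\<Sum>P\<in>Q. \<Sum>i\<in>?D P. norm (Gd i))"
      by (rule sum.UNION_disjoint) (use Q(1,5) in \<open>auto simp: disjoint_family_on_def\<close>)
    also have "\<dots> = (\<Sum>P\<in>Q. \<Sum>i\<in>?D P. norm (avg P))"
      using Gd_in by (intro sum.cong refl) auto
    also have "\<dots> = (\<Sum>P\<in>Q. 2 ^ snd P * norm (avg P))"
      by (simp add: card)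
    also have "\<dots> \<le> (\<Sum>P\<in>Q. sum ?nF (?D P))" by (intro sum_mono avg_mult)
    also have "\<dots> = sum ?nF ?U"
      by (rule sum.UNION_disjoint[symmetric]) (use Q(1,5) in \<open>auto simp: disjoint_family_on_def\<close>)
    also have "(\<Sum>i\<in>?R - ?U. norm (Gd i)) = (\<Sum>i\<in>?R - ?U. ?nF i)"
      using Gd_out by (intro sum.cong refl) auto
    also have "(\<Sum>i\<in>?R - ?U. ?nF i) + sum ?nF ?U = sum ?nF ?R"
      using U by (intro sum.subset_diff[symmetric]) auto
    also have "\<dots> = sum ?nF S" using supp by (intro sumR) auto
    finally show ?thesis by simp
  qed
  let ?g = "step_fun \<delta> Gd" and ?b = "\<lambda>P. step_fun \<delta> (Bd P)"
  have Bd_supp: "Bd P i = 0" if "i \<notin> ?D P" for P i using that by (simp add: Bd_def)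
  have finD: "finite (?D P)" for P by (simp add: split_def)
  have dec: "step_fun \<delta> F = (\<lambda>x. ?g x + (\<Sum>P\<in>Q. ?b P x))"
    by (auto simp: step_fun_def Gd_def)
  have bg: "bounded (range ?g)" by (rule bounded_step_fun[of ?R]) (use Gd_supp in auto)
  have bb: "bounded (range (?b P))" for P by (rule bounded_step_fun[OF finD Bd_supp])
  have bsum: "bounded (range (\<lambda>x. \<Sum>P\<in>Q. ?b P x))"
  proof -
    have "(\<Sum>P\<in>Q. Bd P i) = 0" if "i \<notin> ?R" for i
      using that Q(2) Bd_supp by (intro sum.neutral) blast
    then have "bounded (range (step_fun \<delta> (\<lambda>i. \<Sum>P\<in>Q. Bd P i)))"
      by (intro bounded_step_fun[of ?R]) auto
    then show ?thesis by (simp add: step_fun_def[abs_def])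
  qed
  have conv_dec: "conv k (step_fun \<delta> F) x = conv k ?g x + (\<Sum>P\<in>Q. conv k (?b P) x)" for x
    unfolding dec by (subst conv_add) (use bg bb bsum in \<open>auto simp: conv_sum\<close>)
  have good: "(\<integral>\<^sup>+x. ennreal ((norm (conv k ?g x))\<^sup>2) \<partial>lborel) \<le> ennreal (A * (2 * \<alpha> * N))"
  proof -
    have "(\<integral>\<^sup>+x. ennreal ((norm (?g x))\<^sup>2) \<partial>lborel) = ennreal (\<delta> * (\<Sum>i\<in>?R. (norm (Gd i))\<^sup>2))"
      unfolding step_fun_def by (rule nn_integral_step_fun) (use d Gd_supp in auto)
    also have "\<dots> \<le> ennreal (2 * \<alpha> * N)"
    proof (rule ennreal_leI)
      have "(\<Sum>i\<in>?R. (norm (Gd i))\<^sup>2) \<le> (\<Sum>i\<in>?R. 2 * \<alpha> * norm (Gd i))"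
        unfolding power2_eq_square by (intro sum_mono mult_right_mono Gd_le) auto
      also have "\<dots> \<le> 2 * \<alpha> * sum ?nF S"
        unfolding sum_distrib_left[symmetric] using l by (intro mult_left_mono Gd_sum) auto
      finally show "\<delta> * (\<Sum>i\<in>?R. (norm (Gd i))\<^sup>2) \<le> 2 * \<alpha> * N"
        using d unfolding N_def by (simp add: mult.left_commute)
    qed
    finally have *: "(\<integral>\<^sup>+x. ennreal ((norm (?g x))\<^sup>2) \<partial>lborel) \<le> ennreal (2 * \<alpha> * N)" .
    have "integrable lborel ?g" by (rule integrable_step_fun[of _ ?R]) (use d Gd_supp in auto)
    from L2[OF this bg] have "(\<integral>\<^sup>+x. ennreal ((norm (conv k ?g x))\<^sup>2) \<partial>lborel) \<le> ennreal A * ennreal (2 * \<alpha> * N)"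
      using * by (meson mult_left_mono order_trans zero_le)
    then show ?thesis using A_nonneg l N0 by (simp add: ennreal_mult)
  qed
  \<comment> \<open>\<open>len P\<close> is the full length of the interval, so that
    \<open>E\<close> consists of doubled intervals and every point of the atom satisfies
    \<open>2 * \<bar>y - ctr P\<bar> \<le> len P\<close>.\<close>
  define ctr where "ctr P = \<delta> * (of_int (fst P) + 2 ^ snd P / 2)" for P :: "int \<times> nat"
  define len where "len P = \<delta> * 2 ^ snd P" for P :: "int \<times> nat"
  have len: "len P > 0" for P using d by (simp add: len_def)
  define E where "E = (\<Union>P\<in>Q. {ctr P - len P..ctr P + len P})"
  have E_meas [measurable]: "E \<in> sets borel" unfolding E_def using Q(1) by (intro sets.finite_UN) auto
  have bad: "(\<integral>\<^sup>+x. indicator (- E) x * ennreal (norm (conv k (?b P) x)) \<partial>lborel)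
      \<le> ennreal (B * (2 * \<delta> * sum ?nF (?D P)))"
    if P: "P \<in> Q" for P
  proof -
    have "(\<integral>\<^sup>+x. indicator (- E) x * ennreal (norm (conv k (?b P) x)) \<partial>lborel)
      \<le> (\<integral>\<^sup>+x. indicator {x. \<bar>x - ctr P\<bar> > len P} x * ennreal (norm (conv k (?b P) x)) \<partial>lborel)"
      by (intro nn_integral_mono mult_right_mono)
          (use P in \<open>auto simp: E_def indicator_def abs_if split: if_splits\<close>)
    also have "\<dots> \<le> ennreal B * (\<integral>\<^sup>+y. ennreal (norm (?b P y)) \<partial>lborel)"
    proof (rule atom_bound)
      have "(LINT y|lborel. ?b P y) = \<delta> *\<^sub>R (\<Sum>i\<in>?D P. Bd P i)"
        using has_integral_step_fun[OF d finD Bd_supp, of P] by (simp add: has_bochner_integral_iff)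
      also have "(\<Sum>i\<in>?D P. Bd P i) = (\<Sum>i\<in>?D P. F i - avg P)"
        by (intro sum.cong) (auto simp: Bd_def)
      also have "\<dots> = 0"
        by (simp add: sum_subtractf card avg_def)
      finally show "(LINT y|lborel. ?b P y) = 0" by simp
      fix y assume "?b P y \<noteq> 0"
      then have "\<lfloor>y / \<delta>\<rfloor> \<in> ?D P" using Bd_supp by (auto simp: step_fun_def)
      then have "of_int (fst P) \<le> y / \<delta>" "y / \<delta> < of_int (fst P) + 2 ^ snd P"
        by (auto simp: split_def le_floor_iff floor_less_iff)
      then have "\<delta> * of_int (fst P) \<le> y" "y \<le> \<delta> * (of_int (fst P) + 2 ^ snd P)"
        using d by (auto simp: field_simps)
      then show "2 * \<bar>y - ctr P\<bar> \<le> len P"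
        unfolding ctr_def len_def by (simp add: abs_if algebra_simps)
    qed (use bb integrable_step_fun[OF d finD Bd_supp] in auto)
    also have "(\<integral>\<^sup>+y. ennreal (norm (?b P y)) \<partial>lborel) = ennreal (\<delta> * (\<Sum>i\<in>?D P. norm (Bd P i)))"
      unfolding step_fun_def by (rule nn_integral_step_fun) (use d finD Bd_supp in auto)
    also have "ennreal B * \<dots> \<le> ennreal B * ennreal (2 * \<delta> * sum ?nF (?D P))"
    proof (intro mult_left_mono ennreal_leI)
      have "(\<Sum>i\<in>?D P. norm (Bd P i)) \<le> (\<Sum>i\<in>?D P. ?nF i + norm (avg P))"
        by (intro sum_mono) (auto simp: Bd_def norm_triangle_ineq4)
      also have "\<dots> = sum ?nF (?D P) + 2 ^ snd P * norm (avg P)"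
        by (simp add: sum.distrib card)
      also have "\<dots> \<le> 2 * sum ?nF (?D P)" using avg_mult[of P] by simp
      finally show "\<delta> * (\<Sum>i\<in>?D P. norm (Bd P i)) \<le> 2 * \<delta> * sum ?nF (?D P)" using d by simp
    qed simp
    also have "\<dots> = ennreal (B * (2 * \<delta> * sum ?nF (?D P)))"
      using B_nonneg d by (subst ennreal_mult) (auto intro!: mult_nonneg_nonneg sum_nonneg)
    finally show ?thesis .
  qed
  let ?V = "\<lambda>x. \<Sum>P\<in>Q. indicator (- E) x * ennreal (norm (conv k (?b P) x))"
  have badsum: "(\<integral>\<^sup>+x. ?V x \<partial>lborel) \<le> ennreal (2 * B * N)"
  proof -
    have "(\<integral>\<^sup>+x. ?V x \<partial>lborel) = (\<Sum>P\<in>Q. \<integral>\<^sup>+x. indicator (- E) x * ennreal (norm (conv k (?b P) x)) \<partial>lborel)"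
      by (rule nn_integral_sum) measurable
    also have "\<dots> \<le> (\<Sum>P\<in>Q. ennreal (B * (2 * \<delta> * sum ?nF (?D P))))" by (intro sum_mono bad)
    also have "\<dots> = ennreal (\<Sum>P\<in>Q. B * (2 * \<delta> * sum ?nF (?D P)))"
      using B_nonneg d by (intro sum_ennreal) (auto intro!: mult_nonneg_nonneg sum_nonneg)
    also have "(\<Sum>P\<in>Q. B * (2 * \<delta> * sum ?nF (?D P))) = 2 * B * (\<delta> * (\<Sum>P\<in>Q. sum ?nF (?D P)))"
      by (simp add: sum_distrib_left mult_ac)
    also have "ennreal \<dots> \<le> ennreal (2 * B * N)"
      unfolding N_def using B_nonneg d by (intro ennreal_leI mult_left_mono sumD) auto
    finally show ?thesis .
  qed
  have emE: "ennreal \<alpha> * emeasure lborel E \<le> ennreal (2 * N)"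
  proof -
    have "emeasure lborel E \<le> (\<Sum>P\<in>Q. emeasure lborel {ctr P - len P..ctr P + len P})"
      unfolding E_def using Q(1) by (intro emeasure_subadditive_finite) auto
    also have "\<dots> = (\<Sum>P\<in>Q. ennreal (2 * len P))"
      using len by (intro sum.cong refl) (simp add: less_imp_le)
    also have "\<dots> = ennreal (\<Sum>P\<in>Q. 2 * len P)" using len by (intro sum_ennreal) (simp add: less_imp_le)
    finally have "ennreal \<alpha> * emeasure lborel E \<le> ennreal \<alpha> * ennreal (\<Sum>P\<in>Q. 2 * len P)"
      by (intro mult_left_mono) auto
    also have "\<dots> = ennreal (\<alpha> * (\<Sum>P\<in>Q. 2 * len P))"
      using l len by (subst ennreal_mult) (auto intro!: sum_nonneg simp: less_imp_le)
    also have "\<dots> \<le> ennreal (2 * N)"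
    proof (intro ennreal_leI)
      have "\<alpha> * (\<Sum>P\<in>Q. 2 * len P) = 2 * (\<alpha> * (\<Sum>P\<in>Q. \<delta> * 2 ^ snd P))"
        unfolding len_def sum_distrib_left by (simp only: mult_ac)
      then show "\<alpha> * (\<Sum>P\<in>Q. 2 * len P) \<le> 2 * N" using lenD by linarith
    qed
    finally show ?thesis .
  qed
  \<comment> \<open>Chebyshev's inequality at level \<open>\<alpha> / 2\<close> divides
    \<open>A * (2 * \<alpha> * N)\<close> by \<open>(\<alpha> / 2)\<^sup>2\<close>, which leaves
    \<open>8 * A * N / \<alpha>\<close>.\<close>
  have em_good: "ennreal \<alpha> * emeasure lborel {x. \<alpha> / 2 \<le> norm (conv k ?g x)} \<le> ennreal (8 * A * N)"
  proof -
    let ?Z = "{x. \<alpha> / 2 \<le> norm (conv k ?g x)}"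
    have "{x. \<alpha> / 2 \<le> norm (conv k ?g x)} = {x. ennreal ((\<alpha> / 2)\<^sup>2) \<le> ennreal ((norm (conv k ?g x))\<^sup>2)}"
      using l by (auto simp: ennreal_le_iff abs_le_square_iff[symmetric])
    then have "ennreal ((\<alpha> / 2)\<^sup>2) * emeasure lborel ?Z \<le> (\<integral>\<^sup>+x. ennreal ((norm (conv k ?g x))\<^sup>2) \<partial>lborel)"
      using Markov_nn_integral[of "\<lambda>x. ennreal ((norm (conv k ?g x))\<^sup>2)" "ennreal ((\<alpha> / 2)\<^sup>2)"] by simp
    also note good
    finally have *: "ennreal (4 / \<alpha>) * (ennreal ((\<alpha> / 2)\<^sup>2) * emeasure lborel ?Z)
        \<le> ennreal (4 / \<alpha>) * ennreal (A * (2 * \<alpha> * N))"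
      by (intro mult_left_mono) auto
    have "ennreal (4 / \<alpha>) * (ennreal ((\<alpha> / 2)\<^sup>2) * emeasure lborel ?Z) = ennreal \<alpha> * emeasure lborel ?Z"
      unfolding mult.assoc[symmetric] using l by (subst ennreal_mult[symmetric]) (auto simp: power2_eq_square)
    moreover have "ennreal (4 / \<alpha>) * ennreal (A * (2 * \<alpha> * N)) = ennreal (8 * A * N)"
      using l A_nonneg N0 by (subst ennreal_mult[symmetric]) auto
    ultimately show ?thesis using * by simp
  qed
  have em_bad: "ennreal \<alpha> * emeasure lborel {x. ennreal (\<alpha> / 2) \<le> ?V x} \<le> ennreal (4 * B * N)"
  proof -
    have "ennreal (\<alpha> / 2) * emeasure lborel {x. ennreal (\<alpha> / 2) \<le> ?V x} \<le> ennreal (2 * B * N)"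
      by (rule order_trans[OF Markov_nn_integral badsum]) measurable
    then have "ennreal 2 * (ennreal (\<alpha> / 2) * emeasure lborel {x. ennreal (\<alpha> / 2) \<le> ?V x})
        \<le> ennreal 2 * ennreal (2 * B * N)"
      by (intro mult_left_mono) auto
    then show ?thesis
      unfolding mult.assoc[symmetric] using l B_nonneg N0
      by (subst (asm) (1 2) ennreal_mult[symmetric]) (auto simp: mult.assoc)
  qed
  have sub: "{x. \<alpha> \<le> norm (conv k (step_fun \<delta> F) x)} \<subseteq> E \<union> {x. \<alpha> / 2 \<le> norm (conv k ?g x)} \<union> {x. ennreal (\<alpha> / 2)
      \<le> ?V x}"
  proof
    fix x assume x: "x \<in> {x. \<alpha> \<le> norm (conv k (step_fun \<delta> F) x)}"
    show "x \<in> E \<union> {x. \<alpha> / 2 \<le> norm (conv k ?g x)} \<union> {x. ennreal (\<alpha> / 2) \<le> ?V x}"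
    proof (cases "x \<in> E \<or> \<alpha> / 2 \<le> norm (conv k ?g x)")
      case False
      have "\<alpha> \<le> norm (conv k ?g x) + (\<Sum>P\<in>Q. norm (conv k (?b P) x))"
        using x norm_triangle_ineq[of "conv k ?g x" "\<Sum>P\<in>Q. conv k (?b P) x"] norm_sum[of "\<lambda>P. conv k (?b P) x" Q]
        unfolding conv_dec by force
      then have "\<alpha> / 2 \<le> (\<Sum>P\<in>Q. norm (conv k (?b P) x))" using False by linarith
      then have "ennreal (\<alpha> / 2) \<le> (\<Sum>P\<in>Q. ennreal (norm (conv k (?b P) x)))"
        by (simp add: sum_ennreal ennreal_leI)
      then show ?thesis using False by simp
    qed auto
  qed
  have "emeasure lborel {x. \<alpha> \<le> norm (conv k (step_fun \<delta> F) x)} \<le>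
     emeasure lborel (E \<union> {x. \<alpha> / 2 \<le> norm (conv k ?g x)} \<union> {x. ennreal (\<alpha> / 2) \<le> ?V x})"
    by (rule emeasure_mono[OF sub]) measurable
  also have "\<dots> \<le> emeasure lborel E + emeasure lborel {x. \<alpha> / 2
      \<le> norm (conv k ?g x)} + emeasure lborel {x. ennreal (\<alpha> / 2) \<le> ?V x}"
    by (intro order_trans[OF emeasure_subadditive] add_mono) measurable
  finally have "ennreal \<alpha> * emeasure lborel {x. \<alpha> \<le> norm (conv k (step_fun \<delta> F) x)} \<le> 
     ennreal \<alpha> * (emeasure lborel E + emeasure lborel {x. \<alpha> / 2
         \<le> norm (conv k ?g x)} + emeasure lborel {x. ennreal (\<alpha> / 2) \<le> ?V x})"
    by (intro mult_left_mono) auto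
  also have "\<dots> \<le> ennreal (2 * N) + ennreal (8 * A * N) + ennreal (4 * B * N)"
    unfolding distrib_left by (intro add_mono emE em_good em_bad)
  also have "\<dots> = ennreal weak_const * ennreal N"
    unfolding weak_const_def using A_nonneg B_nonneg N0
    by (simp add: ennreal_plus[symmetric] ennreal_mult[symmetric] algebra_simps del: ennreal_plus)
  finally show ?thesis unfolding N .
qed


section \<open>Marcinkiewicz interpolation\<close>

text \<open>The interpolation constant blows up as \<open>p\<close> tends to 2, where the L^2
  hypothesis is available directly.\<close>

definition "strong_const p = (if p = 2 then A else p * (2 * weak_const / (p - 1) + 4 * A / (2 - p)))"

lemma strong_const_nonneg: "1 < p \<Longrightarrow> p \<le> 2 \<Longrightarrow> strong_const p \<ge> 0"
  using A_nonneg weak_const_nonneg by (auto simp: strong_const_def intro!: mult_nonneg_nonneg add_nonneg_nonneg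
      divide_nonneg_nonneg)

text \<open>The function is cut at the level \<alpha> itself. The weak bound takes its large values
  and the L^2 bound its small ones, each at level \<open>\<alpha> / 2\<close>.\<close>

lemma level_set_bound:
  fixes F :: "int \<Rightarrow> complex"
  assumes d: "\<delta> > 0" and fin: "finite S" and supp: "\<And>i. i \<notin> S \<Longrightarrow> F i = 0" and l: "\<alpha> > 0"
  defines "f \<equiv> step_fun \<delta> F"
  shows "emeasure lborel {x. \<alpha> \<le> norm (conv k f x)} \<le>
    ennreal (2 * weak_const / \<alpha>) * (\<integral>\<^sup>+x. indicator {x. \<alpha> \<le> norm (f x)} x * ennreal (norm (f x)) \<partial>lborel)
    + ennreal (4 * A / \<alpha>\<^sup>2) * (\<integral>\<^sup>+x. indicator {x. norm (f x) < \<alpha>} x * ennreal ((norm (f x))\<^sup>2) \<partial>lborel)"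
proof -
  define F1 where "F1 i = (if \<alpha> \<le> norm (F i) then F i else 0)" for i
  define F2 where "F2 i = (if norm (F i) < \<alpha> then F i else 0)" for i
  have s1: "F1 i = 0" and s2: "F2 i = 0" if "i \<notin> S" for i using supp[OF that] by (auto simp: F1_def F2_def)
  have b1: "bounded (range (step_fun \<delta> F1))" and b2: "bounded (range (step_fun \<delta> F2))"
    using bounded_step_fun[OF fin] s1 s2 by blast+
  have f: "f = (\<lambda>x. step_fun \<delta> F1 x + step_fun \<delta> F2 x)"
    by (auto simp: f_def step_fun_def F1_def F2_def)
  have conv: "conv k f x = conv k (step_fun \<delta> F1) x + conv k (step_fun \<delta> F2) x" for x
    unfolding f by (rule conv_add) (use b1 b2 in auto)
  have e1: "(\<integral>\<^sup>+x. ennreal (norm (step_fun \<delta> F1 x)) \<partial>lborel) = (\<integral>\<^sup>+x. indicator {x. \<alpha>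
      \<le> norm (f x)} x * ennreal (norm (f x)) \<partial>lborel)"
    by (intro nn_integral_cong) (auto simp: f_def step_fun_def F1_def indicator_def)
  have e2: "(\<integral>\<^sup>+x. ennreal ((norm (step_fun \<delta> F2 x))\<^sup>2) \<partial>lborel)
      = (\<integral>\<^sup>+x. indicator {x. norm (f x) < \<alpha>} x * ennreal ((norm (f x))\<^sup>2) \<partial>lborel)"
    by (intro nn_integral_cong) (auto simp: f_def step_fun_def F2_def indicator_def)
  let ?Z1 = "{x. \<alpha> / 2 \<le> norm (conv k (step_fun \<delta> F1) x)}" and ?Z2 = "{x. \<alpha> / 2
      \<le> norm (conv k (step_fun \<delta> F2) x)}"
  have cancel: "X \<le> ennreal (c / a) * Y" if "ennreal a * X
      \<le> ennreal c * Y" "a > 0" "c \<ge> 0" for X Y :: ennreal and a c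
  proof -
    have "ennreal (1 / a) * (ennreal a * X) \<le> ennreal (1 / a) * (ennreal c * Y)"
      using that(1) by (rule mult_left_mono) simp
    then show ?thesis
      using that(2,3) by (simp add: mult.assoc[symmetric] ennreal_mult[symmetric])
  qed
  have z1: "emeasure lborel ?Z1 \<le> ennreal (2 * weak_const / \<alpha>) * (\<integral>\<^sup>+x. ennreal (norm (step_fun \<delta> F1 x)) \<partial>lborel)"
    using cancel[OF weak_type[where F=F1 and \<alpha>="\<alpha> / 2", OF d fin s1]] l weak_const_nonneg
        by (simp add: mult.commute)
  have z2: "emeasure lborel ?Z2 \<le> ennreal (4 * A / \<alpha>\<^sup>2) * (\<integral>\<^sup>+x. ennreal ((norm (step_fun \<delta> F2 x))\<^sup>2) \<partial>lborel)"
  proof -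
    have "?Z2 = {x. ennreal ((\<alpha> / 2)\<^sup>2) \<le> ennreal ((norm (conv k (step_fun \<delta> F2) x))\<^sup>2)}"
      using l by (auto simp: ennreal_le_iff abs_le_square_iff[symmetric])
    then have "ennreal ((\<alpha> / 2)\<^sup>2) * emeasure lborel ?Z2
        \<le> (\<integral>\<^sup>+x. ennreal ((norm (conv k (step_fun \<delta> F2) x))\<^sup>2) \<partial>lborel)"
      using Markov_nn_integral[of "\<lambda>x. ennreal ((norm (conv k (step_fun \<delta> F2) x))\<^sup>2)" "ennreal ((\<alpha> / 2)\<^sup>2)"] by simp
    also have "\<dots> \<le> ennreal A * (\<integral>\<^sup>+x. ennreal ((norm (step_fun \<delta> F2 x))\<^sup>2) \<partial>lborel)"
      by (rule L2[OF integrable_step_fun[OF d fin s2] b2])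
    finally have "emeasure lborel ?Z2 \<le> ennreal (A / (\<alpha> / 2)\<^sup>2)
        * (\<integral>\<^sup>+x. ennreal ((norm (step_fun \<delta> F2 x))\<^sup>2) \<partial>lborel)"
      by (rule cancel) (use l A_nonneg in auto)
    moreover have "A / (\<alpha> / 2)\<^sup>2 = 4 * A / \<alpha>\<^sup>2" by (simp add: power2_eq_square)
    ultimately show ?thesis by (simp only:)
  qed
  have "{x. \<alpha> \<le> norm (conv k f x)} \<subseteq> ?Z1 \<union> ?Z2"
  proof
    fix x assume "x \<in> {x. \<alpha> \<le> norm (conv k f x)}"
    then have "\<alpha> \<le> norm (conv k (step_fun \<delta> F1) x) + norm (conv k (step_fun \<delta> F2) x)"
      using norm_triangle_ineq[of "conv k (step_fun \<delta> F1) x" "conv k (step_fun \<delta> F2) x"] by (simp add: conv)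
    then show "x \<in> ?Z1 \<union> ?Z2" by auto
  qed
  then have "emeasure lborel {x. \<alpha> \<le> norm (conv k f x)} \<le> emeasure lborel (?Z1 \<union> ?Z2)"
    by (rule emeasure_mono) measurable
  also have "\<dots> \<le> emeasure lborel ?Z1 + emeasure lborel ?Z2"
    by (rule emeasure_subadditive) measurable
  also have "\<dots> \<le> ennreal (2 * weak_const / \<alpha>) * (\<integral>\<^sup>+x. ennreal (norm (step_fun \<delta> F1 x)) \<partial>lborel)
    + ennreal (4 * A / \<alpha>\<^sup>2) * (\<integral>\<^sup>+x. ennreal ((norm (step_fun \<delta> F2 x))\<^sup>2) \<partial>lborel)"
    by (rule add_mono[OF z1 z2])
  finally show ?thesis unfolding e1 e2 .
qed

text \<open>The level set bound at \<open>\<alpha> = exp (- s)\<close> is integrated against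
  \<open>p * exp (- p * s)\<close>. After the exchange of integrals, the part with large values
  converges because \<open>p > 1\<close> and the part with small values because
  \<open>p < 2\<close>.\<close>

lemma strong_type_step:
  fixes F :: "int \<Rightarrow> complex"
  assumes d: "\<delta> > 0" and fin: "finite S" and supp: "\<And>i. i \<notin> S \<Longrightarrow> F i = 0" and p: "1 < p" "p \<le> 2"
  defines "f \<equiv> step_fun \<delta> F"
  shows "(\<integral>\<^sup>+x. ennreal (norm (conv k f x) powr p) \<partial>lborel)
      \<le> ennreal (strong_const p) * (\<integral>\<^sup>+x. ennreal (norm (f x) powr p) \<partial>lborel)"
proof (cases "p = 2")
  case True
  have sq: "x powr 2 = x\<^sup>2" if "x \<ge> 0" for x :: real using that by (cases "x = 0") (auto simp: powr_numeral)
  show ?thesis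
    using L2[OF integrable_step_fun[OF d fin supp] bounded_step_fun[OF fin supp]] True
    by (simp add: f_def strong_const_def sq)
next
  case False
  then have p2: "p < 2" using p by simp
  have [measurable]: "f \<in> borel_measurable borel" by (simp add: f_def)
  have [measurable]: "conv k f \<in> borel_measurable borel" by simp
  let ?I1 = "\<lambda>s x. ennreal (exp (- (p - 1) * s)) * (indicator {s. exp (- s)
      \<le> norm (f x)} s * ennreal (norm (f x)))"
  let ?I2 = "\<lambda>s x. ennreal (exp ((2 - p) * s)) * (indicator {s. norm (f x) < exp (- s)} s
      * ennreal ((norm (f x))\<^sup>2))"
  have I1: "(\<integral>\<^sup>+x. (\<integral>\<^sup>+s. ?I1 s x \<partial>lborel) \<partial>lborel)
      \<le> (\<integral>\<^sup>+x. ennreal (1 / (p - 1)) * ennreal (norm (f x) powr p) \<partial>lborel)"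
  proof (rule nn_integral_mono)
    fix x
    let ?v = "norm (f x)"
    have "(\<integral>\<^sup>+s. ?I1 s x \<partial>lborel) = (\<integral>\<^sup>+s. ennreal (1 / (p - 1) * ?v) * (ennreal ((p - 1) * exp (- (p - 1) * s))
        * indicator {s. exp (- s) \<le> ?v} s) \<partial>lborel)"
      using p by (intro nn_integral_cong) (auto simp: indicator_def ennreal_mult[symmetric])
    also have "\<dots> = ennreal (1 / (p - 1) * ?v) * ennreal (?v powr (p - 1))"
      using p exp_layer_cake[of "p - 1" ?v] by (subst nn_integral_cmult) auto
    also have "\<dots> = ennreal (1 / (p - 1)) * ennreal (?v powr p)"
    proof -
      have "?v * ?v powr (p - 1) = ?v powr p" by (cases "?v = 0") (auto simp: powr_mult_base)
      then show ?thesis using p by (simp add: ennreal_mult[symmetric])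
    qed
    finally show "(\<integral>\<^sup>+s. ?I1 s x \<partial>lborel) \<le> ennreal (1 / (p - 1)) * ennreal (?v powr p)" by simp
  qed
  have I2: "(\<integral>\<^sup>+x. (\<integral>\<^sup>+s. ?I2 s x \<partial>lborel) \<partial>lborel)
      \<le> (\<integral>\<^sup>+x. ennreal (1 / (2 - p)) * ennreal (norm (f x) powr p) \<partial>lborel)"
  proof (rule nn_integral_mono)
    fix x
    let ?v = "norm (f x)"
    show "(\<integral>\<^sup>+s. ?I2 s x \<partial>lborel) \<le> ennreal (1 / (2 - p)) * ennreal (?v powr p)"
    proof (cases "f x = 0")
      case False
      have "(\<integral>\<^sup>+s. ?I2 s x \<partial>lborel) \<le> (\<integral>\<^sup>+s. ennreal (1 / (2 - p) * ?v\<^sup>2) * (ennreal ((2 - p) * exp ((2 - p) * s))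
          * indicator {s. ?v \<le> exp (- s)} s) \<partial>lborel)"
        using p2 by (intro nn_integral_mono) (auto simp: indicator_def ennreal_mult[symmetric])
      also have "\<dots> = ennreal (1 / (2 - p) * ?v\<^sup>2) * ennreal (?v powr (- (2 - p)))"
        using p2 False exp_layer_cake_lower[of "2 - p" ?v] by (subst nn_integral_cmult) auto
      also have "\<dots> = ennreal (1 / (2 - p)) * ennreal (?v powr p)"
      proof -
        have "?v\<^sup>2 * ?v powr (- (2 - p)) = ?v powr p" 
        proof -
          have "?v\<^sup>2 = ?v powr 2" using False by (simp add: powr_numeral)
          then show ?thesis by (simp only: powr_add[symmetric]) simp
        qed
        then show ?thesis using p2 by (simp add: ennreal_mult[symmetric])
      qed
      finally show ?thesis .
    qed simp
  qed
  have "(\<integral>\<^sup>+x. ennreal (norm (conv k f x) powr p) \<partial>lborel) =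
     (\<integral>\<^sup>+x. (\<integral>\<^sup>+s. ennreal (p * exp (- p * s)) * indicator {x. exp (- s) \<le> norm (conv k f x)} x \<partial>lborel) \<partial>lborel)"
    using p exp_layer_cake[of p] by (intro nn_integral_cong) (simp add: indicator_def)
  also have "\<dots> = (\<integral>\<^sup>+s. (\<integral>\<^sup>+x. ennreal (p * exp (- p * s)) * indicator {x. exp (- s)
      \<le> norm (conv k f x)} x \<partial>lborel) \<partial>lborel)"
    by (rule lborel_pair.Fubini') measurable
  also have "\<dots> = (\<integral>\<^sup>+s. ennreal (p * exp (- p * s)) * emeasure lborel {x. exp (- s) \<le> norm (conv k f x)} \<partial>lborel)"
    by (intro nn_integral_cong nn_integral_cmult_indicator) measurable
  also have "\<dots> \<le> (\<integral>\<^sup>+s. ennreal (p * 2 * weak_const) * (\<integral>\<^sup>+x. ?I1 s x \<partial>lborel)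
      + ennreal (p * 4 * A) * (\<integral>\<^sup>+x. ?I2 s x \<partial>lborel) \<partial>lborel)"
  proof (rule nn_integral_mono)
    fix s :: real
    let ?X = "\<integral>\<^sup>+x. indicator {x. exp (- s) \<le> norm (f x)} x * ennreal (norm (f x)) \<partial>lborel"
    let ?Y = "\<integral>\<^sup>+x. indicator {x. norm (f x) < exp (- s)} x * ennreal ((norm (f x))\<^sup>2) \<partial>lborel"
    have 1: "(\<integral>\<^sup>+x. ?I1 s x \<partial>lborel) = ennreal (exp (- (p - 1) * s)) * ?X"
      by (subst nn_integral_cmult[symmetric]) (auto simp: indicator_def intro!: nn_integral_cong)
    have 2: "(\<integral>\<^sup>+x. ?I2 s x \<partial>lborel) = ennreal (exp ((2 - p) * s)) * ?Y"
      by (subst nn_integral_cmult[symmetric]) (auto simp: indicator_def intro!: nn_integral_cong)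
    have "ennreal (p * exp (- p * s)) * emeasure lborel {x. exp (- s) \<le> norm (conv k f x)}
      \<le> ennreal (p * exp (- p * s)) * (ennreal (2 * weak_const / exp (- s)) * ?X
          + ennreal (4 * A / (exp (- s))\<^sup>2) * ?Y)"
      unfolding f_def by (intro mult_left_mono level_set_bound[OF d fin supp]) auto
    also have "\<dots> = ennreal (p * exp (- p * s) * (2 * weak_const / exp (- s))) * ?X
        + ennreal (p * exp (- p * s) * (4 * A / (exp (- s))\<^sup>2)) * ?Y"
      using p weak_const_nonneg A_nonneg by (simp add: distrib_left mult.assoc[symmetric] ennreal_mult[symmetric])
    also have "p * exp (- p * s) * (2 * weak_const / exp (- s)) = p * 2 * weak_const * exp (- (p - 1) * s)"
    proof -
      have "exp (- (p - 1) * s) = exp (- p * s) / exp (- s)"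
        unfolding exp_diff[symmetric] by (simp add: algebra_simps)
      then show ?thesis by simp
    qed
    also have "p * exp (- p * s) * (4 * A / (exp (- s))\<^sup>2) = p * 4 * A * exp ((2 - p) * s)"
    proof -
      have "exp ((2 - p) * s) = exp (- p * s) / (exp (- s))\<^sup>2"
        unfolding power2_eq_square exp_add[symmetric] exp_diff[symmetric] by (simp add: algebra_simps)
      then show ?thesis by simp
    qed
    finally show "ennreal (p * exp (- p * s)) * emeasure lborel {x. exp (- s) \<le> norm (conv k f x)}
      \<le> ennreal (p * 2 * weak_const) * (\<integral>\<^sup>+x. ?I1 s x \<partial>lborel) + ennreal (p * 4 * A) * (\<integral>\<^sup>+x. ?I2 s x \<partial>lborel)"
      unfolding 1 2 using p weak_const_nonneg A_nonneg
          by (simp add: mult.assoc[symmetric] ennreal_mult[symmetric])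
  qed
  also have "\<dots> = ennreal (p * 2 * weak_const) * (\<integral>\<^sup>+s. (\<integral>\<^sup>+x. ?I1 s x \<partial>lborel) \<partial>lborel)
      + ennreal (p * 4 * A) * (\<integral>\<^sup>+s. (\<integral>\<^sup>+x. ?I2 s x \<partial>lborel) \<partial>lborel)"
    by (subst nn_integral_add) (auto simp: nn_integral_cmult)
  also have "(\<integral>\<^sup>+s. (\<integral>\<^sup>+x. ?I1 s x \<partial>lborel) \<partial>lborel) = (\<integral>\<^sup>+x. (\<integral>\<^sup>+s. ?I1 s x \<partial>lborel) \<partial>lborel)"
    by (rule lborel_pair.Fubini'[symmetric]) measurable
  also have "(\<integral>\<^sup>+s. (\<integral>\<^sup>+x. ?I2 s x \<partial>lborel) \<partial>lborel) = (\<integral>\<^sup>+x. (\<integral>\<^sup>+s. ?I2 s x \<partial>lborel) \<partial>lborel)"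
    by (rule lborel_pair.Fubini'[symmetric]) measurable
  also have "ennreal (p * 2 * weak_const) * (\<integral>\<^sup>+x. (\<integral>\<^sup>+s. ?I1 s x \<partial>lborel) \<partial>lborel)
      + ennreal (p * 4 * A) * (\<integral>\<^sup>+x. (\<integral>\<^sup>+s. ?I2 s x \<partial>lborel) \<partial>lborel) \<le>
     ennreal (p * 2 * weak_const) * (\<integral>\<^sup>+x. ennreal (1 / (p - 1)) * ennreal (norm (f x) powr p) \<partial>lborel)
     + ennreal (p * 4 * A) * (\<integral>\<^sup>+x. ennreal (1 / (2 - p)) * ennreal (norm (f x) powr p) \<partial>lborel)"
    by (intro add_mono mult_left_mono I1 I2) auto
  also have "\<dots> = ennreal (strong_const p) * (\<integral>\<^sup>+x. ennreal (norm (f x) powr p) \<partial>lborel)"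
  proof -
    let ?N = "\<integral>\<^sup>+x. ennreal (norm (f x) powr p) \<partial>lborel"
    have "ennreal (p * 2 * weak_const) * (ennreal (1 / (p - 1)) * ?N)
        + ennreal (p * 4 * A) * (ennreal (1 / (2 - p)) * ?N)
       = (ennreal (p * 2 * weak_const * (1 / (p - 1))) + ennreal (p * 4 * A * (1 / (2 - p)))) * ?N"
      using p p2 weak_const_nonneg A_nonneg by (simp add: distrib_right mult.assoc[symmetric]
          ennreal_mult[symmetric])
    also have "ennreal (p * 2 * weak_const * (1 / (p - 1))) + ennreal (p * 4 * A * (1 / (2 - p)))
        = ennreal (strong_const p)"
      using p p2 weak_const_nonneg A_nonneg False
      by (subst ennreal_plus[symmetric]) (auto simp: strong_const_def algebra_simps)
    finally show ?thesis by (simp add: nn_integral_cmult)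
  qed
  finally show ?thesis .
qed

end

text \<open>Piecewise continuous functions suffice as test functions in the duality arguments, and they
  are pointwise limits of step functions.\<close>

definition test_fun :: "(real \<Rightarrow> complex) \<Rightarrow> bool" where
  "test_fun h \<longleftrightarrow> (\<exists>u R. continuous_on UNIV u \<and> h = (\<lambda>x. if - real R \<le> x \<and> x < real R then u x else 0))"

lemma test_fun_measurable [measurable_dest]: "test_fun h \<Longrightarrow> h \<in> borel_measurable borel"
proof -
  assume "test_fun h"
  then obtain u R where u: "continuous_on UNIV u" "h = (\<lambda>x. if - real R \<le> x \<and> x < real R then u x else 0)"
    by (auto simp: test_fun_def)
  have [measurable]: "u \<in> borel_measurable borel" using u(1) by (rule borel_measurable_continuous_onI)
  show ?thesis unfolding u(2) by measurable
qed

lemma test_fun_bound: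
  assumes "test_fun h"
  obtains M R where "\<And>x. norm (h x) \<le> M * indicator {- real R..<real R} x"
proof -
  obtain u R where u: "continuous_on UNIV u" "h = (\<lambda>x. if - real R \<le> x \<and> x < real R then u x else 0)"
    using assms by (auto simp: test_fun_def)
  have "compact (u ` {- real R..real R})"
    by (intro compact_continuous_image continuous_on_subset[OF u(1)]) auto
  then have "bounded (u ` {- real R..real R})" by (rule compact_imp_bounded)
  then obtain M where M: "\<And>y. y \<in> {- real R..real R} \<Longrightarrow> norm (u y) \<le> M"
    unfolding bounded_iff by blast
  show ?thesis
    by (rule that[of M R]) (use M in \<open>auto simp: u(2) indicator_def\<close>)
qed

lemma test_fun_bounded: "test_fun h \<Longrightarrow> bounded (range h)"
proof -
  assume h: "test_fun h"
  obtain M R where M: "\<And>x. norm (h x) \<le> M * indicator {- real R..<real R} x" using test_fun_bound[OF h] by blast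
  have "norm (h x) \<le> max 0 M" for x using M[of x] by (cases "x \<in> {- real R..<real R}") auto
  then show ?thesis by (auto simp: bounded_iff)
qed

lemma integrable_bounded_interval: "integrable lborel (\<lambda>x. M * indicator {- real R..<real R} x :: real)"
  by (intro integrable_mult_right integrable_real_indicator) (auto simp: emeasure_lborel_Ico)

lemma test_fun_integrable: "test_fun h \<Longrightarrow> integrable lborel h"
proof -
  assume h: "test_fun h"
  obtain M R where M: "\<And>x. norm (h x) \<le> M * indicator {- real R..<real R} x" using test_fun_bound[OF h] by blast
  show ?thesis
    by (rule Bochner_Integration.integrable_bound[OF integrable_bounded_interval[of M R]])
       (use M h in \<open>auto intro: order_trans[OF _ abs_ge_self] simp: test_fun_measurable\<close>)
qed

text \<open>The function is sampled at the left endpoints of cells of length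
  \<open>1 / Suc n\<close>. The ends \<open>- R\<close> and \<open>R\<close> of its interval are
  integers, hence cell endpoints for every \<open>n\<close>, so rounding down never carries a point
  across a jump.\<close>

lemma test_fun_step_approx:
  assumes h: "test_fun h"
  defines "H \<equiv> \<lambda>n. step_fun (1 / real (Suc n)) (\<lambda>i. h (of_int i / real (Suc n)))"
  shows "(\<lambda>n. H n x) \<longlonglongrightarrow> h x"
    and "\<exists>S. finite S \<and> (\<forall>i. i \<notin> S \<longrightarrow> h (of_int i / real (Suc n)) = 0)"
    and "\<exists>M R. \<forall>n x. norm (H n x) \<le> M * indicator {- real R..<real R} x"
proof -
  obtain u R where u: "continuous_on UNIV u" "h = (\<lambda>x. if - real R \<le> x \<and> x < real R then u x else 0)"
    using h by (auto simp: test_fun_def)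
  define y where "y n x = of_int \<lfloor>x * real (Suc n)\<rfloor> / real (Suc n)" for n x
  have H: "H n x = h (y n x)" for n x
    by (simp add: H_def step_fun_def y_def)
  have y_le: "y n x \<le> x" for n x
    unfolding y_def by (simp add: divide_le_eq mult.commute del: of_nat_Suc)
  have y_ge: "x - 1 / real (Suc n) \<le> y n x" for n x
  proof -
    have "x * real (Suc n) - 1 \<le> of_int \<lfloor>x * real (Suc n)\<rfloor>" by linarith
    then have "(x * real (Suc n) - 1) / real (Suc n) \<le> y n x"
      unfolding y_def by (intro divide_right_mono) auto
    then show ?thesis by (simp add: diff_divide_distrib)
  qed
  have z: "of_int z \<le> y n x \<longleftrightarrow> of_int z \<le> x" for z n x
  proof
    assume "of_int z \<le> x"
    then have "of_int (z * int (Suc n)) \<le> x * real (Suc n)" by (simp add: mult_right_mono)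
    then have "z * int (Suc n) \<le> \<lfloor>x * real (Suc n)\<rfloor>" by (simp only: le_floor_iff)
    then have "real_of_int (z * int (Suc n)) \<le> of_int \<lfloor>x * real (Suc n)\<rfloor>" by (simp only: of_int_le_iff)
    then show "of_int z \<le> y n x" unfolding y_def by (simp add: pos_le_divide_eq del: of_nat_Suc)
  next
    assume "of_int z \<le> y n x" then show "of_int z \<le> x" using y_le[of n x] by linarith
  qed
  have iff: "- real R \<le> y n x \<and> y n x < real R \<longleftrightarrow> - real R \<le> x \<and> x < real R" for n x
    using z[of "- int R" n x] z[of "int R" n x] by auto
  have ylim: "(\<lambda>n. y n x) \<longlonglongrightarrow> x" for x
  proof (rule tendsto_sandwich[of "\<lambda>n. x - 1 / real (Suc n)" _ _ "\<lambda>_. x"])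
    have "(\<lambda>n. x - 1 / real (Suc n)) \<longlonglongrightarrow> x - 0"
      by (intro tendsto_intros LIMSEQ_Suc lim_1_over_n)
    then show "(\<lambda>n. x - 1 / real (Suc n)) \<longlonglongrightarrow> x" by simp
  qed (use y_le y_ge in auto)
  show "(\<lambda>n. H n x) \<longlonglongrightarrow> h x"
  proof -
    have "(\<lambda>n. u (y n x)) \<longlonglongrightarrow> u x"
      using u(1) by (intro isCont_tendsto_compose[OF _ ylim]) (auto simp: continuous_on_eq_continuous_at)
    then show ?thesis unfolding H u(2) iff by (cases "- real R \<le> x \<and> x < real R") auto
  qed
  show "\<exists>S. finite S \<and> (\<forall>i. i \<notin> S \<longrightarrow> h (of_int i / real (Suc n)) = 0)"
  proof (intro exI[of _ "{- int R * int (Suc n)..int R * int (Suc n)}"] conjI allI impI)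
    fix i assume "i \<notin> {- int R * int (Suc n)..int R * int (Suc n)}"
    then have "i < - int R * int (Suc n) \<or> int R * int (Suc n) < i" by auto
    then have "real_of_int i < of_int (- int R * int (Suc n)) \<or> real_of_int (int R * int (Suc n)) < of_int i"
      by (simp only: of_int_less_iff)
    then have "of_int i / real (Suc n) < - real R \<or> real R < of_int i / real (Suc n)"
      by (simp add: pos_divide_less_eq pos_less_divide_eq del: of_nat_Suc)
    then show "h (of_int i / real (Suc n)) = 0" by (auto simp: u(2))
  qed simp
  obtain M where M: "\<And>x. norm (h x) \<le> M" using test_fun_bounded[OF h] by (auto simp: bounded_iff)
  have "norm (H n x) \<le> M * indicator {- real R..<real R} x" for n x
    using M[of "y n x"] iff[of n x] unfolding H by (auto simp: u(2) indicator_def)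
  then show "\<exists>M R. \<forall>n x. norm (H n x) \<le> M * indicator {- real R..<real R} x" by blast
qed

context CZ_kernel begin

text \<open>Step functions approximate \<open>h\<close> pointwise under a common bounded majorant of
  compact support: Fatou's lemma on the left, dominated convergence on the right.\<close>

theorem strong_type:
  assumes h: "test_fun h" and p: "1 < p" "p \<le> 2"
  shows "(\<integral>\<^sup>+x. ennreal (norm (conv k h x) powr p) \<partial>lborel)
      \<le> ennreal (strong_const p) * (\<integral>\<^sup>+x. ennreal (norm (h x) powr p) \<partial>lborel)"
proof -
  define H where "H n = step_fun (1 / real (Suc n)) (\<lambda>i. h (of_int i / real (Suc n)))" for n
  have lim: "(\<lambda>n. H n x) \<longlonglongrightarrow> h x" for x
    unfolding H_def by (rule test_fun_step_approx(1)[OF h])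
  obtain M R where M: "\<And>n x. norm (H n x) \<le> M * indicator {- real R..<real R} x"
    using test_fun_step_approx(3)[OF h] unfolding H_def by blast
  have [measurable]: "H n \<in> borel_measurable borel" for n by (simp add: H_def)
  have [measurable]: "h \<in> borel_measurable borel" using h by (rule test_fun_measurable)
  have powr_lim: "(\<lambda>n. ennreal (norm (g n) powr p)) \<longlonglongrightarrow> ennreal (norm l powr p)" if "g \<longlonglongrightarrow> l" for g and l :: complex
    using that p by (intro tendsto_ennrealI tendsto_powr' tendsto_norm tendsto_const) auto
  have norm_M: "norm (H n x) \<le> \<bar>M\<bar> * indicator {- real R..<real R} x" for n x
    using M[of n x] by (auto simp: indicator_def split: if_splits)
  have conv_lim: "(\<lambda>n. conv k (H n) x) \<longlonglongrightarrow> conv k h x" for x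
    unfolding conv_def
  proof (rule integral_dominated_convergence[where w="\<lambda>y. \<bar>M\<bar> * norm (k (x - y))"])
    show "integrable lborel (\<lambda>y. \<bar>M\<bar> * norm (k (x - y)))"
      using k_integrable by (intro integrable_mult_right integrable_norm) (simp add: integrable_reflect)
    show "AE y in lborel. (\<lambda>n. k (x - y) * H n y) \<longlonglongrightarrow> k (x - y) * h y"
      by (intro AE_I2 tendsto_intros lim)
    show "AE y in lborel. norm (k (x - y) * H n y) \<le> \<bar>M\<bar> * norm (k (x - y))" for n
    proof (rule AE_I2)
      fix y
      have "norm (H n y) \<le> \<bar>M\<bar>" using norm_M[of n y] by (cases "y \<in> {- real R..<real R}") auto
      then show "norm (k (x - y) * H n y) \<le> \<bar>M\<bar> * norm (k (x - y))"
        by (simp add: norm_mult mult.commute mult_right_mono)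
    qed
  qed measurable
  have C: "(\<lambda>n. \<integral>\<^sup>+x. ennreal (norm (H n x) powr p) \<partial>lborel) \<longlonglongrightarrow> (\<integral>\<^sup>+x. ennreal (norm (h x) powr p) \<partial>lborel)"
  proof (rule nn_integral_dominated_convergence[where w="\<lambda>x. ennreal (\<bar>M\<bar> powr p
      * indicator {- real R..<real R} x)"])
    show "AE x in lborel. (\<lambda>n. ennreal (norm (H n x) powr p)) \<longlonglongrightarrow> ennreal (norm (h x) powr p)"
      by (intro AE_I2 powr_lim lim)
    show "AE x in lborel. ennreal (norm (H n x) powr p)
        \<le> ennreal (\<bar>M\<bar> powr p * indicator {- real R..<real R} x)" for n
    proof (intro AE_I2 ennreal_leI)
      fix x
      show "norm (H n x) powr p \<le> \<bar>M\<bar> powr p * indicator {- real R..<real R} x"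
        using norm_M[of n x] p powr_mono2[of p "norm (H n x)" "\<bar>M\<bar>"]
            by (auto simp: indicator_def split: if_splits)
    qed
    show "(\<integral>\<^sup>+x. ennreal (\<bar>M\<bar> powr p * indicator {- real R..<real R} x) \<partial>lborel) < \<infinity>"
      using integrable_bounded_interval[of "\<bar>M\<bar> powr p" R]
          by (simp add: nn_integral_eq_integral less_top[symmetric])
  qed measurable
  show ?thesis
  proof (rule nn_integral_Fatou_bound[where f="\<lambda>n x. ennreal (norm (conv k (H n) x) powr p)"])
    show "(\<lambda>n. ennreal (norm (conv k (H n) x) powr p)) \<longlonglongrightarrow> ennreal (norm (conv k h x) powr p)" for x
      by (intro powr_lim conv_lim)
    show "(\<lambda>n. ennreal (strong_const p) * (\<integral>\<^sup>+x. ennreal (norm (H n x) powr p) \<partial>lborel))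
        \<longlonglongrightarrow> ennreal (strong_const p) * (\<integral>\<^sup>+x. ennreal (norm (h x) powr p) \<partial>lborel)"
      by (intro ennreal_tendsto_cmult C) auto
    fix n
    obtain S where "finite S" "\<And>i. i \<notin> S \<Longrightarrow> h (of_int i / real (Suc n)) = 0"
      using test_fun_step_approx(2)[OF h, of n] by blast
    then show "(\<integral>\<^sup>+x. ennreal (norm (conv k (H n) x) powr p) \<partial>lborel)
        \<le> ennreal (strong_const p) * (\<integral>\<^sup>+x. ennreal (norm (H n x) powr p) \<partial>lborel)"
      unfolding H_def using p by (intro strong_type_step) auto
  qed measurable
qed

end

subsection \<open>Duality and Khinchine's inequality\<close>

text \<open>Fubini; an even kernel is symmetric in x and y. The pairing is bilinear, without
  conjugation.\<close>

lemma conv_symmetric: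
  fixes k f g :: "real \<Rightarrow> complex"
  assumes k: "integrable lborel k" and even: "\<And>x. k (- x) = k x"
    and f: "f \<in> borel_measurable borel" "bounded (range f)" and g: "integrable lborel g"
  shows "(LINT x|lborel. conv k f x * g x) = (LINT y|lborel. f y * conv k g y)"
proof -
  have [measurable]: "k \<in> borel_measurable borel" "g \<in> borel_measurable borel" "f \<in> borel_measurable borel"
    using k g f by auto
  obtain B where B: "\<And>x. norm (f x) \<le> B" using f(2) by (auto simp: bounded_iff)
  have kB: "integrable lborel (\<lambda>x. of_real B * k x)" using k by (rule integrable_mult_right)
  have ev: "k (x - y) = k (y - x)" for x y using even[of "y - x"] by simp
  have "(LINT x|lborel. conv k f x * g x) = (LINT x|lborel. LINT y|lborel. k (x - y) * f y * g x)"
    unfolding conv_def by simp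
  also have "\<dots> = (LINT y|lborel. LINT x|lborel. k (x - y) * f y * g x)"
  proof (rule lborel_pair.Fubini_integral, rule integrable_pair_convolution[OF kB g])
    fix y x
    have "norm (k (x - y)) * norm (f y) * norm (g x) \<le> norm (k (y - x)) * B * norm (g x)"
      unfolding ev[of x y] by (intro mult_right_mono mult_left_mono B) auto
    also have "\<dots> \<le> norm (of_real B * k (y - x)) * norm (g x)"
      by (intro mult_right_mono) (auto simp: norm_mult mult.commute mult_right_mono)
    finally show "norm (case (y, x) of (y, x) \<Rightarrow> k (x - y) * f y * g x)
        \<le> norm (of_real B * k (y - x)) * norm (g x)"
      by (simp add: norm_mult)
  qed measurable
  also have "\<dots> = (LINT y|lborel. f y * (LINT x|lborel. k (y - x) * g x))"
    unfolding integral_mult_right_zero[symmetric] ev[symmetric] by (simp only: mult_ac)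
  finally show ?thesis by (simp add: conv_def)
qed

text \<open>If \<open>a \<le> \<eta> * b powr (q - 1)\<close>, the first term alone dominates;
  otherwise \<open>b \<le> (a / \<eta>) powr (r - 1)\<close> and the second one does. The free
  weight \<eta> is what permits absorption.\<close>

lemma weighted_Young:
  fixes a b \<eta> r q :: real
  assumes "a \<ge> 0" "b \<ge> 0" "\<eta> > 0" "r > 1" "q = r / (r - 1)"
  shows "a * b \<le> \<eta> * b powr q + \<eta> powr (1 - r) * a powr r"
proof (cases "a \<le> \<eta> * b powr (q - 1) \<or> b = 0")
  case True
  have q: "q > 1" using assms(4) unfolding assms(5) by (simp add: less_divide_eq)
  have "a * b \<le> \<eta> * b powr q"
  proof (cases "b = 0")
    case False
    then have "a * b \<le> \<eta> * b powr (q - 1) * b" using True assms(2) by (intro mult_right_mono) auto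
    also have "\<dots> = \<eta> * b powr q" using False assms(2) by (simp add: powr_diff)
    finally show ?thesis .
  qed simp
  moreover have "0 \<le> \<eta> powr (1 - r) * a powr r" by simp
  ultimately show ?thesis by linarith
next
  case False
  then have b: "b > 0" and lt: "\<eta> * b powr (q - 1) < a" using assms(2) by auto
  have a: "a > 0" using lt assms(3) by (meson le_less_trans mult_nonneg_nonneg powr_ge_zero less_imp_le)
  have rq: "(q - 1) * (r - 1) = 1" using assms(4,5) by (simp add: field_simps)
  have "b powr (q - 1) \<le> a / \<eta>" using lt assms(3) by (simp add: field_simps)
  then have "(b powr (q - 1)) powr (r - 1) \<le> (a / \<eta>) powr (r - 1)"
    using assms(4) by (intro powr_mono2) auto
  then have "b \<le> (a / \<eta>) powr (r - 1)" using b rq by (simp add: powr_powr)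
  then have "a * b \<le> a * (a / \<eta>) powr (r - 1)" using a by (intro mult_left_mono) auto
  also have "\<dots> = a powr r * \<eta> powr (1 - r)"
  proof -
    have "a * a powr (r - 1) = a powr r" using a by (simp add: powr_mult_base)
    moreover have "(a / \<eta>) powr (r - 1) = a powr (r - 1) * \<eta> powr (1 - r)"
      using powr_minus[of \<eta> "r - 1"] by (simp add: powr_divide divide_inverse[of "a powr _"])
    ultimately show ?thesis by (simp only: mult.assoc[symmetric])
  qed
  also have "\<dots> \<le> \<eta> * b powr q + \<eta> powr (1 - r) * a powr r" using assms(3) by (simp add: mult.commute)
  finally show ?thesis .
qed

text \<open>The extremal function of L^r duality must be continuous for its truncation to be a test
  function. At 0 it is 0, and its modulus \<open>norm z powr (r - 1)\<close> tends to 0 there even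
  when \<open>r < 2\<close>.\<close>

lemma continuous_cnj_powr:
  assumes "r > 1"
  shows "continuous_on UNIV (\<lambda>z::complex. cnj z * of_real (norm z powr (r - 2)))"
proof (rule continuous_at_imp_continuous_on, rule ballI)
  fix z :: complex
  show "isCont (\<lambda>z. cnj z * of_real (norm z powr (r - 2))) z"
  proof (cases "z = 0")
    case False
    then show ?thesis by (intro continuous_intros) auto
  next
    case True
    have "((\<lambda>z::complex. norm z powr (r - 1)) \<longlongrightarrow> 0) (at 0)"
    proof -
      have "((\<lambda>z::complex. norm z powr (r - 1)) \<longlongrightarrow> norm (0::complex) powr (r - 1)) (at 0)"
        using assms by (intro tendsto_powr' tendsto_norm tendsto_const) (auto intro: tendsto_ident_at)
      then show ?thesis by simp
    qed
    moreover have "norm (cnj z * complex_of_real (norm z powr (r - 2))) = norm z powr (r - 1)" for z :: complex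
    proof (cases "z = 0")
      case False
      then have "norm z * norm z powr (r - 2) = norm z powr (r - 1)" by (simp add: powr_mult_base)
      then show ?thesis by (simp add: norm_mult)
    qed simp
    ultimately have "((\<lambda>z::complex. norm (cnj z * complex_of_real (norm z powr (r - 2)))) \<longlongrightarrow> 0) (at 0)"
      by simp
    then show ?thesis using True by (simp add: isCont_def tendsto_norm_zero_iff)
  qed
qed

text \<open>The weight \<eta> = \<open>1 / (2 * (C + 1))\<close> gives
  \<open>\<eta> * C \<le> 1 / 2\<close>; moving that half to the other side produces the factor
  2.\<close>

definition dual_const :: "real \<Rightarrow> real \<Rightarrow> real" where
  "dual_const r C = 2 * (1 / (2 * (C + 1))) powr (1 - r)"

text \<open>Test \<open>U\<close> against the truncation of \<open>cnj U * norm U powr (r - 2)\<close> to an interval. The term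
  \<open>\<eta> * b powr q\<close> of Young's inequality is then absorbed into the left-hand side, which is finite
  by the truncation.\<close>

lemma dual_bound:
  fixes U :: "real \<Rightarrow> complex" and a :: "real \<Rightarrow> real"
  assumes U: "continuous_on UNIV U" and r: "r > 1" and q: "q = r / (r - 1)" and C: "C \<ge> 0"
    and a[measurable]: "a \<in> borel_measurable borel" and a0: "\<And>x. a x \<ge> 0"
    and dual: "\<And>h. test_fun h \<Longrightarrow> \<exists>b. b \<in> borel_measurable borel \<and> (\<forall>x. b x \<ge> (0::real)) \<and>
      ennreal (norm (LINT x|lborel. U x * h x)) \<le> (\<integral>\<^sup>+x. ennreal (a x * b x) \<partial>lborel) \<and>
      (\<integral>\<^sup>+x. ennreal (b x powr q) \<partial>lborel) \<le> ennreal C * (\<integral>\<^sup>+x. ennreal (norm (h x) powr q) \<partial>lborel)"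
  shows "(\<integral>\<^sup>+x. ennreal (norm (U x) powr r) \<partial>lborel)
      \<le> ennreal (dual_const r C) * (\<integral>\<^sup>+x. ennreal (a x powr r) \<partial>lborel)"
proof -
  have [measurable]: "U \<in> borel_measurable borel" using U by (rule borel_measurable_continuous_onI)
  have q1: "q > 1" using r unfolding q by (simp add: less_divide_eq)
  define \<eta> where "\<eta> = 1 / (2 * (C + 1))"
  have eta: "\<eta> > 0" "\<eta> * C \<le> 1 / 2" using C by (auto simp: \<eta>_def field_simps)
  let ?Y = "\<integral>\<^sup>+x. ennreal (a x powr r) \<partial>lborel"
  let ?I = "\<lambda>R::nat. {- real R..<real R}"
  have main: "(\<integral>\<^sup>+x. ennreal (norm (U x) powr r) * indicator (?I R) x \<partial>lborel)
      \<le> ennreal (dual_const r C) * ?Y" for R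
  proof -
    let ?X = "\<integral>\<^sup>+x. ennreal (norm (U x) powr r) * indicator (?I R) x \<partial>lborel"
    define h where "h x = (if - real R \<le> x \<and> x < real R then cnj (U x)
        * of_real (norm (U x) powr (r - 2)) else 0)" for x
    have h: "test_fun h"
      unfolding test_fun_def h_def[abs_def]
      by (intro exI[of _ "\<lambda>x. cnj (U x) * of_real (norm (U x) powr (r - 2))"] exI[of _ R] conjI
          continuous_on_compose2[OF continuous_cnj_powr[OF r] U]) auto
    have Uh: "U x * h x = complex_of_real (norm (U x) powr r * indicator (?I R) x)" for x
    proof (cases "U x = 0 \<or> x \<notin> ?I R")
      case False
      have "(norm (U x))\<^sup>2 * norm (U x) powr (r - 2) = norm (U x) powr 2 * norm (U x) powr (r - 2)"
        using False by (simp add: powr_numeral)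
      also have "\<dots> = norm (U x) powr r" by (simp only: powr_add[symmetric]) simp
      finally have *: "(norm (U x))\<^sup>2 * norm (U x) powr (r - 2) = norm (U x) powr r" .
      have "U x * h x = (U x * cnj (U x)) * of_real (norm (U x) powr (r - 2))"
        using False by (simp add: h_def)
      also have "U x * cnj (U x) = of_real ((norm (U x))\<^sup>2)" by (rule complex_norm_square[symmetric])
      finally show ?thesis using False by (simp add: *[symmetric])
    qed (auto simp: h_def)
    have hq: "norm (h x) powr q = norm (U x) powr r * indicator (?I R) x" for x
    proof (cases "U x = 0 \<or> x \<notin> ?I R")
      case False
      have "norm (h x) = norm (U x) * norm (U x) powr (r - 2)" using False by (simp add: h_def norm_mult)
      also have "\<dots> = norm (U x) powr (r - 1)" using False by (simp add: powr_mult_base)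
      finally have "norm (h x) powr q = norm (U x) powr ((r - 1) * q)" by (simp add: powr_powr)
      also have "(r - 1) * q = r" using r q by simp
      finally show ?thesis using False by simp
    qed (auto simp: h_def)
    obtain b where b: "b \<in> borel_measurable borel" "\<And>x. b x \<ge> 0"
      "ennreal (norm (LINT x|lborel. U x * h x)) \<le> (\<integral>\<^sup>+x. ennreal (a x * b x) \<partial>lborel)"
      "(\<integral>\<^sup>+x. ennreal (b x powr q) \<partial>lborel) \<le> ennreal C * (\<integral>\<^sup>+x. ennreal (norm (h x) powr q) \<partial>lborel)"
      using dual[OF h] by blast
    have [measurable]: "b \<in> borel_measurable borel" by (rule b(1))
    have X_eq: "?X = (\<integral>\<^sup>+x. ennreal (norm (h x) powr q) \<partial>lborel)"
      unfolding hq by (intro nn_integral_cong) (auto simp: indicator_def)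
    have int: "integrable lborel (\<lambda>x. norm (U x) powr r * indicator (?I R) x)"
    proof -
      have "compact (U ` {- real R..real R})"
        by (intro compact_continuous_image continuous_on_subset[OF U]) auto
      then have "bounded (U ` {- real R..real R})" by (rule compact_imp_bounded)
      then obtain M where M: "\<And>x. x \<in> {- real R..real R} \<Longrightarrow> norm (U x) \<le> M"
        unfolding bounded_iff by blast
      show ?thesis
      proof (rule Bochner_Integration.integrable_bound[OF integrable_bounded_interval[of "M powr r" R]])
        show "AE x in lborel. norm (norm (U x) powr r * indicator (?I R) x)
            \<le> norm (M powr r * indicator (?I R) x)"
        proof (rule AE_I2)
          fix x
          show "norm (norm (U x) powr r * indicator (?I R) x) \<le> norm (M powr r * indicator (?I R) x)"
            using M[of x] r by (cases "x \<in> ?I R") (auto intro!: powr_mono2)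
        qed
      qed measurable
    qed
    have X_int: "?X = ennreal (LINT x|lborel. norm (U x) powr r * indicator (?I R) x)"
      by (subst nn_integral_eq_integral[OF int, symmetric]) (auto simp: indicator_def intro!: nn_integral_cong)
    have "(LINT x|lborel. U x * h x) = of_real (LINT x|lborel. norm (U x) powr r * indicator (?I R) x)"
      unfolding Uh by (rule integral_complex_of_real)
    then have "?X = ennreal (norm (LINT x|lborel. U x * h x))"
      unfolding X_int by (simp add: abs_of_nonneg Bochner_Integration.integral_nonneg)
    also note b(3)
    also have "(\<integral>\<^sup>+x. ennreal (a x * b x) \<partial>lborel)
        \<le> (\<integral>\<^sup>+x. ennreal \<eta> * ennreal (b x powr q) + ennreal (\<eta> powr (1 - r)) * ennreal (a x powr r) \<partial>lborel)"
    proof (rule nn_integral_mono)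
      fix x
      have "ennreal (a x * b x) \<le> ennreal (\<eta> * b x powr q + \<eta> powr (1 - r) * a x powr r)"
        by (intro ennreal_leI weighted_Young a0 b(2) eta r q)
      then show "ennreal (a x * b x) \<le> ennreal \<eta> * ennreal (b x powr q)
          + ennreal (\<eta> powr (1 - r)) * ennreal (a x powr r)"
        using eta by (simp add: ennreal_mult[symmetric])
    qed
    also have "\<dots> = ennreal \<eta> * (\<integral>\<^sup>+x. ennreal (b x powr q) \<partial>lborel) + ennreal (\<eta> powr (1 - r)) * ?Y"
      by (simp add: nn_integral_add nn_integral_cmult)
    also have "\<dots> \<le> ennreal \<eta> * (ennreal C * ?X) + ennreal (\<eta> powr (1 - r)) * ?Y"
      using b(4) unfolding X_eq by (intro add_mono mult_left_mono) auto
    also have "\<dots> \<le> ennreal (1 / 2) * ?X + ennreal (\<eta> powr (1 - r)) * ?Y"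
    proof (rule add_right_mono)
      have "ennreal (\<eta> * C) * ?X \<le> ennreal (1 / 2) * ?X"
        by (intro mult_right_mono ennreal_leI eta) auto
      then show "ennreal \<eta> * (ennreal C * ?X) \<le> ennreal (1 / 2) * ?X"
        unfolding mult.assoc[symmetric] using eta(1) C by (subst ennreal_mult[symmetric]) auto
    qed
    finally have X: "?X \<le> ennreal (1 / 2) * ?X + ennreal (\<eta> powr (1 - r)) * ?Y" .
    \<comment> \<open>If \<open>?Y\<close> is infinite, the claim rests on the constant being
      positive, as 0 times \<infinity> is 0 in \<open>ennreal\<close>.\<close>
    show ?thesis
    proof (cases "?Y = \<infinity>")
      case True
      have "dual_const r C > 0" using eta unfolding dual_const_def \<eta>_def[symmetric] by simp
      then show ?thesis using True by (simp add: ennreal_mult_top)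
    next
      case False
      then obtain y where y: "?Y = ennreal y" "y \<ge> 0" by (cases ?Y) auto
      let ?x = "LINT x|lborel. norm (U x) powr r * indicator (?I R) x"
      have x0: "?x \<ge> 0" by (rule Bochner_Integration.integral_nonneg) simp
      have "ennreal ?x \<le> ennreal (1 / 2 * ?x + \<eta> powr (1 - r) * y)"
      proof -
        have "ennreal (1 / 2 * ?x + \<eta> powr (1 - r) * y)
            = ennreal (1 / 2) * ennreal ?x + ennreal (\<eta> powr (1 - r)) * ennreal y"
        proof -
          have 1: "ennreal (1 / 2 * ?x) = ennreal (1 / 2) * ennreal ?x"
            by (rule ennreal_mult) (use x0 in auto)
          have 2: "ennreal (\<eta> powr (1 - r) * y) = ennreal (\<eta> powr (1 - r)) * ennreal y"
            by (rule ennreal_mult) (use y(2) in auto)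
          show ?thesis
            unfolding 1[symmetric] 2[symmetric] by (rule ennreal_plus) (use x0 y(2) in auto)
        qed
        then show ?thesis using X unfolding X_int y(1) by simp
      qed
      moreover have "0 \<le> 1 / 2 * ?x + \<eta> powr (1 - r) * y" using x0 y(2) by simp
      ultimately have "?x \<le> 1 / 2 * ?x + \<eta> powr (1 - r) * y"
        using ennreal_le_iff by blast
      then have "?x \<le> dual_const r C * y" unfolding dual_const_def \<eta>_def[symmetric] by simp
      then show ?thesis unfolding X_int y(1) using y(2) eta
        by (subst ennreal_mult[symmetric]) (auto simp: dual_const_def intro: ennreal_leI)
    qed
  qed
  show ?thesis
  proof (rule nn_integral_Fatou_bound[where f="\<lambda>R x. ennreal (norm (U x) powr r) * indicator (?I R) x"
        and C="\<lambda>_. ennreal (dual_const r C) * ?Y"])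
    fix x
    obtain N :: nat where N: "\<bar>x\<bar> < real N" using reals_Archimedean2 by blast
    have "eventually (\<lambda>R. ennreal (norm (U x) powr r) * indicator (?I R) x
        = ennreal (norm (U x) powr r)) sequentially"
      using eventually_ge_at_top[of N]
    proof eventually_elim
      case (elim R)
      then have "\<bar>x\<bar> < real R" using N by (meson less_le_trans of_nat_le_iff)
      then have "x \<in> ?I R" by auto
      then show ?case by simp
    qed
    then show "(\<lambda>R. ennreal (norm (U x) powr r) * indicator (?I R) x) \<longlonglongrightarrow> ennreal (norm (U x) powr r)"
      by (rule tendsto_eventually)
  qed (use main in auto)
qed

lemma dual_const_nonneg: "dual_const r C \<ge> 0"
  by (simp add: dual_const_def)

lemma continuous_conv:
  fixes k h :: "real \<Rightarrow> complex"
  assumes k: "continuous_on UNIV k" "bounded (range k)" and h: "integrable lborel h"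
  shows "continuous_on UNIV (conv k h)"
proof -
  obtain B where B: "\<And>x. norm (k x) \<le> B" using k(2) by (auto simp: bounded_iff)
  have [measurable]: "k \<in> borel_measurable borel" "h \<in> borel_measurable borel"
    using k(1) h borel_measurable_continuous_onI by auto
  show ?thesis
    unfolding conv_def[abs_def]
  proof (rule continuous_on_LINT[where w="\<lambda>y. B * norm (h y)"])
    show "continuous_on UNIV (\<lambda>x. k (x - y) * h y)" for y
      by (intro continuous_intros continuous_on_compose2[OF k(1)]) auto
    show "norm (k (x - y) * h y) \<le> B * norm (h y)" for x y
      by (simp add: norm_mult B mult_right_mono)
  qed (use h in auto)
qed

text \<open>Evenness makes the operator symmetric; continuity and boundedness of the kernel make
  \<open>conv k h\<close> continuous, as \<open>dual_bound\<close> requires.\<close>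

locale CZ_even = CZ_kernel +
  assumes k_cont: "continuous_on UNIV k" and k_bdd: "bounded (range k)" and k_even: "\<And>x. k (- x) = k x"
begin

definition "Lp_const p = (if p \<le> 2 then strong_const p else dual_const p (strong_const (p / (p - 1))))"

lemma Lp_const_nonneg: "1 < p \<Longrightarrow> Lp_const p \<ge> 0"
  using strong_const_nonneg[of p] dual_const_nonneg[of p] by (simp add: Lp_const_def)

text \<open>Beyond 2 the kernel is moved to the dual test function by symmetry, and the conjugate
  exponent is below 2.\<close>

theorem Lp_bound:
  assumes h: "test_fun h" and p: "1 < p"
  shows "(\<integral>\<^sup>+x. ennreal (norm (conv k h x) powr p) \<partial>lborel)
      \<le> ennreal (Lp_const p) * (\<integral>\<^sup>+x. ennreal (norm (h x) powr p) \<partial>lborel)"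
proof (cases "p \<le> 2")
  case True
  then show ?thesis using strong_type[OF h p] by (simp add: Lp_const_def)
next
  case False
  let ?q = "p / (p - 1)"
  have q: "1 < ?q" "?q \<le> 2" using False by (auto simp: field_simps)
  have [measurable]: "h \<in> borel_measurable borel" using h by (rule test_fun_measurable)
  have "(\<integral>\<^sup>+x. ennreal (norm (conv k h x) powr p) \<partial>lborel)
      \<le> ennreal (dual_const p (strong_const ?q)) * (\<integral>\<^sup>+x. ennreal (norm (h x) powr p) \<partial>lborel)"
  proof (rule dual_bound[where q="?q"])
    show "continuous_on UNIV (conv k h)"
      by (intro continuous_conv k_cont k_bdd test_fun_integrable h)
    fix g assume g: "test_fun g"
    have [measurable]: "g \<in> borel_measurable borel" using g by (rule test_fun_measurable)
    have "(LINT x|lborel. conv k h x * g x) = (LINT x|lborel. h x * conv k g x)"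
      by (rule conv_symmetric[OF k_integrable k_even _ test_fun_bounded[OF h] test_fun_integrable[OF g]])
          measurable
    then have "ennreal (norm (LINT x|lborel. conv k h x * g x))
        \<le> (\<integral>\<^sup>+x. ennreal (norm (h x) * norm (conv k g x)) \<partial>lborel)"
      using norm_integral_le_nn_integral[of lborel "\<lambda>x. h x * conv k g x"] by (simp add: norm_mult)
    then show "\<exists>b. b \<in> borel_measurable borel \<and> (\<forall>x. b x \<ge> (0::real)) \<and>
      ennreal (norm (LINT x|lborel. conv k h x * g x)) \<le> (\<integral>\<^sup>+x. ennreal (norm (h x) * b x) \<partial>lborel) \<and>
      (\<integral>\<^sup>+x. ennreal (b x powr ?q) \<partial>lborel) \<le> ennreal (strong_const ?q)
          * (\<integral>\<^sup>+x. ennreal (norm (g x) powr ?q) \<partial>lborel)"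
      using strong_type[OF g q] by (intro exI[of _ "\<lambda>x. norm (conv k g x)"]) auto
  qed (use p strong_const_nonneg[OF q] in auto)
  then show ?thesis using False by (simp add: Lp_const_def)
qed

end

section \<open>Khinchine's inequality\<close>

text \<open>A choice of signs is encoded by the set \<open>S\<close> of indices with sign +1, so
  that expectations are averages over \<open>Pow J\<close>.\<close>

definition sgn_sum :: "'i set \<Rightarrow> 'i set \<Rightarrow> ('i \<Rightarrow> complex) \<Rightarrow> complex" where
  "sgn_sum J S a = (\<Sum>j\<in>J. (if j \<in> S then 1 else - 1) * a j)"

text \<open>Conditioning on the sign of the new index: the induction step for both moments.\<close>

lemma sum_Pow_sgn_sum_insert:
  fixes f :: "complex \<Rightarrow> real"
  assumes "finite J" "j \<notin> J"
  shows "(\<Sum>S\<in>Pow (insert j J). f (sgn_sum (insert j J) S a)) =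
    (\<Sum>S\<in>Pow J. f (sgn_sum J S a - a j) + f (sgn_sum J S a + a j))"
proof -
  have dis: "Pow J \<inter> insert j ` Pow J = {}" using assms(2) by auto
  have inj: "inj_on (insert j) (Pow J)" using assms(2) by (auto simp: inj_on_def)
  have "(\<Sum>S\<in>Pow (insert j J). f (sgn_sum (insert j J) S a)) =
    (\<Sum>S\<in>Pow J. f (sgn_sum (insert j J) S a)) + (\<Sum>S\<in>Pow J. f (sgn_sum (insert j J) (insert j S) a))"
    unfolding Pow_insert using assms(1) dis inj
    by (subst sum.union_disjoint) (auto simp: sum.reindex)
  also have "(\<Sum>S\<in>Pow J. f (sgn_sum (insert j J) S a)) = (\<Sum>S\<in>Pow J. f (sgn_sum J S a - a j))"
    using assms by (intro sum.cong refl arg_cong[of _ _ f]) (auto simp: sgn_sum_def)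
  also have "(\<Sum>S\<in>Pow J. f (sgn_sum (insert j J) (insert j S) a)) = (\<Sum>S\<in>Pow J. f (sgn_sum J S a + a j))"
  proof (intro sum.cong refl arg_cong[of _ _ f])
    fix S
    have "(\<Sum>i\<in>J. (if i \<in> insert j S then 1 else - 1) * a i) = (\<Sum>i\<in>J. (if i \<in> S then 1 else - 1) * a i)"
      using assms(2) by (intro sum.cong) auto
    then show "sgn_sum (insert j J) (insert j S) a = sgn_sum J S a + a j"
      using assms by (simp add: sgn_sum_def)
  qed
  finally show ?thesis by (simp add: sum.distrib)
qed

text \<open>The parallelogram law cancels the cross terms of each added sign.\<close>

lemma Khinchine_moment2:
  assumes "finite J"
  shows "(\<Sum>S\<in>Pow J. (norm (sgn_sum J S a))\<^sup>2) = 2 ^ card J * (\<Sum>j\<in>J. (norm (a j))\<^sup>2)"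
  using assms
proof (induction J rule: finite_induct)
  case empty
  then show ?case by (simp add: sgn_sum_def)
next
  case (insert j J)
  have par: "(norm (x - y))\<^sup>2 + (norm (x + y))\<^sup>2 = 2 * (norm x)\<^sup>2 + 2 * (norm y)\<^sup>2" for x y :: complex
    unfolding cmod_power2 by (simp add: power2_eq_square algebra_simps)
  show ?case
    unfolding sum_Pow_sgn_sum_insert[OF insert.hyps, where f="\<lambda>z. (norm z)\<^sup>2"] par
    using insert by (simp add: sum.distrib sum_distrib_left[symmetric] card_Pow algebra_simps)
qed

text \<open>The factor 3 is dictated by the cross term: \<open>12 * ?b * ?s\<close> is exactly the
  cross term of \<open>6 * (?b + ?s)\<^sup>2\<close>, the 6 being 3 times the doubling of the number
  of sign choices.\<close>

lemma Khinchine_moment4: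
  assumes "finite J"
  shows "(\<Sum>S\<in>Pow J. (norm (sgn_sum J S a)) ^ 4) \<le> 3 * 2 ^ card J * (\<Sum>j\<in>J. (norm (a j))\<^sup>2)\<^sup>2"
  using assms
proof (induction J rule: finite_induct)
  case empty
  then show ?case by (simp add: sgn_sum_def)
next
  case (insert j J)
  let ?s = "\<Sum>j\<in>J. (norm (a j))\<^sup>2" and ?b = "(norm (a j))\<^sup>2"
  have four: "(norm (x - y)) ^ 4 + (norm (x + y)) ^ 4
      \<le> 2 * (norm x) ^ 4 + 12 * (norm y)\<^sup>2 * (norm x)\<^sup>2 + 2 * (norm y) ^ 4" for x y :: complex
  proof -
    define u v where "u = (norm x)\<^sup>2 + (norm y)\<^sup>2" and "v = 2 * (x \<bullet> y)"
    have m: "(norm (x - y))\<^sup>2 = u - v" and p: "(norm (x + y))\<^sup>2 = u + v"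
      unfolding u_def v_def by (simp_all add: power2_norm_eq_inner inner_diff_left inner_diff_right inner_add_left
          inner_add_right inner_commute algebra_simps)
    have "v\<^sup>2 \<le> 4 * ((norm x)\<^sup>2 * (norm y)\<^sup>2)"
      using Cauchy_Schwarz_ineq[of x y] unfolding v_def power2_norm_eq_inner by (simp add: power_mult_distrib)
    moreover have "(norm (x - y)) ^ 4 + (norm (x + y)) ^ 4 = ((norm (x - y))\<^sup>2)\<^sup>2 + ((norm (x + y))\<^sup>2)\<^sup>2"
      by simp
    moreover have "\<dots> = 2 * u\<^sup>2 + 2 * v\<^sup>2" unfolding m p by (simp add: power2_eq_square algebra_simps)
    moreover have "u\<^sup>2 = (norm x) ^ 4 + 2 * ((norm x)\<^sup>2 * (norm y)\<^sup>2) + (norm y) ^ 4"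
      unfolding u_def by (simp add: power2_eq_square power4_eq_xxxx algebra_simps)
    ultimately show ?thesis by (simp add: mult.commute)
  qed
  have "(\<Sum>S\<in>Pow (insert j J). (norm (sgn_sum (insert j J) S a)) ^ 4) \<le>
    (\<Sum>S\<in>Pow J. 2 * (norm (sgn_sum J S a)) ^ 4 + 12 * ?b * (norm (sgn_sum J S a))\<^sup>2 + 2 * (norm (a j)) ^ 4)"
    unfolding sum_Pow_sgn_sum_insert[OF insert.hyps, where f="\<lambda>z. norm z ^ 4"] by (intro sum_mono four)
  also have "\<dots> = 2 * (\<Sum>S\<in>Pow J. (norm (sgn_sum J S a)) ^ 4) + 12 * ?b * (2 ^ card J * ?s)
      + 2 ^ card J * (2 * (norm (a j)) ^ 4)"
    using insert.hyps by (simp add: sum.distrib sum_distrib_left[symmetric] Khinchine_moment2 card_Pow)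
  also have "\<dots> \<le> 2 * (3 * 2 ^ card J * ?s\<^sup>2) + 12 * ?b * (2 ^ card J * ?s) + 2 ^ card J * (2 * (norm (a j)) ^ 4)"
    using insert.IH by simp
  also have "\<dots> \<le> 3 * 2 ^ card (insert j J) * (?b + ?s)\<^sup>2"
  proof -
    have "(norm (a j)) ^ 4 = ?b\<^sup>2" by simp
    then have "3 * 2 ^ card (insert j J) * (?b + ?s)\<^sup>2 - (2 * (3 * 2 ^ card J * ?s\<^sup>2) + 12 * ?b * (2 ^ card J * ?s)
        + 2 ^ card J * (2 * (norm (a j)) ^ 4)) = 2 ^ card J * (4 * ?b\<^sup>2)"
      using insert.hyps by (simp add: power2_eq_square algebra_simps)
    moreover have "2 ^ card J * (4 * ?b\<^sup>2) \<ge> 0" by simp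
    ultimately show ?thesis by linarith
  qed
  finally show ?case using insert.hyps by simp
qed

text \<open>The base of the power is the truncation level in units of the standard deviation. With
  \<open>sqrt 6\<close> the fourth moment, and with \<open>sqrt (1 / 2)\<close> the values below the
  level, use up half of the second moment; the factor 2 restores it.\<close>

definition Khinchine_const :: "real \<Rightarrow> real" where
  "Khinchine_const p = 2 * (if p \<le> 2 then sqrt 6 else sqrt (1 / 2)) powr (2 - p)"

lemma Khinchine_const_pos: "Khinchine_const p > 0"
  by (simp add: Khinchine_const_def)

text \<open>The second moment is split at the level \<open>c * \<sigma>\<close>. On one side of it
  squares are bounded by p-th powers. The other side is covered by the fourth moment when
  \<open>p \<le> 2\<close>, and by the square of the level when \<open>p > 2\<close>.\<close>

theorem Khinchine:
  assumes J: "finite J" and p: "p > 0"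
  shows "sqrt (\<Sum>j\<in>J. (norm (a j))\<^sup>2) powr p \<le> Khinchine_const p
      * ((\<Sum>S\<in>Pow J. norm (sgn_sum J S a) powr p) / 2 ^ card J)"
proof (cases "(\<Sum>j\<in>J. (norm (a j))\<^sup>2) = 0")
  case True
  then show ?thesis using less_imp_le[OF Khinchine_const_pos]
      by (auto intro!: mult_nonneg_nonneg divide_nonneg_nonneg sum_nonneg)
next
  case False
  define \<sigma> where "\<sigma> = sqrt (\<Sum>j\<in>J. (norm (a j))\<^sup>2)"
  have s2: "(\<Sum>j\<in>J. (norm (a j))\<^sup>2) = \<sigma>\<^sup>2" unfolding \<sigma>_def by (simp add: sum_nonneg)
  have s: "\<sigma> > 0" using False unfolding \<sigma>_def by (simp add: sum_nonneg less_le)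
  define c where "c = (if p \<le> 2 then sqrt 6 else sqrt (1 / 2))"
  have c: "c > 0" by (simp add: c_def)
  let ?X = "\<lambda>S. norm (sgn_sum J S a)"
  let ?n = "2 ^ card J :: real"
  have m2: "(\<Sum>S\<in>Pow J. (?X S)\<^sup>2) = ?n * \<sigma>\<^sup>2" using Khinchine_moment2[OF J, of a] s2 by simp
  have "?n * \<sigma>\<^sup>2 \<le> 2 * ((c * \<sigma>) powr (2 - p) * (\<Sum>S\<in>Pow J. ?X S powr p))"
  proof (cases "p \<le> 2")
    case True
    have *: "x\<^sup>2 \<le> (c * \<sigma>) powr (2 - p) * x powr p + x ^ 4 / (c * \<sigma>)\<^sup>2" if "x \<ge> 0" for x
    proof (cases "x \<le> c * \<sigma>")
      case le: True
      have "x\<^sup>2 = x powr (2 - p) * x powr p"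
        using that by (cases "x = 0") (auto simp: powr_add[symmetric] powr_numeral p)
      also have "\<dots> \<le> (c * \<sigma>) powr (2 - p) * x powr p"
        using le that True by (intro mult_right_mono powr_mono2) auto
      finally show ?thesis using zero_le_divide_iff[of "x ^ 4" "(c * \<sigma>)\<^sup>2"] by (simp add: add_increasing2)
    next
      case gt: False
      have "(c * \<sigma>)\<^sup>2 \<le> x\<^sup>2" using gt c s by (intro power_mono) auto
      then have "x\<^sup>2 * (c * \<sigma>)\<^sup>2 \<le> x\<^sup>2 * x\<^sup>2" by (intro mult_left_mono) auto
      then have "x\<^sup>2 * (c * \<sigma>)\<^sup>2 \<le> x ^ 4" by (simp add: power2_eq_square power4_eq_xxxx mult.assoc)
      then have "x\<^sup>2 \<le> x ^ 4 / (c * \<sigma>)\<^sup>2" using c s by (subst pos_le_divide_eq) auto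
      moreover have "0 \<le> (c * \<sigma>) powr (2 - p) * x powr p" by simp
      ultimately show ?thesis by linarith
    qed
    have "?n * \<sigma>\<^sup>2 \<le> (\<Sum>S\<in>Pow J. (c * \<sigma>) powr (2 - p) * ?X S powr p + ?X S ^ 4 / (c * \<sigma>)\<^sup>2)"
      unfolding m2[symmetric] by (intro sum_mono *) auto
    also have "\<dots> = (c * \<sigma>) powr (2 - p) * (\<Sum>S\<in>Pow J. ?X S powr p) + (\<Sum>S\<in>Pow J. ?X S ^ 4) / (c * \<sigma>)\<^sup>2"
      by (simp add: sum.distrib sum_distrib_left sum_divide_distrib)
    also have "(\<Sum>S\<in>Pow J. ?X S ^ 4) / (c * \<sigma>)\<^sup>2 \<le> (3 * ?n * (\<sigma>\<^sup>2)\<^sup>2) / (c * \<sigma>)\<^sup>2"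
      using Khinchine_moment4[OF J, of a] s2 by (intro divide_right_mono) auto
    also have "(3 * ?n * (\<sigma>\<^sup>2)\<^sup>2) / (c * \<sigma>)\<^sup>2 = ?n * \<sigma>\<^sup>2 / 2"
      using True s by (simp add: c_def power_mult_distrib power2_eq_square)
    finally show ?thesis by simp
  next
    case False
    have *: "x\<^sup>2 \<le> (c * \<sigma>)\<^sup>2 + (c * \<sigma>) powr (2 - p) * x powr p" if "x \<ge> 0" for x
    proof (cases "x \<le> c * \<sigma>")
      case True
      then have "x\<^sup>2 \<le> (c * \<sigma>)\<^sup>2" using that by (intro power_mono) auto
      moreover have "0 \<le> (c * \<sigma>) powr (2 - p) * x powr p" by simp
      ultimately show ?thesis by linarith
    next
      case gt: False
      then have x: "x > 0" using c s by (smt (verit) mult_pos_pos)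
      have "x\<^sup>2 = x powr (2 - p) * x powr p"
        using x by (auto simp: powr_add[symmetric] powr_numeral)
      also have "x powr (2 - p) \<le> (c * \<sigma>) powr (2 - p)"
        using gt False c s by (intro powr_mono2') auto
      finally have "x\<^sup>2 \<le> (c * \<sigma>) powr (2 - p) * x powr p" by (simp add: mult_right_mono)
      then show ?thesis by (simp add: add_increasing)
    qed
    have "?n * \<sigma>\<^sup>2 \<le> (\<Sum>S\<in>Pow J. (c * \<sigma>)\<^sup>2 + (c * \<sigma>) powr (2 - p) * ?X S powr p)"
      unfolding m2[symmetric] by (intro sum_mono *) auto
    also have "\<dots> = ?n * (c * \<sigma>)\<^sup>2 + (c * \<sigma>) powr (2 - p) * (\<Sum>S\<in>Pow J. ?X S powr p)"
      using J by (simp add: sum.distrib sum_distrib_left card_Pow)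
    also have "?n * (c * \<sigma>)\<^sup>2 = ?n * \<sigma>\<^sup>2 / 2"
      using False by (simp add: c_def power_mult_distrib power_divide)
    finally show ?thesis by simp
  qed
  also have "(c * \<sigma>) powr (2 - p) = c powr (2 - p) * \<sigma> powr (2 - p)"
    by (rule powr_mult)
  finally have "?n * \<sigma>\<^sup>2 \<le> 2 * (c powr (2 - p) * \<sigma> powr (2 - p) * (\<Sum>S\<in>Pow J. ?X S powr p))" .
  then have "\<sigma> powr (p - 2) * (?n * \<sigma>\<^sup>2) \<le> \<sigma> powr (p - 2) * (2 * (c powr (2 - p) * \<sigma> powr (2 - p)
      * (\<Sum>S\<in>Pow J. ?X S powr p)))"
    by (intro mult_left_mono) auto
  also have "\<sigma> powr (p - 2) * (?n * \<sigma>\<^sup>2) = ?n * \<sigma> powr p"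
  proof -
    have "\<sigma>\<^sup>2 = \<sigma> powr 2" using s by (simp add: powr_numeral)
    then have "\<sigma> powr (p - 2) * \<sigma>\<^sup>2 = \<sigma> powr p" by (simp only: powr_add[symmetric]) simp
    then show ?thesis by (simp add: mult.left_commute)
  qed
  also have "\<sigma> powr (p - 2) * (2 * (c powr (2 - p) * \<sigma> powr (2 - p) * (\<Sum>S\<in>Pow J. ?X S powr p)))
      = 2 * c powr (2 - p) * (\<Sum>S\<in>Pow J. ?X S powr p)"
  proof -
    have "\<sigma> powr (p - 2) * \<sigma> powr (2 - p) = \<sigma> powr (p - 2 + (2 - p))" by (rule powr_add[symmetric])
    also have "\<dots> = 1" using s by simp
    finally have "x * (2 * (y * z * T)) = 2 * y * T" if "x = \<sigma> powr (p - 2)" "z = \<sigma> powr (2 - p)" for x y z T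
      unfolding that by (simp add: mult.commute[of "\<sigma> powr (2 - p)"] mult.left_commute[of "\<sigma> powr
          (p - 2)"] mult.assoc)
    then show ?thesis by blast
  qed
  finally have "?n * \<sigma> powr p \<le> 2 * c powr (2 - p) * (\<Sum>S\<in>Pow J. ?X S powr p)" .
  then have "\<sigma> powr p \<le> 2 * c powr (2 - p) * (\<Sum>S\<in>Pow J. ?X S powr p) / ?n"
    by (subst pos_le_divide_eq) (auto simp: mult.commute)
  then show ?thesis unfolding \<sigma>_def[symmetric] Khinchine_const_def c_def[symmetric] by simp
qed

subsection \<open>The Littlewood-Paley square function\<close>

lemma Wk_inv_fourier_decay:
  fixes u :: "real \<Rightarrow> complex"
  assumes "Wk 2 u"
  shows "\<exists>C\<ge>0. \<forall>t. norm (inv_fourier u t) \<le> C / (1 + t\<^sup>2)"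
proof -
  obtain C where C: "\<And>x. norm (fourier u x) * (1 + x\<^sup>2) \<le> C"
    using Wk_fourier_decay[of "{1}" u] assms by auto
  have "norm (inv_fourier u t) \<le> \<bar>C\<bar> / (1 + t\<^sup>2)" for t
  proof -
    have pos: "1 + t\<^sup>2 > 0" by (simp add: add_pos_nonneg)
    have "norm (inv_fourier u t) = norm (fourier u (- t)) / (2 * pi)"
      by (simp add: inv_fourier_eq_fourier norm_divide norm_mult)
    also have "\<dots> \<le> norm (fourier u (- t))"
      using pi_gt3 by (simp add: divide_le_eq mult_ge1_I mult_le_cancel_left1)
    also have "\<dots> \<le> \<bar>C\<bar> / (1 + t\<^sup>2)"
      using C[of "- t"] pos by (subst pos_le_divide_eq) auto
    finally show ?thesis .
  qed
  then show ?thesis by (intro exI[of _ "\<bar>C\<bar>"]) auto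
qed

text \<open>Multiplying the symbol by \<open>\<i> * \<tau>\<close> differentiates its kernel.
  Integrating the derivative over \<open>{t1..t2}\<close> and exchanging integrals yields a mean
  value estimate.\<close>

lemma inv_fourier_increment:
  fixes u :: "real \<Rightarrow> complex"
  assumes u: "integrable lborel u" and ud: "integrable lborel (\<lambda>\<tau>. of_real \<tau> * u \<tau>)"
    and t: "t1 \<le> t2" and M: "\<And>s. s \<in> {t1..t2} \<Longrightarrow> norm (inv_fourier (\<lambda>\<tau>. of_real \<tau> * u \<tau>) s) \<le> M"
  shows "norm (inv_fourier u t2 - inv_fourier u t1) \<le> (t2 - t1) * M"
proof -
  have [measurable]: "u \<in> borel_measurable borel" using u by auto
  let ?v = "\<lambda>\<tau>. of_real \<tau> * u \<tau>" and ?I = "indicator {t1..t2} :: real \<Rightarrow> real"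
  have FTC: "(LINT s|lborel. ?I s *\<^sub>R (\<i> * of_real \<tau> * cis (s * \<tau>))) = cis (t2 * \<tau>) - cis (t1 * \<tau>)" for \<tau>
  proof (rule integral_FTC_Icc[OF t])
    show "((\<lambda>s. cis (s * \<tau>)) has_vector_derivative \<i> * of_real \<tau> * cis (s * \<tau>)) (at s within {t1..t2})" for s
      using has_vector_derivative_cis_affine[of 0 \<tau> s] by (simp add: has_vector_derivative_at_within)
    show "continuous_on {t1..t2} (\<lambda>s. \<i> * complex_of_real \<tau> * cis (s * \<tau>))"
      by (intro continuous_intros)
  qed
  have int: "integrable lborel (\<lambda>\<tau>. cis (t * \<tau>) * u \<tau>)" for t
    by (rule integrable_cis_mult[OF u]) measurable
  have iI: "integrable lborel (\<lambda>s. complex_of_real (?I s))"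
    by (intro integrable_of_real integrable_real_indicator) (use t in auto)
  have "inv_fourier u t2 - inv_fourier u t1 = 1 / (2 * pi) * (LINT \<tau>|lborel. (cis (t2 * \<tau>) - cis (t1 * \<tau>)) * u \<tau>)"
    using int by (simp add: inv_fourier_def left_diff_distrib right_diff_distrib)
  also have "(LINT \<tau>|lborel. (cis (t2 * \<tau>) - cis (t1 * \<tau>)) * u \<tau>)
     = (LINT \<tau>|lborel. LINT s|lborel. (?I s *\<^sub>R (\<i> * of_real \<tau> * cis (s * \<tau>))) * u \<tau>)"
    by (simp only: FTC[symmetric] integral_mult_left_zero)
  also have "\<dots> = (LINT s|lborel. LINT \<tau>|lborel. (?I s *\<^sub>R (\<i> * of_real \<tau> * cis (s * \<tau>))) * u \<tau>)"
    by (rule lborel_pair.Fubini_integral, rule integrable_pair_bound[OF iI ud])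
       (auto simp: norm_mult)
  also have "\<dots> = (LINT s|lborel. ?I s *\<^sub>R (\<i> * (LINT \<tau>|lborel. cis (s * \<tau>) * ?v \<tau>)))"
    by (simp add: mult_ac flip: integral_mult_right_zero integral_scaleR_right)
  also have "1 / (2 * pi) * \<dots> = (LINT s|lborel. ?I s *\<^sub>R (\<i> * inv_fourier ?v s))"
    by (simp add: inv_fourier_def mult.left_commute scaleR_conv_of_real flip: integral_mult_right_zero)
  finally have eq: "inv_fourier u t2 - inv_fourier u t1 = (LINT s|lborel. ?I s *\<^sub>R (\<i> * inv_fourier ?v s))" .
  have "ennreal (norm (inv_fourier u t2 - inv_fourier u t1))
      \<le> (\<integral>\<^sup>+s. ennreal (norm (?I s *\<^sub>R (\<i> * inv_fourier ?v s))) \<partial>lborel)"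
    unfolding eq by (rule norm_integral_le_nn_integral)
  also have "\<dots> \<le> (\<integral>\<^sup>+s. ennreal M * indicator {t1..t2} s \<partial>lborel)"
    using M by (intro nn_integral_mono) (auto simp: indicator_def norm_mult intro: ennreal_leI)
  also have "\<dots> = ennreal M * ennreal (t2 - t1)"
    using t by (subst nn_integral_cmult_indicator) auto
  also have "\<dots> = ennreal ((t2 - t1) * M)"
    using M[of t1] t order_trans[OF norm_ge_zero M[of t1]] by (simp add: ennreal_mult mult.commute)
  finally show ?thesis
    using t order_trans[OF norm_ge_zero M[of t1]] by (simp add: ennreal_le_iff)
qed

lemma nn_integral_inverse_square_tail:
  assumes "a > 0" "c \<ge> 0"
  shows "(\<integral>\<^sup>+x. ennreal (c / x\<^sup>2) * indicator {x. \<bar>x\<bar> \<ge> a} x \<partial>lborel) = ennreal (2 * c / a)"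
proof -
  have 1: "(\<integral>\<^sup>+x. ennreal (c / x\<^sup>2) * indicator {a..} x \<partial>lborel) = ennreal (0 - (- c / a))"
  proof (rule nn_integral_FTC_atLeast)
    show "((\<lambda>x. - c / x) has_real_derivative c / x\<^sup>2) (at x)" if "a \<le> x" for x
      using that assms by (auto intro!: derivative_eq_intros simp: power2_eq_square)
    show "((\<lambda>x. - c / x) \<longlongrightarrow> 0) at_top"
      by (intro tendsto_divide_0[OF tendsto_const] filterlim_at_top_imp_at_infinity filterlim_ident)
  qed (use assms in auto)
  have 2: "(\<integral>\<^sup>+x. ennreal (c / x\<^sup>2) * indicator {..-a} x \<partial>lborel)
      = (\<integral>\<^sup>+x. ennreal (c / x\<^sup>2) * indicator {a..} x \<partial>lborel)"
    by (subst nn_integral_real_affine[of _ "-1" 0]) (auto simp: indicator_def intro!: nn_integral_cong)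
  have "(\<integral>\<^sup>+x. ennreal (c / x\<^sup>2) * indicator {x. \<bar>x\<bar> \<ge> a} x \<partial>lborel) =
    (\<integral>\<^sup>+x. ennreal (c / x\<^sup>2) * indicator {a..} x + ennreal (c / x\<^sup>2) * indicator {..-a} x \<partial>lborel)"
    using assms by (intro nn_integral_cong) (auto simp: indicator_def)
  also have "\<dots> = ennreal (c / a) + ennreal (c / a)"
    by (subst nn_integral_add) (auto simp: 1 2)
  also have "\<dots> = ennreal (2 * c / a)"
    using assms by (simp add: ennreal_plus[symmetric] field_simps del: ennreal_plus)
  finally show ?thesis .
qed

definition quad_mass :: real where "quad_mass = (LINT x|lborel. inverse (1 + x\<^sup>2))"

lemma quad_mass: "quad_mass \<ge> 0" "(\<integral>\<^sup>+x. ennreal (inverse (1 + x\<^sup>2)) \<partial>lborel) = ennreal quad_mass"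
  unfolding quad_mass_def using integrable_inverse_1_plus_square
  by (auto intro!: Bochner_Integration.integral_nonneg nn_integral_eq_integral)

text \<open>Two estimates of the same integral: the increment bound gives a multiple of
  \<open>\<bar>w\<bar>\<close>, and the decay of each kernel value separately a multiple of
  \<open>1 / \<bar>w\<bar>\<close>. Only their minimum can be summed over all scales.\<close>

lemma kernel_difference_bound:
  fixes K :: "real \<Rightarrow> complex"
  assumes C: "C \<ge> 0" and dec: "\<And>t. norm (K t) \<le> C / (1 + t\<^sup>2)"
    and inc: "\<And>t1 t2 M. t1 \<le> t2 \<Longrightarrow> (\<And>s. s \<in> {t1..t2} \<Longrightarrow> C / (1 + s\<^sup>2) \<le> M) \<Longrightarrow> norm (K t2 - K t1) \<le> (t2 - t1) * M"
    and w: "w \<noteq> 0"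
  shows "(\<integral>\<^sup>+x. indicator {x. \<bar>x\<bar> > 2 * \<bar>w\<bar>} x * ennreal (norm (K (x - w) - K x)) \<partial>lborel)
    \<le> ennreal (C * (5 + 4 * quad_mass) * min \<bar>w\<bar> (1 / \<bar>w\<bar>))"
proof -
  \<comment> \<open>When \<open>\<bar>x\<bar>\<close> exceeds \<open>2 * \<bar>w\<bar>\<close>, the
    whole segment from \<open>x\<close> to \<open>x - w\<close> stays at distance at least
    \<open>\<bar>x\<bar> / 2\<close> from 0.\<close>
  have half: "x\<^sup>2 / 4 \<le> s\<^sup>2" if "\<bar>x\<bar> > 2 * \<bar>w\<bar>" "s \<in> closed_segment x (x - w)" for x s
  proof -
    have "\<bar>s - x\<bar> \<le> \<bar>w\<bar>" using that(2) by (auto simp: closed_segment_eq_real_ivl split: if_splits)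
    then have "\<bar>x / 2\<bar> \<le> \<bar>s\<bar>" using that(1) by linarith
    then have "(x / 2)\<^sup>2 \<le> s\<^sup>2" by (simp only: abs_le_square_iff)
    then show ?thesis by (simp add: power_divide)
  qed
  have le4: "C / (1 + s\<^sup>2) \<le> 4 * C * inverse (1 + x\<^sup>2)" if "x\<^sup>2 / 4 \<le> s\<^sup>2" for s x
  proof -
    have pos: "1 + x\<^sup>2 > 0" "1 + s\<^sup>2 > 0" by (simp_all add: add_pos_nonneg)
    have "C * (1 + x\<^sup>2) \<le> C * (4 * (1 + s\<^sup>2))" using that C by (intro mult_left_mono) auto
    then show ?thesis using pos by (simp add: field_simps)
  qed
  have A: "norm (K (x - w) - K x) \<le> \<bar>w\<bar> * (4 * C) * inverse (1 + x\<^sup>2)" if x: "\<bar>x\<bar> > 2 * \<bar>w\<bar>" for x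
  proof (cases "w \<ge> 0")
    case True
    have "norm (K x - K (x - w)) \<le> (x - (x - w)) * (4 * C * inverse (1 + x\<^sup>2))"
      using True by (intro inc le4 half[OF x]) (auto simp: closed_segment_eq_real_ivl)
    then show ?thesis using True by (simp add: norm_minus_commute mult.assoc)
  next
    case False
    have "norm (K (x - w) - K x) \<le> (x - w - x) * (4 * C * inverse (1 + x\<^sup>2))"
      using False by (intro inc le4 half[OF x]) (auto simp: closed_segment_eq_real_ivl)
    then show ?thesis using False by (simp add: mult.assoc)
  qed
  have B: "norm (K (x - w) - K x) \<le> 5 * C / x\<^sup>2" if x: "\<bar>x\<bar> > 2 * \<bar>w\<bar>" for x
  proof -
    have x2: "x\<^sup>2 > 0" using x by auto
    have i: "inverse (1 + x\<^sup>2) \<le> 1 / x\<^sup>2" using x2 unfolding inverse_eq_divide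
      by (intro divide_left_mono mult_pos_pos) (auto simp: add_pos_nonneg)
    have "norm (K (x - w)) \<le> 4 * C * inverse (1 + x\<^sup>2)"
      by (rule order_trans[OF dec le4[OF half[OF x]]]) (auto simp: closed_segment_eq_real_ivl)
    also have "\<dots> \<le> 4 * C * (1 / x\<^sup>2)" using C by (intro mult_left_mono i) auto
    finally have "norm (K (x - w)) \<le> 4 * C / x\<^sup>2" by simp
    moreover have "norm (K x) \<le> C / x\<^sup>2"
    proof -
      have "norm (K x) \<le> C * inverse (1 + x\<^sup>2)" using dec[of x] by (simp add: divide_inverse)
      also have "\<dots> \<le> C * (1 / x\<^sup>2)" using C by (intro mult_left_mono i) auto
      finally show ?thesis by simp
    qed
    ultimately have "norm (K (x - w)) + norm (K x) \<le> 4 * C / x\<^sup>2 + C / x\<^sup>2" by simp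
    also have "\<dots> = 5 * C / x\<^sup>2" by (simp add: add_divide_distrib[symmetric])
    finally have "norm (K (x - w)) + norm (K x) \<le> 5 * C / x\<^sup>2" .
    then show ?thesis using norm_triangle_ineq4[of "K (x - w)" "K x"] by linarith
  qed
  let ?L = "\<integral>\<^sup>+x. indicator {x. \<bar>x\<bar> > 2 * \<bar>w\<bar>} x * ennreal (norm (K (x - w) - K x)) \<partial>lborel"
  \<comment> \<open>The constant adds \<open>4 * quad_mass\<close> from the first estimate and 5
    from the second.\<close>
  let ?D = "C * (5 + 4 * quad_mass)"
  have "?L \<le> ennreal (?D * \<bar>w\<bar>)"
  proof -
    have "?L \<le> (\<integral>\<^sup>+x. ennreal (\<bar>w\<bar> * (4 * C)) * ennreal (inverse (1 + x\<^sup>2)) \<partial>lborel)"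
      using A C by (intro nn_integral_mono) (auto simp: indicator_def ennreal_mult[symmetric] intro!: ennreal_leI)
    also have "\<dots> = ennreal (\<bar>w\<bar> * (4 * C) * quad_mass)"
      using C quad_mass by (simp add: nn_integral_cmult ennreal_mult)
    also have "\<dots> \<le> ennreal (?D * \<bar>w\<bar>)"
      using C quad_mass(1) by (intro ennreal_leI) (simp add: algebra_simps)
    finally show ?thesis .
  qed
  moreover have "?L \<le> ennreal (?D * (1 / \<bar>w\<bar>))"
  proof -
    have "?L \<le> (\<integral>\<^sup>+x. ennreal (5 * C / x\<^sup>2) * indicator {x. \<bar>x\<bar> \<ge> 2 * \<bar>w\<bar>} x \<partial>lborel)"
      using B C by (intro nn_integral_mono) (auto simp: indicator_def intro!: ennreal_leI)
    also have "\<dots> = ennreal (2 * (5 * C) / (2 * \<bar>w\<bar>))"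
      by (rule nn_integral_inverse_square_tail) (use w C in auto)
    also have "\<dots> \<le> ennreal (?D * (1 / \<bar>w\<bar>))"
      using C quad_mass(1) w by (intro ennreal_leI) (simp add: divide_right_mono algebra_simps)
    finally show ?thesis .
  qed
  ultimately show ?thesis by (auto simp: min_def)
qed

lemma sum_half_powers:
  fixes I :: "int set"
  assumes "finite I"
  shows "(\<Sum>j\<in>I. (1 / 2 :: real) ^ nat \<bar>j - n\<bar>) \<le> 4"
proof -
  have geo: "(\<Sum>j\<in>N. (1 / 2 :: real) ^ j) \<le> 2" if "finite N" for N :: "nat set"
  proof -
    have "(\<Sum>j\<in>N. (1 / 2 :: real) ^ j) \<le> (\<Sum>j. (1 / 2) ^ j)"
      by (rule sum_le_suminf) (use that in \<open>auto intro: summable_geometric\<close>)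
    also have "\<dots> = 2" by (simp add: suminf_geometric)
    finally show ?thesis .
  qed
  have part: "(\<Sum>j\<in>{j\<in>I. P j}. (1 / 2 :: real) ^ nat \<bar>j - n\<bar>) \<le> 2"
    if "inj_on (\<lambda>j. nat \<bar>j - n\<bar>) {j\<in>I. P j}" for P
  proof -
    have "(\<Sum>j\<in>{j\<in>I. P j}. (1 / 2 :: real) ^ nat \<bar>j - n\<bar>) = (\<Sum>i\<in>(\<lambda>j. nat \<bar>j - n\<bar>) ` {j\<in>I. P j}. (1 / 2) ^ i)"
      by (subst sum.reindex[OF that]) simp
    then show ?thesis using geo assms by simp
  qed
  have "(\<Sum>j\<in>I. (1 / 2 :: real) ^ nat \<bar>j - n\<bar>) =
    (\<Sum>j\<in>{j\<in>I. j \<ge> n}. (1 / 2) ^ nat \<bar>j - n\<bar>) + (\<Sum>j\<in>{j\<in>I. \<not> j \<ge> n}. (1 / 2) ^ nat \<bar>j - n\<bar>)"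
    using assms by (subst sum.union_disjoint[symmetric]) (auto intro!: sum.cong)
  also have "\<dots> \<le> 2 + 2"
    by (intro add_mono part) (auto simp: inj_on_def)
  finally show ?thesis by simp
qed

text \<open>The terms decay geometrically away from the scale \<open>n\<close> at which the dilate
  of \<open>y\<close> is about 1, and \<open>m \<ge> 1\<close> makes the ratio at least 2. Rounding
  that scale to an integer costs a factor 2, on top of the bound 4 of
  \<open>sum_half_powers\<close>.\<close>

lemma sum_min_dilates:
  fixes J :: "int set" and m y :: real
  assumes J: "finite J" and m: "m \<ge> 1" and y: "y > 0"
  shows "(\<Sum>j\<in>J. min (2 powr (m * of_int j) * y) (1 / (2 powr (m * of_int j) * y))) \<le> 8"
proof -
  define \<theta> where "\<theta> = log 2 y / m"
  have y_eq: "y = 2 powr (m * \<theta>)" using m y by (simp add: \<theta>_def)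
  define n where "n = \<lfloor>- \<theta>\<rfloor>"
  have "min (2 powr (m * of_int j) * y) (1 / (2 powr (m * of_int j) * y)) \<le> 2 * (1 / 2) ^ nat \<bar>j - n\<bar>" for j
  proof -
    let ?a = "m * (of_int j + \<theta>)"
    have e: "2 powr (m * of_int j) * y = 2 powr ?a" unfolding y_eq
        by (simp add: powr_add[symmetric] algebra_simps)
    have "min (2 powr ?a) (1 / 2 powr ?a) \<le> 2 powr (- \<bar>?a\<bar>)"
      by (cases "?a \<ge> 0") (auto simp: min_def powr_minus_divide)
    also have "\<dots> \<le> 2 powr (1 - \<bar>of_int (j - n)\<bar>)"
    proof (rule powr_mono)
      have "\<bar>of_int (j - n)\<bar> - 1 \<le> \<bar>of_int j + \<theta>\<bar>" unfolding n_def by linarith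
      also have "\<dots> \<le> m * \<bar>of_int j + \<theta>\<bar>" using m mult_right_mono[of 1 m "\<bar>of_int j + \<theta>\<bar>"] by simp
      also have "\<dots> = \<bar>?a\<bar>" using m by (simp add: abs_mult)
      finally show "- \<bar>?a\<bar> \<le> 1 - \<bar>of_int (j - n)\<bar>" by simp
    qed simp
    also have "\<dots> = 2 * 2 powr (- real (nat \<bar>j - n\<bar>))" by (simp add: powr_diff powr_minus_divide)
    also have "\<dots> = 2 * (1 / 2) ^ nat \<bar>j - n\<bar>"
        by (simp only: powr_minus powr_realpow[of 2, simplified] power_one_over inverse_eq_divide)
    finally show ?thesis unfolding e .
  qed
  then have "(\<Sum>j\<in>J. min (2 powr (m * of_int j) * y) (1 / (2 powr (m * of_int j) * y)))
      \<le> (\<Sum>j\<in>J. 2 * (1 / 2) ^ nat \<bar>j - n\<bar>)"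
    by (rule sum_mono)
  also have "\<dots> \<le> 8" unfolding sum_distrib_left[symmetric] using sum_half_powers[OF J, of n] by simp
  finally show ?thesis .
qed

lemma LP_cutoff_sum_eq_1:
  assumes phi: "LP_cutoff \<phi>" and y: "y > 0" and J: "finite J"
    and sup: "\<And>k. \<phi> (2 powr (- of_int k) * y) \<noteq> 0 \<Longrightarrow> k \<in> J"
  shows "(\<Sum>k\<in>J. \<phi> (2 powr (- of_int k) * y)) = 1"
proof -
  let ?f = "\<lambda>k::int. \<phi> (2 powr (- of_int k) * y)"
  have "(?f has_sum 1) UNIV" using phi y unfolding LP_cutoff_def by auto
  moreover have "(?f has_sum (\<Sum>k\<in>J. ?f k)) UNIV"
    by (rule has_sum_finite_neutralI[OF J]) (use sup in auto)
  ultimately show ?thesis by (metis has_sum_unique)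
qed

text \<open>The inequality is strict because \<phi> vanishes at 1/2 and 2. Two indices active at the
  same point therefore differ by less than 2.\<close>

lemma LP_cutoff_log_support:
  assumes phi: "LP_cutoff \<phi>" and y: "y > 0" and nz: "\<phi> (2 powr (- of_int k) * y) \<noteq> 0"
  shows "\<bar>of_int k - log 2 y\<bar> < 1"
proof -
  let ?y = "2 powr (- of_int k) * y"
  have b: "1/2 < ?y" "?y < 2"
    using nz LP_cutoff_iter_deriv_zero[OF phi, of ?y 0] unfolding not_le[symmetric] by auto
  have "log 2 ?y = - of_int k + log 2 y" using y by (simp add: log_mult)
  moreover have "log 2 (1/2) < log 2 ?y" "log 2 ?y < log 2 2" using b y by (auto simp: log_less_cancel_iff)
  ultimately show ?thesis by (simp add: log_divide abs_less_iff)
qed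

section \<open>The dyadic decomposition of time frequencies\<close>

locale LP_decomposition =
  fixes \<phi> :: "real \<Rightarrow> real" and m :: real
  assumes phi: "LP_cutoff \<phi>" and m: "m \<ge> 1"
begin

definition symb :: "int \<Rightarrow> real \<Rightarrow> complex" where
  "symb j \<tau> = of_real (\<phi> (2 powr (- of_int j) * \<bar>\<tau>\<bar> powr (1 / m)))"

text \<open>\<open>fat j\<close> is 1 on the support of \<open>symb j\<close>, so that convolution with \<open>ker j\<close> reproduces
  every function whose frequencies lie in that support.\<close>

definition fat :: "int \<Rightarrow> real \<Rightarrow> complex" where
  "fat j \<tau> = symb (j - 1) \<tau> + symb j \<tau> + symb (j + 1) \<tau>"

definition ker :: "int \<Rightarrow> real \<Rightarrow> complex" where
  "ker j = inv_fourier (fat j)"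

lemma symb_support:
  assumes "symb j \<tau> \<noteq> 0"
  shows "\<tau> \<noteq> 0" "\<bar>of_int j - log 2 \<bar>\<tau>\<bar> / m\<bar> < 1"
proof -
  let ?y = "\<bar>\<tau>\<bar> powr (1 / m)"
  have nz: "\<phi> (2 powr (- of_int j) * ?y) \<noteq> 0" using assms by (simp add: symb_def)
  then show t: "\<tau> \<noteq> 0" using LP_cutoff_iter_deriv_zero[OF phi, of 0 0] by auto
  have "log 2 ?y = log 2 \<bar>\<tau>\<bar> / m" using t by (simp add: log_powr)
  then show "\<bar>of_int j - log 2 \<bar>\<tau>\<bar> / m\<bar> < 1"
    using LP_cutoff_log_support[OF phi _ nz] t by simp
qed

lemma sum_symb_eq_1:
  assumes t: "\<tau> \<noteq> 0" and J: "finite J" and sup: "\<And>j. symb j \<tau> \<noteq> 0 \<Longrightarrow> j \<in> J"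
  shows "(\<Sum>j\<in>J. symb j \<tau>) = 1"
proof -
  have "(\<Sum>j\<in>J. \<phi> (2 powr (- of_int j) * \<bar>\<tau>\<bar> powr (1 / m))) = 1"
    using t sup by (intro LP_cutoff_sum_eq_1[OF phi _ J]) (auto simp: symb_def)
  then show ?thesis by (simp add: symb_def flip: of_real_sum)
qed

lemma fat_symb: "fat j \<tau> * symb j \<tau> = symb j \<tau>"
proof (cases "symb j \<tau> = 0")
  case False
  have "(\<Sum>i\<in>{j - 1, j, j + 1}. symb i \<tau>) = 1"
  proof (rule sum_symb_eq_1)
    fix i assume "symb i \<tau> \<noteq> 0"
    then have "\<bar>of_int j - of_int i\<bar> < (2::real)"
      using symb_support(2)[OF False] symb_support(2)[of i \<tau>] by linarith
    then have "\<bar>j - i\<bar> < 2" by linarith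
    then show "i \<in> {j - 1, j, j + 1}" by auto
  qed (use symb_support(1)[OF False] in auto)
  then have "fat j \<tau> = 1" by (simp add: fat_def add.assoc)
  then show ?thesis by simp
qed simp

definition phi_bound :: real where "phi_bound = (SOME B. \<forall>y. \<bar>\<phi> y\<bar> \<le> B)"

lemma phi_bound: "\<bar>\<phi> y\<bar> \<le> phi_bound" and phi_bound_nonneg: "phi_bound \<ge> 0"
proof -
  have "continuous_on UNIV \<phi>" using continuous_on_iter_deriv[of \<phi> 0] phi by (simp add: LP_cutoff_def)
  then have "compact (\<phi> ` {1/2..2})"
    by (rule compact_continuous_image[OF continuous_on_subset]) auto
  then have "bounded (\<phi> ` {1/2..2})" by (rule compact_imp_bounded)
  then obtain B where B: "\<And>y. y \<in> {1/2..2} \<Longrightarrow> \<bar>\<phi> y\<bar> \<le> B"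
    unfolding bounded_iff by (metis imageI real_norm_def)
  have z: "\<phi> y = 0" if "y \<notin> {1/2..2}" for y using phi that unfolding LP_cutoff_def by blast
  have "\<forall>y. \<bar>\<phi> y\<bar> \<le> max 0 B"
  proof
    fix y
    show "\<bar>\<phi> y\<bar> \<le> max 0 B"
      using B[of y] z[of y] by (cases "y \<in> {1/2..2}") (auto simp del: atLeastAtMost_iff)
  qed
  then have *: "\<forall>y. \<bar>\<phi> y\<bar> \<le> phi_bound" unfolding phi_bound_def by (rule someI)
  then show "\<bar>\<phi> y\<bar> \<le> phi_bound" by blast
  show "phi_bound \<ge> 0" using * abs_ge_zero order_trans by blast
qed

lemma norm_symb_le: "norm (symb j \<tau>) \<le> phi_bound"
  by (simp add: symb_def phi_bound)

text \<open>The contributing indices lie in \<open>{n - 1..n + 1}\<close>. The bound is uniform in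
  \<open>J\<close>, as the L^2 estimate with arbitrary signs demands.\<close>

lemma sum_norm_symb_le:
  assumes "finite J"
  shows "(\<Sum>j\<in>J. norm (symb j \<tau>)) \<le> 3 * phi_bound"
proof -
  define n where "n = \<lfloor>log 2 \<bar>\<tau>\<bar> / m\<rfloor>"
  have sub: "{j\<in>J. symb j \<tau> \<noteq> 0} \<subseteq> {n..n + 2} \<union> {n - 1..n + 1}"
  proof
    fix j assume "j \<in> {j\<in>J. symb j \<tau> \<noteq> 0}"
    then have "\<bar>of_int j - log 2 \<bar>\<tau>\<bar> / m\<bar> < 1" using symb_support(2) by auto
    then have "n - 1 \<le> j" "j \<le> n + 1" unfolding n_def by linarith+
    then show "j \<in> {n..n + 2} \<union> {n - 1..n + 1}" by auto
  qed
  have sub: "{j\<in>J. symb j \<tau> \<noteq> 0} \<subseteq> {n - 1..n + 1}"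
  proof
    fix j assume "j \<in> {j\<in>J. symb j \<tau> \<noteq> 0}"
    then have "\<bar>of_int j - log 2 \<bar>\<tau>\<bar> / m\<bar> < 1" using symb_support(2) by auto
    then have "n - 1 \<le> j" "j \<le> n + 1" unfolding n_def by linarith+
    then show "j \<in> {n - 1..n + 1}" by auto
  qed
  have "(\<Sum>j\<in>J. norm (symb j \<tau>)) = (\<Sum>j\<in>{j\<in>J. symb j \<tau> \<noteq> 0}. norm (symb j \<tau>))"
    using assms by (intro sum.mono_neutral_right) auto
  also have "\<dots> \<le> (\<Sum>j\<in>{n - 1..n + 1}. norm (symb j \<tau>))"
    using sub by (intro sum_mono2) auto
  also have "\<dots> \<le> of_nat (card {n - 1..n + 1}) * phi_bound"
    by (rule sum_bounded_above) (rule norm_symb_le)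
  finally show ?thesis by simp
qed

lemma sum_norm_fat_le:
  assumes "finite J"
  shows "(\<Sum>j\<in>J. norm (fat j \<tau>)) \<le> 9 * phi_bound"
proof -
  have shift: "(\<Sum>j\<in>J. norm (symb (j + c) \<tau>)) \<le> 3 * phi_bound" for c
    using sum_norm_symb_le[of "(\<lambda>j. j + c) ` J" \<tau>] assms by (simp add: sum.reindex inj_on_def)
  have "(\<Sum>j\<in>J. norm (fat j \<tau>)) \<le> (\<Sum>j\<in>J. norm (symb (j + (- 1)) \<tau>) + norm (symb (j + 0) \<tau>) + norm (symb (j
      + 1) \<tau>))"
    unfolding fat_def by (intro sum_mono) (auto intro!: order_trans[OF norm_triangle_ineq] add_right_mono
        norm_triangle_ineq)
  also have "\<dots> \<le> 3 * phi_bound + 3 * phi_bound + 3 * phi_bound"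
    unfolding sum.distrib by (intro add_mono shift)
  finally show ?thesis by simp
qed

lemma cutoff_sym_symb: "cutoff_sym \<phi> (2 powr (- of_int j)) (1 / m) (symb j)"
  using cutoff_sym_time[OF phi, of "2 powr (- of_int j)" m] by (simp add: symb_def[abs_def])

lemma pos: "2 powr (- real_of_int j) > 0" "1 / m > 0" using m by simp_all

lemma fat_Wk: "Wk k (fat j)"
  unfolding fat_def[abs_def] by (intro Wk_add cutoff_sym_Wk[OF phi pos cutoff_sym_symb])

text \<open>A coordinate times a cut-off symbol is again a cut-off symbol, so the derivative of the
  kernel decays as fast as the kernel.\<close>

lemma fat_moment_Wk: "Wk k (\<lambda>\<tau>. of_real \<tau> * fat j \<tau>)"
proof -
  have "Wk k (\<lambda>\<tau>. of_real (\<tau> \<bullet> 1) * symb i \<tau>)" for i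
    by (rule cutoff_sym_Wk[OF phi pos cutoff_sym.coord[OF cutoff_sym_symb]])
  then have "Wk k (\<lambda>\<tau>. of_real \<tau> * symb (j - 1) \<tau> + of_real \<tau> * symb j \<tau> + of_real \<tau> * symb (j + 1) \<tau>)"
    by (intro Wk_add) auto
  then show ?thesis by (simp add: fat_def distrib_left)
qed

lemma fat_props: "integrable lborel (fat j)" "continuous_on UNIV (fat j)" "bounded (range (fat j))"
  "integrable lborel (fourier (fat j))"
proof -
  show "integrable lborel (fat j)" "continuous_on UNIV (fat j)"
    using Wk_base[OF fat_Wk] by auto
  have "norm (fat j \<tau>) \<le> 9 * phi_bound" for \<tau>
    using sum_norm_fat_le[of "{j}" \<tau>] by simp
  then show "bounded (range (fat j))" by (auto simp: bounded_iff)
  show "integrable lborel (fourier (fat j))"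
    by (rule Wk_fourier_integrable) (rule fat_Wk)
qed

lemma ker_integrable: "integrable lborel (ker j)"
  unfolding ker_def by (rule integrable_inv_fourier[OF fat_props])

lemma fourier_ker: "fourier (ker j) \<tau> = fat j \<tau>"
  unfolding ker_def by (rule fourier_inv_fourier[OF fat_props])

lemma ker_continuous: "continuous_on UNIV (ker j)"
  unfolding ker_def inv_fourier_eq_fourier[abs_def]
  by (intro continuous_intros continuous_on_compose2[OF continuous_fourier[OF fat_props(1)]]) auto

lemma ker_bounded: "bounded (range (ker j))"
proof -
  have "norm (ker j x) \<le> norm (1 / (2 * pi)) * (LINT x|lborel. norm (fat j x))" for x
    unfolding ker_def inv_fourier_eq_fourier norm_mult
    using norm_fourier_le[OF fat_props(1), of j "- x"] by (simp add: norm_divide norm_mult divide_right_mono)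
  then show ?thesis by (auto simp: bounded_iff)
qed

lemma symb_minus: "symb j (- \<tau>) = symb j \<tau>"
  by (simp add: symb_def)

lemma ker_even: "ker j (- x) = ker j x"
proof -
  have "fat j (- \<tau>) = fat j \<tau>" for \<tau> by (simp add: fat_def symb_minus)
  then have "(LINT \<tau>|lborel. cis (- x * \<tau>) * fat j \<tau>) = (LINT \<tau>|lborel. cis (x * \<tau>) * fat j \<tau>)"
    using LINT_reflect[of "\<lambda>\<tau>. cis (x * \<tau>) * fat j \<tau>" 0] by simp
  then show ?thesis by (simp add: ker_def inv_fourier_def)
qed

lemma symb_scale: "symb (j + i) \<tau> = symb i (\<tau> / 2 powr (m * of_int j))"
proof -
  have "\<bar>\<tau> / 2 powr (m * of_int j)\<bar> powr (1 / m) = \<bar>\<tau>\<bar> powr (1 / m) / 2 powr (of_int j)"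
    using m by (simp add: powr_divide powr_powr)
  then have "2 powr (- of_int i) * \<bar>\<tau> / 2 powr (m * of_int j)\<bar> powr (1 / m)
      = 2 powr (- of_int (j + i)) * \<bar>\<tau>\<bar> powr (1 / m)"
  proof -
    have "2 powr (- real_of_int (j + i)) = 2 powr (- real_of_int i) / 2 powr (real_of_int j)"
    proof -
      have "- real_of_int (j + i) = - real_of_int i - real_of_int j" by simp
      then show ?thesis by (simp only: powr_diff)
    qed
    then show ?thesis unfolding \<open>\<bar>\<tau> / _\<bar> powr _ = _\<close> by simp
  qed
  then show ?thesis by (simp only: symb_def)
qed

text \<open>One step in the index dilates time frequencies by \<open>2 powr m\<close>. All kernels
  are dilates of \<open>ker 0\<close> with the same L^1 norm, so the decay of \<open>ker 0\<close>
  and its derivative serves every \<open>j\<close>.\<close>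

lemma ker_scale: "ker j x = of_real (2 powr (m * of_int j)) * ker 0 (2 powr (m * of_int j) * x)"
proof -
  let ?l = "2 powr (m * of_int j)"
  have l: "?l > 0" by simp
  have fat_scale: "fat j (?l * \<tau>) = fat 0 \<tau>" for \<tau>
    using symb_scale[of j "-1" "?l * \<tau>"] symb_scale[of j 0 "?l * \<tau>"] symb_scale[of j 1 "?l * \<tau>"]
        by (simp add: fat_def)
  have "(LINT \<tau>|lborel. cis (x * \<tau>) * fat j \<tau>) = ?l *\<^sub>R (LINT \<tau>|lborel. cis (?l * x * \<tau>) * fat 0 \<tau>)"
  proof -
    have "cis (x * (?l * \<tau>)) = cis (?l * x * \<tau>)" for \<tau> by (simp only: mult_ac)
    then show ?thesis
      using LINT_translate[of ?l "\<lambda>\<tau>. cis (x * \<tau>) * fat j \<tau>" 0] by (simp add: fat_scale)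
  qed
  then show ?thesis by (simp add: ker_def inv_fourier_def scaleR_conv_of_real)
qed

definition dec_const :: real where
  "dec_const = (SOME C. C \<ge> 0 \<and> (\<forall>t. norm (ker 0 t) \<le> C / (1 + t\<^sup>2)) \<and>
     (\<forall>t. norm (inv_fourier (\<lambda>\<tau>. of_real \<tau> * fat 0 \<tau>) t) \<le> C / (1 + t\<^sup>2)))"

lemma dec_const:
  "dec_const \<ge> 0" "norm (ker 0 t) \<le> dec_const / (1 + t\<^sup>2)"
  "norm (inv_fourier (\<lambda>\<tau>. of_real \<tau> * fat 0 \<tau>) t) \<le> dec_const / (1 + t\<^sup>2)"
proof -
  obtain C1 where C1: "C1 \<ge> 0" "\<And>t. norm (ker 0 t) \<le> C1 / (1 + t\<^sup>2)"
    using Wk_inv_fourier_decay[OF fat_Wk] unfolding ker_def by blast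
  obtain C2 where C2: "C2 \<ge> 0" "\<And>t. norm (inv_fourier (\<lambda>\<tau>. of_real \<tau> * fat 0 \<tau>) t) \<le> C2 / (1 + t\<^sup>2)"
    using Wk_inv_fourier_decay[OF fat_moment_Wk] by blast
  have p: "1 + t\<^sup>2 > 0" for t :: real by (simp add: add_pos_nonneg)
  have "C1 + C2 \<ge> 0 \<and> (\<forall>t. norm (ker 0 t) \<le> (C1 + C2) / (1 + t\<^sup>2)) \<and>
     (\<forall>t. norm (inv_fourier (\<lambda>\<tau>. of_real \<tau> * fat 0 \<tau>) t) \<le> (C1 + C2) / (1 + t\<^sup>2))"
    using C1(1) C2(1) p by (auto intro!: order_trans[OF C1(2)] order_trans[OF C2(2)] divide_right_mono simp:
        less_imp_le)
  from someI[of "\<lambda>C. C \<ge> 0 \<and> (\<forall>t. norm (ker 0 t) \<le> C / (1 + t\<^sup>2)) \<and>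
     (\<forall>t. norm (inv_fourier (\<lambda>\<tau>. of_real \<tau> * fat 0 \<tau>) t) \<le> C / (1 + t\<^sup>2))", OF this]
  show "dec_const \<ge> 0" "norm (ker 0 t) \<le> dec_const / (1 + t\<^sup>2)"
    "norm (inv_fourier (\<lambda>\<tau>. of_real \<tau> * fat 0 \<tau>) t) \<le> dec_const / (1 + t\<^sup>2)"
    unfolding dec_const_def by blast+
qed

definition "diff_const = dec_const * (5 + 4 * quad_mass)"

lemma diff_const_nonneg: "diff_const \<ge> 0"
  using dec_const(1) quad_mass(1) by (simp add: diff_const_def)

lemma ker_measurable [measurable]: "ker j \<in> borel_measurable borel"
  using ker_integrable by auto

text \<open>Rescaling by \<open>l\<close> replaces \<open>ker j\<close> by \<open>ker 0\<close> and
  the increment \<open>y\<close> by \<open>l * y\<close>; the factor from the change of variable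
  cancels the one in \<open>ker_scale\<close>.\<close>

lemma ker_Hormander:
  fixes j :: int
  assumes y: "y \<noteq> 0"
  defines "l \<equiv> 2 powr (m * of_int j)"
  shows "(\<integral>\<^sup>+x. indicator {x. \<bar>x\<bar> > 2 * \<bar>y\<bar>} x * ennreal (norm (ker j (x - y) - ker j x)) \<partial>lborel)
    \<le> ennreal (diff_const * min (l * \<bar>y\<bar>) (1 / (l * \<bar>y\<bar>)))"
proof -
  have l: "l > 0" by (simp add: l_def)
  have ks: "ker j x = of_real l * ker 0 (l * x)" for x unfolding l_def by (rule ker_scale)
  have "(\<integral>\<^sup>+x. indicator {x. \<bar>x\<bar> > 2 * \<bar>y\<bar>} x * ennreal (norm (ker j (x - y) - ker j x)) \<partial>lborel)
     = ennreal (1 / l) * (\<integral>\<^sup>+x. indicator {x. \<bar>x\<bar> > 2 * \<bar>y\<bar>} (x / l)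
         * ennreal (norm (ker j (x / l - y) - ker j (x / l))) \<partial>lborel)"
    using l by (subst nn_integral_real_affine[of _ "1 / l" 0]) auto
  also have "\<dots> = (\<integral>\<^sup>+x. ennreal (1 / l) * (indicator {x. \<bar>x\<bar> > 2 * \<bar>y\<bar>} (x / l)
      * ennreal (norm (ker j (x / l - y) - ker j (x / l)))) \<partial>lborel)"
    by (rule nn_integral_cmult[symmetric]) measurable
  also have "\<dots> = (\<integral>\<^sup>+x. indicator {x. \<bar>x\<bar> > 2 * \<bar>l * y\<bar>} x * ennreal (norm (ker 0 (x - l * y) - ker 0 x)) \<partial>lborel)"
  proof (rule nn_integral_cong)
    fix x
    have i: "indicator {x. \<bar>x\<bar> > 2 * \<bar>y\<bar>} (x / l) = (indicator {x. \<bar>x\<bar> > 2 * \<bar>l * y\<bar>} x :: ennreal)"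
      using l by (auto simp: indicator_def abs_mult field_simps)
    have "ker j (x / l - y) - ker j (x / l) = of_real l * (ker 0 (x - l * y) - ker 0 x)"
      unfolding ks using l by (simp add: right_diff_distrib)
    then have "norm (ker j (x / l - y) - ker j (x / l)) = l * norm (ker 0 (x - l * y) - ker 0 x)"
      using l by (simp add: norm_mult)
    then have "ennreal (1 / l) * ennreal (norm (ker j (x / l - y) - ker j (x / l)))
        = ennreal (norm (ker 0 (x - l * y) - ker 0 x))"
      using l by (simp add: ennreal_mult[symmetric])
    then show "ennreal (1 / l) * (indicator {x. \<bar>x\<bar> > 2 * \<bar>y\<bar>} (x / l)
        * ennreal (norm (ker j (x / l - y) - ker j (x / l))))
      = indicator {x. \<bar>x\<bar> > 2 * \<bar>l * y\<bar>} x * ennreal (norm (ker 0 (x - l * y) - ker 0 x))"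
      unfolding i by (metis mult.left_commute)
  qed
  also have "\<dots> \<le> ennreal (dec_const * (5 + 4 * quad_mass) * min \<bar>l * y\<bar> (1 / \<bar>l * y\<bar>))"
  proof (rule kernel_difference_bound)
    fix t1 t2 M :: real assume t: "t1 \<le> t2" and M: "\<And>s. s \<in> {t1..t2} \<Longrightarrow> dec_const / (1 + s\<^sup>2) \<le> M"
    show "norm (ker 0 t2 - ker 0 t1) \<le> (t2 - t1) * M"
      unfolding ker_def
    proof (rule inv_fourier_increment[OF fat_props(1) _ t])
      show "integrable lborel (\<lambda>\<tau>. complex_of_real \<tau> * fat 0 \<tau>)" using Wk_base[OF fat_moment_Wk] by blast
      show "norm (inv_fourier (\<lambda>\<tau>. complex_of_real \<tau> * fat 0 \<tau>) s) \<le> M" if "s \<in> {t1..t2}" for s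
        using dec_const(3)[of s] M[OF that] by linarith
    qed
  qed (use dec_const y l in auto)
  also have "\<bar>l * y\<bar> = l * \<bar>y\<bar>" using l by (simp add: abs_mult)
  finally show ?thesis by (simp add: diff_const_def)
qed

section \<open>Signed kernels and the two square function estimates\<close>

definition sgn_ker :: "int set \<Rightarrow> int set \<Rightarrow> real \<Rightarrow> complex" where
  "sgn_ker J S x = sgn_sum J S (\<lambda>j. ker j x)"

text \<open>The square of the bound in \<open>sum_norm_fat_le\<close>, valid for every choice of
  signs. The 8 in \<open>Hor_const\<close> is that of \<open>sum_min_dilates\<close>.\<close>

definition "L2_const = (9 * phi_bound)\<^sup>2"
definition "Hor_const = diff_const * 8"

lemma conv_sgn_ker:
  assumes "h \<in> borel_measurable borel" "bounded (range h)"
  shows "conv (sgn_ker J S) h x = sgn_sum J S (\<lambda>j. conv (ker j) h x)"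
proof -
  have "conv (sgn_ker J S) h x = (LINT y|lborel. (\<Sum>j\<in>J. (if j \<in> S then 1 else - 1) * (ker j (x - y) * h y)))"
    unfolding conv_def sgn_ker_def sgn_sum_def sum_distrib_right by (simp only: mult.assoc)
  also have "\<dots> = (\<Sum>j\<in>J. LINT y|lborel. (if j \<in> S then 1 else - 1) * (ker j (x - y) * h y))"
    by (intro Bochner_Integration.integral_sum integrable_mult_right conv_integrable ker_integrable assms)
  also have "\<dots> = (\<Sum>j\<in>J. (if j \<in> S then 1 else - 1) * (LINT y|lborel. ker j (x - y) * h y))"
    by (simp only: integral_mult_right_zero)
  finally show ?thesis by (simp add: sgn_sum_def conv_def)
qed

text \<open>Convolution is multiplication by the bounded symbol \<open>a\<close> on the Fourier
  side. Bessel's inequality is used on the way there and on the way back; its two factors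
  \<open>2 * pi\<close> cancel the normalisation of \<open>inv_fourier\<close>.\<close>

lemma sgn_ker_L2:
  assumes J: "finite J" and h: "integrable lborel h" "bounded (range h)"
  shows "(\<integral>\<^sup>+x. ennreal ((norm (conv (sgn_ker J S) h x))\<^sup>2) \<partial>lborel)
      \<le> ennreal L2_const * (\<integral>\<^sup>+x. ennreal ((norm (h x))\<^sup>2) \<partial>lborel)"
proof -
  define a where "a \<tau> = sgn_sum J S (\<lambda>j. fat j \<tau>)" for \<tau>
  have [measurable]: "h \<in> borel_measurable borel" using h by auto
  have ai: "integrable lborel a"
    unfolding a_def sgn_sum_def by (intro Bochner_Integration.integrable_sum integrable_mult_right fat_props)
  then have [measurable]: "a \<in> borel_measurable borel" by auto
  have [measurable]: "fourier h \<in> borel_measurable borel"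
    using continuous_fourier[OF h(1)] by (rule borel_measurable_continuous_onI)
  have a_le: "norm (a \<tau>) \<le> 9 * phi_bound" for \<tau>
  proof -
    have "norm (a \<tau>) \<le> (\<Sum>j\<in>J. norm (fat j \<tau>))"
      unfolding a_def sgn_sum_def by (rule order_trans[OF norm_sum]) (auto intro!: sum_mono simp: norm_mult)
    then show ?thesis using sum_norm_fat_le[OF J, of \<tau>] by linarith
  qed
  have "inv_fourier a x = sgn_ker J S x" for x
  proof -
    have "(LINT \<tau>|lborel. cis (x * \<tau>) * a \<tau>) = (LINT \<tau>|lborel. (\<Sum>j\<in>J. (if j \<in> S then 1 else - 1) * (cis (x * \<tau>)
        * fat j \<tau>)))"
      unfolding a_def sgn_sum_def sum_distrib_left by (simp only: mult.left_commute)
    also have "\<dots> = (\<Sum>j\<in>J. LINT \<tau>|lborel. (if j \<in> S then 1 else - 1) * (cis (x * \<tau>) * fat j \<tau>))"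
      by (intro Bochner_Integration.integral_sum integrable_mult_right integrable_cis_mult fat_props) measurable
    also have "\<dots> = (\<Sum>j\<in>J. (if j \<in> S then 1 else - 1) * (LINT \<tau>|lborel. cis (x * \<tau>) * fat j \<tau>))"
      by (simp only: integral_mult_right_zero)
    finally show ?thesis
      by (simp add: inv_fourier_def sgn_ker_def sgn_sum_def ker_def sum_divide_distrib)
  qed
  then have ker_eq: "inv_fourier a = sgn_ker J S" by auto
  obtain H where H: "\<And>x. norm (fourier h x) \<le> H" using norm_fourier_le[OF h(1)] by auto
  let ?v = "\<lambda>\<tau>. a \<tau> * fourier h \<tau>"
  have vi: "integrable lborel ?v"
  proof (rule Bochner_Integration.integrable_bound[OF integrable_mult_right[OF integrable_norm[OF ai], of H]])
    show "AE x in lborel. norm (a x * fourier h x) \<le> norm (H * norm (a x))"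
    proof (rule AE_I2)
      fix x
      have "norm (fourier h x) * norm (a x) \<le> H * norm (a x)" by (intro mult_right_mono H) auto
      then show "norm (a x * fourier h x) \<le> norm (H * norm (a x))" by (simp add: norm_mult mult.commute)
    qed
  qed measurable
  have c: "conv (sgn_ker J S) h x = 1 / (2 * pi) * fourier ?v (- x)" for x
    using inv_fourier_mult[OF ai h(1), of x] unfolding ker_eq by (simp add: inv_fourier_eq_fourier)
  have [measurable]: "fourier ?v \<in> borel_measurable borel"
    using continuous_fourier[OF vi] by (rule borel_measurable_continuous_onI)
  have "(\<integral>\<^sup>+x. ennreal ((norm (conv (sgn_ker J S) h x))\<^sup>2) \<partial>lborel)
      = (\<integral>\<^sup>+x. ennreal (1 / (2 * pi)\<^sup>2) * ennreal ((norm (fourier ?v (- x)))\<^sup>2) \<partial>lborel)"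
    unfolding c by (simp add: norm_mult norm_divide power_mult_distrib power_divide ennreal_mult[symmetric])
  also have "\<dots> = ennreal (1 / (2 * pi)\<^sup>2) * (\<integral>\<^sup>+x. ennreal ((norm (fourier ?v (- x)))\<^sup>2) \<partial>lborel)"
    by (rule nn_integral_cmult) measurable
  also have "(\<integral>\<^sup>+x. ennreal ((norm (fourier ?v (- x)))\<^sup>2) \<partial>lborel)
      = (\<integral>\<^sup>+x. ennreal ((norm (fourier ?v x))\<^sup>2) \<partial>lborel)"
    by (subst nn_integral_real_affine[of _ "-1" 0]) auto
  also have "ennreal (1 / (2 * pi)\<^sup>2) * \<dots> \<le> ennreal (1 / (2 * pi)\<^sup>2) * (ennreal (2 * pi) * (ennreal L2_const
      * (ennreal (2 * pi) * (\<integral>\<^sup>+x. ennreal ((norm (h x))\<^sup>2) \<partial>lborel))))"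
  proof (rule mult_left_mono)
    have "(\<integral>\<^sup>+x. ennreal ((norm (fourier ?v x))\<^sup>2) \<partial>lborel)
        \<le> ennreal (2 * pi) * (\<integral>\<^sup>+x. ennreal ((norm (?v x))\<^sup>2) \<partial>lborel)"
      using fourier_Bessel[OF vi] by simp
    also have "\<dots> \<le> ennreal (2 * pi) * (\<integral>\<^sup>+x. ennreal L2_const * ennreal ((norm (fourier h x))\<^sup>2) \<partial>lborel)"
    proof (intro mult_left_mono nn_integral_mono)
      fix x
      have "(norm (?v x))\<^sup>2 \<le> L2_const * (norm (fourier h x))\<^sup>2"
      proof -
        have "(norm (a x))\<^sup>2 \<le> L2_const"
          unfolding L2_const_def by (rule power_mono[OF a_le]) simp
        then show ?thesis unfolding norm_mult power_mult_distrib by (rule mult_right_mono) simp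
      qed
      then show "ennreal ((norm (?v x))\<^sup>2) \<le> ennreal L2_const * ennreal ((norm (fourier h x))\<^sup>2)"
        by (simp add: ennreal_mult[symmetric] L2_const_def ennreal_leI)
    qed simp
    also have "\<dots> = ennreal (2 * pi) * (ennreal L2_const * (\<integral>\<^sup>+x. ennreal ((norm (fourier h x))\<^sup>2) \<partial>lborel))"
      by (subst nn_integral_cmult) auto
    also have "\<dots> \<le> ennreal (2 * pi) * (ennreal L2_const * (ennreal (2 * pi)
        * (\<integral>\<^sup>+x. ennreal ((norm (h x))\<^sup>2) \<partial>lborel)))"
      using fourier_Bessel[OF h(1)] by (intro mult_left_mono) auto
    finally show "(\<integral>\<^sup>+x. ennreal ((norm (fourier ?v x))\<^sup>2) \<partial>lborel)
        \<le> ennreal (2 * pi) * (ennreal L2_const * (ennreal (2 * pi) * (\<integral>\<^sup>+x. ennreal ((norm (h x))\<^sup>2) \<partial>lborel)))" .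
  qed simp
  also have "\<dots> = ennreal L2_const * (\<integral>\<^sup>+x. ennreal ((norm (h x))\<^sup>2) \<partial>lborel)"
  proof -
    let ?N = "\<integral>\<^sup>+x. ennreal ((norm (h x))\<^sup>2) \<partial>lborel"
    have "ennreal (1 / (2 * pi)\<^sup>2) * (ennreal (2 * pi) * ennreal (2 * pi)) = 1"
      by (simp add: ennreal_mult[symmetric] power2_eq_square)
    moreover have "ennreal (1 / (2 * pi)\<^sup>2) * (ennreal (2 * pi) * (ennreal L2_const * (ennreal (2 * pi) * ?N))) =
      (ennreal (1 / (2 * pi)\<^sup>2) * (ennreal (2 * pi) * ennreal (2 * pi))) * (ennreal L2_const * ?N)"
      by (simp only: mult_ac)
    ultimately show ?thesis by simp
  qed
  finally show ?thesis .
qed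

text \<open>Both constants are independent of \<open>J\<close> and \<open>S\<close>: the one because
  the symbols overlap boundedly, the other because the Hormander integrals are summable over the
  scales.\<close>

lemma CZ_sgn_ker:
  assumes J: "finite J"
  shows "CZ_even (sgn_ker J S) L2_const Hor_const"
proof
  show "integrable lborel (sgn_ker J S)"
    unfolding sgn_ker_def[abs_def] sgn_sum_def
    by (intro Bochner_Integration.integrable_sum integrable_mult_right ker_integrable)
  show "0 \<le> L2_const" by (simp add: L2_const_def)
  show "0 \<le> Hor_const" by (simp add: Hor_const_def diff_const_nonneg)
  show "(\<integral>\<^sup>+x. ennreal ((norm (conv (sgn_ker J S) h x))\<^sup>2) \<partial>lborel)
      \<le> ennreal L2_const * (\<integral>\<^sup>+x. ennreal ((norm (h x))\<^sup>2) \<partial>lborel)"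
    if "integrable lborel h" "bounded (range h)" for h
    using that by (rule sgn_ker_L2[OF J])
  show "continuous_on UNIV (sgn_ker J S)"
    unfolding sgn_ker_def[abs_def] sgn_sum_def by (intro continuous_intros ker_continuous)
  show "sgn_ker J S (- x) = sgn_ker J S x" for x by (simp add: sgn_ker_def ker_even)
  have nrm: "norm (sgn_sum J S b) \<le> (\<Sum>j\<in>J. norm (b j))" for b
    unfolding sgn_sum_def by (rule order_trans[OF norm_sum]) (auto intro!: sum_mono simp: norm_mult)
  show "bounded (range (sgn_ker J S))"
  proof -
    have "\<exists>B. \<forall>x. norm (ker j x) \<le> B" for j using ker_bounded by (auto simp: bounded_iff)
    then obtain B where B: "\<And>j x. norm (ker j x) \<le> B j" by metis
    have "norm (sgn_ker J S x) \<le> (\<Sum>j\<in>J. B j)" for x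
      unfolding sgn_ker_def by (rule order_trans[OF nrm sum_mono[OF B]])
    then show ?thesis by (auto simp: bounded_iff)
  qed
  show "(\<integral>\<^sup>+x. indicator {x. \<bar>x\<bar> > 2 * \<bar>y\<bar>} x * ennreal (norm (sgn_ker J S (x - y) - sgn_ker J S x)) \<partial>lborel)
      \<le> ennreal Hor_const" for y
  proof (cases "y = 0")
    case False
    let ?I = "\<lambda>x. indicator {x. \<bar>x\<bar> > 2 * \<bar>y\<bar>} x :: ennreal"
    have "(\<integral>\<^sup>+x. ?I x * ennreal (norm (sgn_ker J S (x - y) - sgn_ker J S x)) \<partial>lborel)
      \<le> (\<integral>\<^sup>+x. (\<Sum>j\<in>J. ?I x * ennreal (norm (ker j (x - y) - ker j x))) \<partial>lborel)"
    proof (rule nn_integral_mono)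
      fix x
      have "sgn_ker J S (x - y) - sgn_ker J S x = sgn_sum J S (\<lambda>j. ker j (x - y) - ker j x)"
        by (simp add: sgn_ker_def sgn_sum_def sum_subtractf right_diff_distrib)
      then have "norm (sgn_ker J S (x - y) - sgn_ker J S x) \<le> (\<Sum>j\<in>J. norm (ker j (x - y) - ker j x))"
        using nrm by simp
      then have "ennreal (norm (sgn_ker J S (x - y) - sgn_ker J S x))
          \<le> (\<Sum>j\<in>J. ennreal (norm (ker j (x - y) - ker j x)))"
        by (simp add: sum_ennreal ennreal_leI)
      then show "?I x * ennreal (norm (sgn_ker J S (x - y) - sgn_ker J S x))
          \<le> (\<Sum>j\<in>J. ?I x * ennreal (norm (ker j (x - y) - ker j x)))"
        unfolding sum_distrib_left[symmetric] by (rule mult_left_mono) simp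
    qed
    also have "\<dots> = (\<Sum>j\<in>J. \<integral>\<^sup>+x. ?I x * ennreal (norm (ker j (x - y) - ker j x)) \<partial>lborel)"
      by (rule nn_integral_sum) measurable
    also have "\<dots> \<le> (\<Sum>j\<in>J. ennreal (diff_const * min (2 powr (m * of_int j) * \<bar>y\<bar>) (1 / (2 powr (m * of_int j)
        * \<bar>y\<bar>))))"
      by (intro sum_mono ker_Hormander False)
    also have "\<dots> = ennreal (diff_const * (\<Sum>j\<in>J. min (2 powr (m * of_int j) * \<bar>y\<bar>) (1 / (2 powr (m * of_int j)
        * \<bar>y\<bar>))))"
      unfolding sum_distrib_left using diff_const_nonneg by (intro sum_ennreal) auto
    also have "\<dots> \<le> ennreal Hor_const"
      unfolding Hor_const_def using False
      by (intro ennreal_leI mult_left_mono sum_min_dilates J m diff_const_nonneg) auto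
    finally show ?thesis .
  qed simp
qed

definition "sq_const p = Khinchine_const p * CZ_even.Lp_const L2_const Hor_const p"

lemma sq_const_nonneg: "1 < p \<Longrightarrow> sq_const p \<ge> 0"
  \<comment> \<open>\<open>Lp_const\<close> is a function of the two bounds alone, so the empty sum
    can serve as the kernel that instantiates the locale.\<close>
  using CZ_even.Lp_const_nonneg[OF CZ_sgn_ker[of "{}" "{}"], of p] Khinchine_const_pos[of p]
  by (simp add: sq_const_def less_imp_le)

text \<open>Khinchine's inequality at each point, then the L^p bound for each choice of signs.
  Averaging over all choices costs nothing, as the bounds coincide.\<close>

theorem square_function_bound:
  assumes J: "finite J" and h: "test_fun h" and p: "1 < p"
  shows "(\<integral>\<^sup>+x. ennreal (sqrt (\<Sum>j\<in>J. (norm (conv (ker j) h x))\<^sup>2) powr p) \<partial>lborel)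
    \<le> ennreal (sq_const p) * (\<integral>\<^sup>+x. ennreal (norm (h x) powr p) \<partial>lborel)"
proof -
  let ?N = "\<integral>\<^sup>+x. ennreal (norm (h x) powr p) \<partial>lborel" and ?K = "Khinchine_const p" and ?n = "2 ^ card J :: real"
  let ?L = "CZ_even.Lp_const L2_const Hor_const p"
  have [measurable]: "h \<in> borel_measurable borel" using h by (rule test_fun_measurable)
  have L0: "?L \<ge> 0" using CZ_even.Lp_const_nonneg[OF CZ_sgn_ker[of "{}" "{}"] p] by simp
  have K0: "?K \<ge> 0" using Khinchine_const_pos[of p] by simp
  have sk: "conv (sgn_ker J S) h x = sgn_sum J S (\<lambda>j. conv (ker j) h x)" for S x
    by (rule conv_sgn_ker[OF _ test_fun_bounded[OF h]]) measurable
  have [measurable]: "sgn_ker J S \<in> borel_measurable borel" for S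
    using CZ_kernel.k_integrable[OF CZ_even.axioms(1)[OF CZ_sgn_ker[OF J, of S]]] by auto
  have "(\<integral>\<^sup>+x. ennreal (sqrt (\<Sum>j\<in>J. (norm (conv (ker j) h x))\<^sup>2) powr p) \<partial>lborel)
    \<le> (\<integral>\<^sup>+x. ennreal (?K / ?n) * (\<Sum>S\<in>Pow J. ennreal (norm (conv (sgn_ker J S) h x) powr p)) \<partial>lborel)"
  proof (rule nn_integral_mono)
    fix x
    have "sqrt (\<Sum>j\<in>J. (norm (conv (ker j) h x))\<^sup>2) powr p
        \<le> ?K * ((\<Sum>S\<in>Pow J. norm (conv (sgn_ker J S) h x) powr p) / ?n)"
      unfolding sk by (rule Khinchine[OF J]) (use p in simp)
    also have "\<dots> = (?K / ?n) * (\<Sum>S\<in>Pow J. norm (conv (sgn_ker J S) h x) powr p)" by simp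
    finally have "ennreal (sqrt (\<Sum>j\<in>J. (norm (conv (ker j) h x))\<^sup>2) powr p)
        \<le> ennreal ((?K / ?n) * (\<Sum>S\<in>Pow J. norm (conv (sgn_ker J S) h x) powr p))"
      by (rule ennreal_leI)
    also have "\<dots> = ennreal (?K / ?n) * ennreal (\<Sum>S\<in>Pow J. norm (conv (sgn_ker J S) h x) powr p)"
      by (rule ennreal_mult) (use K0 in \<open>auto intro: sum_nonneg\<close>)
    finally show "ennreal (sqrt (\<Sum>j\<in>J. (norm (conv (ker j) h x))\<^sup>2) powr p)
        \<le> ennreal (?K / ?n) * (\<Sum>S\<in>Pow J. ennreal (norm (conv (sgn_ker J S) h x) powr p))"
      by (simp add: sum_ennreal)
  qed
  also have "\<dots> = ennreal (?K / ?n) * (\<Sum>S\<in>Pow J. \<integral>\<^sup>+x. ennreal (norm (conv (sgn_ker J S) h x) powr p) \<partial>lborel)"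
    by (simp add: nn_integral_cmult nn_integral_sum del: sum_ennreal)
  also have "\<dots> \<le> ennreal (?K / ?n) * (\<Sum>S\<in>Pow J. ennreal ?L * ?N)"
    by (intro mult_left_mono sum_mono CZ_even.Lp_bound[OF CZ_sgn_ker[OF J] h p]) auto
  also have "\<dots> = ennreal (?K / ?n) * (ennreal ?n * (ennreal ?L * ?N))"
    using J by (simp add: card_Pow ennreal_of_nat_eq_real_of_nat ennreal_power flip: ennreal_numeral)
  also have "\<dots> = ennreal (sq_const p) * ?N"
    unfolding sq_const_def using K0 L0 by (simp add: mult.assoc[symmetric] ennreal_mult[symmetric])
  finally show ?thesis .
qed

definition "rev_const r = dual_const r (sq_const (r / (r - 1)))"

text \<open>Paired with a test function, each \<open>G j\<close> is replaced by
  \<open>conv (ker j) (G j)\<close> and its kernel is moved to the test function. Cauchy-Schwarz in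
  \<open>j\<close> leaves the square function of the test function, which is bounded at the
  conjugate exponent.\<close>

theorem reverse_square_function:
  assumes J: "finite J" and r: "1 < r"
    and G: "\<And>j. j \<in> J \<Longrightarrow> continuous_on UNIV (G j)" "\<And>j. j \<in> J \<Longrightarrow> bounded (range (G j))"
    and rep: "\<And>j x. j \<in> J \<Longrightarrow> conv (ker j) (G j) x = G j x"
  shows "(\<integral>\<^sup>+x. ennreal (norm (\<Sum>j\<in>J. G j x) powr r) \<partial>lborel)
    \<le> ennreal (rev_const r) * (\<integral>\<^sup>+x. ennreal (sqrt (\<Sum>j\<in>J. (norm (G j x))\<^sup>2) powr r) \<partial>lborel)"
  unfolding rev_const_def
proof (rule dual_bound[where q="r / (r - 1)"])
  let ?q = "r / (r - 1)"
  have q: "1 < ?q" using r by (simp add: less_divide_eq)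
  show "sq_const ?q \<ge> 0" using q by (rule sq_const_nonneg)
  have Gm: "G j \<in> borel_measurable borel" if "j \<in> J" for j
    using G(1)[OF that] by (rule borel_measurable_continuous_onI)
  show "continuous_on UNIV (\<lambda>x. \<Sum>j\<in>J. G j x)" by (intro continuous_on_sum G)
  show "(\<lambda>x. sqrt (\<Sum>j\<in>J. (norm (G j x))\<^sup>2)) \<in> borel_measurable borel"
    using Gm by measurable
  show "sqrt (\<Sum>j\<in>J. (norm (G j x))\<^sup>2) \<ge> 0" for x by (simp add: sum_nonneg)
  fix h assume h: "test_fun h"
  have [measurable]: "h \<in> borel_measurable borel" using h by (rule test_fun_measurable)
  let ?a = "\<lambda>x. sqrt (\<Sum>j\<in>J. (norm (G j x))\<^sup>2)" and ?b = "\<lambda>x. sqrt (\<Sum>j\<in>J. (norm (conv (ker j) h x))\<^sup>2)"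
  have int: "integrable lborel (\<lambda>x. G j x * h x)" if "j \<in> J" for j
  proof -
    have [measurable]: "G j \<in> borel_measurable borel" using that by (rule Gm)
    have "bounded (range (G j))" using that by (rule G(2))
    then obtain B where B: "\<And>x. norm (G j x) \<le> B" by (auto simp: bounded_iff)
    show ?thesis
    proof (rule Bochner_Integration.integrable_bound[OF integrable_mult_right[OF integrable_norm[OF
        test_fun_integrable[OF h]], of B]])
      show "AE x in lborel. norm (G j x * h x) \<le> norm (B * norm (h x))"
        using B by (intro AE_I2) (auto simp: norm_mult intro!: mult_right_mono intro: order_trans[OF _
            abs_ge_self])
    qed measurable
  qed
  have "(LINT x|lborel. (\<Sum>j\<in>J. G j x) * h x) = (\<Sum>j\<in>J. LINT x|lborel. G j x * h x)"
    unfolding sum_distrib_right by (rule Bochner_Integration.integral_sum) (rule int)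
  also have "\<dots> = (\<Sum>j\<in>J. LINT x|lborel. G j x * conv (ker j) h x)"
  proof (rule sum.cong)
    fix j assume j: "j \<in> J"
    have "(LINT x|lborel. G j x * h x) = (LINT x|lborel. conv (ker j) (G j) x * h x)"
      using rep[OF j] by simp
    also have "\<dots> = (LINT x|lborel. G j x * conv (ker j) h x)"
      by (rule conv_symmetric[OF ker_integrable ker_even Gm[OF j] G(2)[OF j] test_fun_integrable[OF h]])
    finally show "(LINT x|lborel. G j x * h x) = (LINT x|lborel. G j x * conv (ker j) h x)" .
  qed simp
  finally have eq: "(LINT x|lborel. (\<Sum>j\<in>J. G j x) * h x) = (\<Sum>j\<in>J. LINT x|lborel. G j x * conv (ker j) h x)" .
  have "ennreal (norm (LINT x|lborel. (\<Sum>j\<in>J. G j x) * h x))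
      \<le> ennreal (\<Sum>j\<in>J. norm (LINT x|lborel. G j x * conv (ker j) h x))"
    unfolding eq by (intro ennreal_leI norm_sum)
  also have "\<dots> = (\<Sum>j\<in>J. ennreal (norm (LINT x|lborel. G j x * conv (ker j) h x)))"
    by (rule sum_ennreal[symmetric]) simp
  also have "\<dots> \<le> (\<Sum>j\<in>J. \<integral>\<^sup>+x. ennreal (norm (G j x * conv (ker j) h x)) \<partial>lborel)"
    by (intro sum_mono norm_integral_le_nn_integral)
  also have "\<dots> = (\<integral>\<^sup>+x. (\<Sum>j\<in>J. ennreal (norm (G j x * conv (ker j) h x))) \<partial>lborel)"
    using Gm measurable_conv[OF ker_measurable \<open>h \<in> borel_measurable borel\<close>]
        by (intro nn_integral_sum[symmetric]) auto
  also have "\<dots> \<le> (\<integral>\<^sup>+x. ennreal (?a x * ?b x) \<partial>lborel)"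
  proof (rule nn_integral_mono)
    fix x
    have "(\<Sum>j\<in>J. norm (G j x * conv (ker j) h x)) \<le> ?a x * ?b x"
      using L2_set_mult_ineq[of "\<lambda>j. norm (G j x)" "\<lambda>j. norm (conv (ker j) h x)" J]
          by (simp add: L2_set_def norm_mult)
    then show "(\<Sum>j\<in>J. ennreal (norm (G j x * conv (ker j) h x))) \<le> ennreal (?a x * ?b x)"
      by (simp add: sum_ennreal ennreal_leI)
  qed
  finally show "\<exists>b. b \<in> borel_measurable borel \<and> (\<forall>x. b x \<ge> (0::real)) \<and>
      ennreal (norm (LINT x|lborel. (\<Sum>j\<in>J. G j x) * h x)) \<le> (\<integral>\<^sup>+x. ennreal (?a x * b x) \<partial>lborel) \<and>
      (\<integral>\<^sup>+x. ennreal (b x powr ?q) \<partial>lborel) \<le> ennreal (sq_const ?q) * (\<integral>\<^sup>+x. ennreal (norm (h x) powr ?q) \<partial>lborel)"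
    using square_function_bound[OF J h q] by (intro exI[of _ ?b]) (auto intro: sum_nonneg)
qed (use r in auto)

text \<open>As a function of t, \<open>cis (t * \<Phi> \<xi>)\<close> is an eigenfunction of
  convolution with eigenvalue \<open>fourier (ker j) (\<Phi> \<xi>)\<close>.\<close>

lemma conv_ker_osc_integral:
  fixes v :: "'a::euclidean_space \<Rightarrow> complex"
  assumes [measurable]: "\<Phi> \<in> borel_measurable borel" and v: "integrable lborel v"
  shows "conv (ker j) (osc_integral \<Phi> v) t = osc_integral \<Phi> (\<lambda>\<xi>. fat j (\<Phi> \<xi>) * v \<xi>) t"
proof -
  have [measurable]: "v \<in> borel_measurable borel" using v by auto
  have kr: "integrable lborel (\<lambda>s. ker j (t - s))" using ker_integrable[of j] by (simp add: integrable_reflect)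
  have "conv (ker j) (osc_integral \<Phi> v) t = (LINT s|lborel. LINT \<xi>|lborel. ker j (t - s) * (cis (s * \<Phi> \<xi>) * v \<xi>))"
    unfolding conv_def osc_integral_def by simp
  also have "\<dots> = (LINT \<xi>|lborel. LINT s|lborel. ker j (t - s) * (cis (s * \<Phi> \<xi>) * v \<xi>))"
    by (rule lborel_pair.Fubini_integral[symmetric], rule integrable_pair_bound[OF kr v])
       (auto simp: norm_mult split_def)
  also have "\<dots> = (LINT \<xi>|lborel. cis (t * \<Phi> \<xi>) * (fat j (\<Phi> \<xi>) * v \<xi>))"
  proof (rule Bochner_Integration.integral_cong[OF refl])
    fix \<xi>
    have "(LINT s|lborel. ker j (t - s) * (cis (s * \<Phi> \<xi>) * v \<xi>))
        = (LINT s|lborel. ker j s * (cis ((t - s) * \<Phi> \<xi>) * v \<xi>))"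
      using LINT_reflect[of "\<lambda>s. ker j s * (cis ((t - s) * \<Phi> \<xi>) * v \<xi>)" t] by simp
    also have "\<dots> = (LINT s|lborel. (cis (- (s \<bullet> \<Phi> \<xi>)) * ker j s) * (cis (t * \<Phi> \<xi>) * v \<xi>))"
    proof -
      have "cis ((t - s) * \<Phi> \<xi>) = cis (t * \<Phi> \<xi>) * cis (- (s \<bullet> \<Phi> \<xi>))" for s
        by (simp add: cis_mult left_diff_distrib)
      then show ?thesis by (simp only: mult_ac)
    qed
    also have "\<dots> = fourier (ker j) (\<Phi> \<xi>) * (cis (t * \<Phi> \<xi>) * v \<xi>)"
      by (simp only: integral_mult_left_zero fourier_def)
    finally show "(LINT s|lborel. ker j (t - s) * (cis (s * \<Phi> \<xi>) * v \<xi>)) = cis (t * \<Phi> \<xi>) * (fat j (\<Phi> \<xi>) * v \<xi>)"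
      by (simp add: fourier_ker)
  qed
  finally show ?thesis by (simp add: osc_integral_def)
qed

lemma symb_measurable [measurable]: "symb j \<in> borel_measurable borel"
  using cutoff_sym_integrable[OF phi pos cutoff_sym_symb] by auto

lemma integrable_symb_mult:
  fixes g :: "'a::euclidean_space \<Rightarrow> complex"
  assumes [measurable]: "\<Phi> \<in> borel_measurable borel" and g: "integrable lborel g"
  shows "integrable lborel (\<lambda>\<xi>. symb j (\<Phi> \<xi>) * g \<xi>)"
proof (rule Bochner_Integration.integrable_bound[OF integrable_mult_right[OF integrable_norm[OF g], of
    phi_bound]])
  show "(\<lambda>\<xi>. symb j (\<Phi> \<xi>) * g \<xi>) \<in> borel_measurable lborel"
    using g by measurable
  show "AE \<xi> in lborel. norm (symb j (\<Phi> \<xi>) * g \<xi>) \<le> norm (phi_bound * norm (g \<xi>))"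
    using phi_bound_nonneg by (intro AE_I2) (simp add: norm_mult abs_mult norm_symb_le mult_right_mono)
qed

text \<open>Where \<open>\<Phi> \<xi>\<close> is non-zero, the partial sums of the symbols are
  eventually 1, so dominated convergence recovers the full integral at every t. Fatou's lemma
  carries the norm bound to the limit.\<close>

theorem osc_integral_reverse_square:
  fixes g :: "'a::euclidean_space \<Rightarrow> complex"
  assumes Phi[measurable]: "\<Phi> \<in> borel_measurable borel" and g: "integrable lborel g" and r: "1 < r"
    and nz: "AE \<xi> in lborel. \<Phi> \<xi> \<noteq> 0"
    and X: "\<And>J. finite J \<Longrightarrow> (\<integral>\<^sup>+t. ennreal (sqrt (\<Sum>j\<in>J. (norm (osc_integral \<Phi> (\<lambda>\<xi>. symb j (\<Phi> \<xi>)
        * g \<xi>) t))\<^sup>2) powr r) \<partial>lborel) \<le> X"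
  shows "(\<integral>\<^sup>+t. ennreal (norm (osc_integral \<Phi> g t) powr r) \<partial>lborel) \<le> ennreal (rev_const r) * X"
proof -
  have [measurable]: "g \<in> borel_measurable borel" using g by auto
  let ?G = "\<lambda>j. osc_integral \<Phi> (\<lambda>\<xi>. symb j (\<Phi> \<xi>) * g \<xi>)"
  note gi = integrable_symb_mult[OF Phi g]
  have Gc: "continuous_on UNIV (?G j)" for j by (rule osc_integral_continuous[OF Phi gi])
  have [measurable]: "?G j \<in> borel_measurable borel" for j using Gc by (rule borel_measurable_continuous_onI)
  have rep: "conv (ker j) (?G j) t = ?G j t" for j t
    unfolding conv_ker_osc_integral[OF Phi gi] by (simp add: mult.assoc[symmetric] fat_symb)
  let ?J = "\<lambda>N::nat. {- int N..int N}"
  have part: "(\<integral>\<^sup>+t. ennreal (norm (\<Sum>j\<in>?J N. ?G j t) powr r) \<partial>lborel) \<le> ennreal (rev_const r) * X" for N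
  proof -
    have "(\<integral>\<^sup>+t. ennreal (norm (\<Sum>j\<in>?J N. ?G j t) powr r) \<partial>lborel)
      \<le> ennreal (rev_const r) * (\<integral>\<^sup>+t. ennreal (sqrt (\<Sum>j\<in>?J N. (norm (?G j t))\<^sup>2) powr r) \<partial>lborel)"
    proof (rule reverse_square_function[OF _ r Gc _ rep])
      show "bounded (range (?G j))" for j using osc_integral_bounded by (auto simp: bounded_iff)
    qed simp
    also have "\<dots> \<le> ennreal (rev_const r) * X" by (intro mult_left_mono X) auto
    finally show ?thesis .
  qed
  have lim: "(\<lambda>N. \<Sum>j\<in>?J N. ?G j t) \<longlonglongrightarrow> osc_integral \<Phi> g t" for t
  proof -
    have eq: "(\<Sum>j\<in>?J N. ?G j t) = (LINT \<xi>|lborel. (\<Sum>j\<in>?J N. symb j (\<Phi> \<xi>)) * (cis (t * \<Phi> \<xi>) * g \<xi>))" for N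
    proof -
      have "(\<Sum>j\<in>?J N. ?G j t) = (LINT \<xi>|lborel. (\<Sum>j\<in>?J N. cis (t * \<Phi> \<xi>) * (symb j (\<Phi> \<xi>) * g \<xi>)))"
        unfolding osc_integral_def
        by (rule Bochner_Integration.integral_sum[symmetric]) (intro integrable_cis_mult gi; measurable)
      then show ?thesis unfolding sum_distrib_right by (simp only: mult_ac)
    qed
    have "(\<lambda>N. LINT \<xi>|lborel. (\<Sum>j\<in>?J N. symb j (\<Phi> \<xi>)) * (cis (t * \<Phi> \<xi>) * g \<xi>))
        \<longlonglongrightarrow> (LINT \<xi>|lborel. cis (t * \<Phi> \<xi>) * g \<xi>)"
    proof (rule integral_dominated_convergence[where w="\<lambda>\<xi>. 3 * phi_bound * norm (g \<xi>)"])
      show "AE \<xi> in lborel. (\<lambda>N. (\<Sum>j\<in>?J N. symb j (\<Phi> \<xi>)) * (cis (t * \<Phi> \<xi>) * g \<xi>)) \<longlonglongrightarrow> cis (t * \<Phi> \<xi>) * g \<xi>"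
        using nz
      proof eventually_elim
        case (elim \<xi>)
        obtain N0 :: nat where N0: "\<bar>log 2 \<bar>\<Phi> \<xi>\<bar> / m\<bar> + 1 \<le> real N0" using real_arch_simple by blast
        have "eventually (\<lambda>N. (\<Sum>j\<in>?J N. symb j (\<Phi> \<xi>)) * (cis (t * \<Phi> \<xi>) * g \<xi>) = cis (t * \<Phi> \<xi>) * g \<xi>) sequentially"
          using eventually_ge_at_top[of N0]
        proof eventually_elim
          case (elim N)
          have "(\<Sum>j\<in>?J N. symb j (\<Phi> \<xi>)) = 1"
          proof (rule sum_symb_eq_1)
            fix j assume "symb j (\<Phi> \<xi>) \<noteq> 0"
            then have "\<bar>of_int j - log 2 \<bar>\<Phi> \<xi>\<bar> / m\<bar> < 1" by (rule symb_support)
            moreover have "real N0 \<le> real N" using elim by simp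
            ultimately have "- real N \<le> of_int j" "of_int j \<le> real N" using N0 by linarith+
            then show "j \<in> ?J N" by simp
          qed (use \<open>\<Phi> \<xi> \<noteq> 0\<close> in auto)
          then show ?case by simp
        qed
        then show ?case by (rule tendsto_eventually)
      qed
      show "AE \<xi> in lborel. norm ((\<Sum>j\<in>?J N. symb j (\<Phi> \<xi>)) * (cis (t * \<Phi> \<xi>) * g \<xi>))
          \<le> 3 * phi_bound * norm (g \<xi>)" for N
      proof (rule AE_I2)
        fix \<xi>
        have "norm (\<Sum>j\<in>?J N. symb j (\<Phi> \<xi>)) \<le> 3 * phi_bound"
          by (rule order_trans[OF norm_sum sum_norm_symb_le]) simp
        then show "norm ((\<Sum>j\<in>?J N. symb j (\<Phi> \<xi>)) * (cis (t * \<Phi> \<xi>) * g \<xi>)) \<le> 3 * phi_bound * norm (g \<xi>)"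
          by (simp add: norm_mult mult_right_mono)
      qed
    qed (use g in auto)
    then show ?thesis by (simp only: eq osc_integral_def[of \<Phi> g])
  qed
  show ?thesis
  proof (rule nn_integral_Fatou_bound[where f="\<lambda>N t. ennreal (norm (\<Sum>j\<in>?J N. ?G j t) powr r)" and C="\<lambda>_. ennreal
      (rev_const r) * X"])
    show "(\<lambda>N. ennreal (norm (\<Sum>j\<in>?J N. ?G j t) powr r)) \<longlonglongrightarrow> ennreal (norm (osc_integral \<Phi> g t) powr r)" for t
      using r by (intro tendsto_ennrealI tendsto_powr' tendsto_norm lim tendsto_const) auto
  qed (use part in auto)
qed

end

subsection \<open>Dispersive propagators\<close>

lemma enn_powr_ennreal: "x \<ge> 0 \<Longrightarrow> enn_powr (ennreal x) p = ennreal (x powr p)"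
  by (simp add: enn_powr_def)

lemma enn_powr_mono:
  assumes "x \<le> y" "p \<ge> 0"
  shows "enn_powr x p \<le> enn_powr y p"
proof (cases "y = \<infinity>")
  case False
  then have "x \<noteq> \<infinity>" using assms(1) by (auto simp: top_unique)
  then show ?thesis using False assms
    by (auto simp: enn_powr_def intro!: ennreal_leI powr_mono2 enn2real_mono simp: less_top)
qed (simp add: enn_powr_def)

lemma enn_powr_cmult:
  assumes "c > 0" "p > 0"
  shows "enn_powr (ennreal c * x) p = ennreal (c powr p) * enn_powr x p"
proof (cases "x = \<infinity>")
  case True
  then show ?thesis using assms by (simp add: enn_powr_def ennreal_mult_top)
next
  case False
  then obtain y where y: "x = ennreal y" "y \<ge> 0" by (cases x) auto
  have "ennreal c * x = ennreal (c * y)" using assms y by (simp add: ennreal_mult)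
  then show ?thesis using assms y by (simp add: enn_powr_ennreal ennreal_mult[symmetric] powr_mult)
qed

lemma Lr_norm_le:
  assumes r: "r > 0" and c: "c > 0"
    and le: "(\<integral>\<^sup>+t. enn_powr (F t) r \<partial>lborel) \<le> ennreal c * (\<integral>\<^sup>+t. enn_powr (G t) r \<partial>lborel)"
  shows "Lr_norm r F \<le> ennreal (c powr (1 / r)) * Lr_norm r G"
proof -
  have "Lr_norm r F \<le> enn_powr (ennreal c * (\<integral>\<^sup>+t. enn_powr (G t) r \<partial>lborel)) (1 / r)"
    unfolding Lr_norm_def using r by (intro enn_powr_mono le) auto
  also have "\<dots> = ennreal (c powr (1 / r)) * Lr_norm r G"
    unfolding Lr_norm_def using r c by (intro enn_powr_cmult) auto
  finally show ?thesis .
qed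

lemma borel_measurable_off_zero:
  fixes \<Phi> :: "'a::euclidean_space \<Rightarrow> real"
  assumes "continuous_on (- {0}) \<Phi>"
  shows "\<Phi> \<in> borel_measurable borel"
proof -
  have "(\<lambda>x. indicator (- {0}) x *\<^sub>R \<Phi> x) \<in> borel_measurable borel"
    by (rule borel_measurable_continuous_on_indicator) (use assms in auto)
  then have "(\<lambda>x. if x = 0 then \<Phi> 0 else indicator (- {0}) x *\<^sub>R \<Phi> x) \<in> borel_measurable borel"
    by measurable
  also have "(\<lambda>x. if x = 0 then \<Phi> 0 else indicator (- {0}) x *\<^sub>R \<Phi> x) = \<Phi>"
    by (auto simp: indicator_def)
  finally show ?thesis .
qed

text \<open>Homogeneity reduces to the unit sphere, where \<Phi> is pinched between the two powers
  of \<mu>. The logarithmic form compares directly the indices j and k at which \<xi> is seen in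
  time and in space.\<close>

lemma homogeneous_bounds:
  fixes \<Phi> :: "'a::euclidean_space \<Rightarrow> real"
  assumes sph: "\<And>\<xi>. norm \<xi> = 1 \<Longrightarrow> inverse \<mu> \<le> \<bar>\<Phi> \<xi>\<bar> \<and> \<bar>\<Phi> \<xi>\<bar> \<le> \<mu>"
    and hom: "\<And>c \<xi>. c > 0 \<Longrightarrow> \<xi> \<noteq> 0 \<Longrightarrow> \<Phi> (c *\<^sub>R \<xi>) = c powr m * \<Phi> \<xi>"
    and mu: "\<mu> \<ge> 1" and m: "m \<ge> 1" and xi: "\<xi> \<noteq> 0"
  shows "\<Phi> \<xi> \<noteq> 0" "\<bar>log 2 \<bar>\<Phi> \<xi>\<bar> / m - log 2 (norm \<xi>)\<bar> \<le> log 2 \<mu> / m"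
proof -
  let ?s = "\<xi> /\<^sub>R norm \<xi>"
  have s: "norm ?s = 1" "?s \<noteq> 0" using xi by auto
  have b: "inverse \<mu> \<le> \<bar>\<Phi> ?s\<bar>" "\<bar>\<Phi> ?s\<bar> \<le> \<mu>" using sph[OF s(1)] by auto
  have p: "\<bar>\<Phi> ?s\<bar> > 0" using b(1) mu by (smt (verit) positive_imp_inverse_positive)
  have "\<Phi> \<xi> = norm \<xi> powr m * \<Phi> ?s" using hom[of "norm \<xi>" ?s] xi s by simp
  then have e: "\<bar>\<Phi> \<xi>\<bar> = norm \<xi> powr m * \<bar>\<Phi> ?s\<bar>" by (simp add: abs_mult)
  then show "\<Phi> \<xi> \<noteq> 0" using p xi by auto
  have "log 2 \<bar>\<Phi> \<xi>\<bar> = m * log 2 (norm \<xi>) + log 2 \<bar>\<Phi> ?s\<bar>"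
    unfolding e using p xi by (simp add: log_mult log_powr)
  then have "log 2 \<bar>\<Phi> \<xi>\<bar> / m - log 2 (norm \<xi>) = log 2 \<bar>\<Phi> ?s\<bar> / m"
    using m by (simp add: add_divide_distrib)
  moreover have "\<bar>log 2 \<bar>\<Phi> ?s\<bar>\<bar> \<le> log 2 \<mu>"
  proof -
    have "log 2 \<bar>\<Phi> ?s\<bar> \<le> log 2 \<mu>" using b(2) p mu by (subst log_le_cancel_iff) auto
    moreover have "log 2 (inverse \<mu>) \<le> log 2 \<bar>\<Phi> ?s\<bar>" using b(1) p mu by (subst log_le_cancel_iff) auto
    ultimately show ?thesis using mu by (simp add: log_inverse abs_le_iff)
  qed
  ultimately show "\<bar>log 2 \<bar>\<Phi> \<xi>\<bar> / m - log 2 (norm \<xi>)\<bar> \<le> log 2 \<mu> / m"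
    using m by (simp add: divide_right_mono)
qed

text \<open>\<open>C\<close> is chosen before \<Phi>, f and x. Integrability of f and of its
  transform makes the formal integrals absolutely convergent; values in \<open>ennreal\<close> keep
  the inequality meaningful when a norm is infinite.\<close>

theorem lemma2p1:
  fixes \<phi> :: "real \<Rightarrow> real" and m \<mu> r :: real
  assumes "LP_cutoff \<phi>" and "\<mu> \<ge> 1" and "m \<ge> 1" and "1 < r"
  shows "\<exists>C::real. C \<ge> 0 \<and>
    (\<forall>\<Phi> :: real^'n \<Rightarrow> real.
       smooth_on (- {0}) \<Phi> \<longrightarrow>
       (\<forall>\<xi>. \<xi> \<noteq> 0 \<longrightarrow> norm (grad \<Phi> \<xi>) \<noteq> 0) \<longrightarrow>
       (\<forall>\<xi>. norm \<xi> = 1 \<longrightarrow> inverse \<mu> \<le> \<bar>\<Phi> \<xi>\<bar> \<and> \<bar>\<Phi> \<xi>\<bar> \<le> \<mu>) \<longrightarrow>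
       (\<forall>c>0. \<forall>\<xi>. \<xi> \<noteq> 0 \<longrightarrow> \<Phi> (c *\<^sub>R \<xi>) = c powr m * \<Phi> \<xi>) \<longrightarrow>
       (\<forall>\<xi>. \<xi> \<noteq> 0 \<longrightarrow> rank (hessian \<Phi> \<xi>) \<ge> 1) \<longrightarrow>
       (\<forall>(f :: real^'n \<Rightarrow> complex) (x :: real^'n).
          integrable lborel f \<longrightarrow> integrable lborel (fourier f) \<longrightarrow>
          Lr_norm r (\<lambda>t. ennreal (norm (dispersive \<Phi> t f x)))
          \<le> ennreal C * Lr_norm r (\<lambda>t. enn_powr
               (\<Sum>\<^sub>\<infinity>(j, k) \<in> {(j :: int, k :: int). \<bar>real_of_int (k - j)\<bar> \<le> log 2 \<mu> / m + 2}.
                  ennreal ((norm (LP_time (time_cutoff m \<phi>) m j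
                              (\<lambda>s. dispersive \<Phi> s (LP_space \<phi> k f) x) t))\<^sup>2))
               (1 / 2))))"
proof -
  note phi = assms(1) and mu = assms(2) and m = assms(3) and r = assms(4)
  interpret LP_decomposition \<phi> m by unfold_locales (rule phi, rule m)
  define L where "L = log 2 \<mu> / m + 2"
  have L: "L \<ge> 2" using mu m by (simp add: L_def zero_le_log_cancel_iff)
  define W where "W j = {j - \<lfloor>L\<rfloor>..j + \<lfloor>L\<rfloor>}" for j
  have W: "k \<in> W j \<longleftrightarrow> \<bar>real_of_int (k - j)\<bar> \<le> L" for j k
  proof -
    have "\<bar>real_of_int (k - j)\<bar> \<le> L \<longleftrightarrow> \<bar>k - j\<bar> \<le> \<lfloor>L\<rfloor>" by (simp add: le_floor_iff)
    then show ?thesis unfolding W_def by auto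
  qed
  have finW: "finite (W j)" for j by (simp add: W_def)
  define n where "n = real (nat (2 * \<lfloor>L\<rfloor> + 1))"
  have cardW: "real (card (W j)) = n" for j by (simp add: W_def n_def algebra_simps)
  have n: "n > 0" using L by (simp add: n_def le_floor_iff) linarith
  \<comment> \<open>The power of \<open>n\<close> is the loss from Cauchy-Schwarz over the
    \<open>n\<close> space frequencies in \<open>W j\<close>; the added 1 makes \<open>c\<close>
    positive, as \<open>Lr_norm_le\<close> requires.\<close>
  define c where "c = (rev_const r + 1) * n powr (r / 2)"
  have rc: "rev_const r \<ge> 0" by (simp add: rev_const_def dual_const_nonneg)
  have c: "c > 0" using rc n by (simp add: c_def)
  show ?thesis
  proof (intro exI[of _ "c powr (1 / r)"] conjI allI impI)
    show "c powr (1 / r) \<ge> 0" by simp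
    fix \<Phi> :: "real^'n \<Rightarrow> real" and f :: "real^'n \<Rightarrow> complex" and x :: "real^'n"
    assume sm: "smooth_on (- {0}) \<Phi>"
      and sph: "\<forall>\<xi>. norm \<xi> = 1 \<longrightarrow> inverse \<mu> \<le> \<bar>\<Phi> \<xi>\<bar> \<and> \<bar>\<Phi> \<xi>\<bar> \<le> \<mu>"
      and hom: "\<forall>c>0. \<forall>\<xi>. \<xi> \<noteq> 0 \<longrightarrow> \<Phi> (c *\<^sub>R \<xi>) = c powr m * \<Phi> \<xi>"
      and f: "integrable lborel f" and ff: "integrable lborel (fourier f)"
    have "continuous_on (- {0}) \<Phi>" using sm unfolding smooth_on_def by (metis Ck_on.simps(1))
    then have Phi[measurable]: "\<Phi> \<in> borel_measurable borel" by (rule borel_measurable_off_zero)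
    have bounds: "\<Phi> \<xi> \<noteq> 0" "\<bar>log 2 \<bar>\<Phi> \<xi>\<bar> / m - log 2 (norm \<xi>)\<bar> \<le> log 2 \<mu> / m" if "\<xi> \<noteq> 0" for \<xi>
      using homogeneous_bounds[OF _ _ mu m that, of \<Phi>] sph hom by auto
    \<comment> \<open>The phase in x and the transform of f are absorbed into the density; from here
      on both occur only through \<open>g\<close>.\<close>
    define g where "g \<xi> = 1 / (2 * pi) ^ DIM(real^'n) * (cis (x \<bullet> \<xi>) * fourier f \<xi>)" for \<xi>
    define s where "s k \<xi> = complex_of_real (\<phi> (2 powr (- of_int k) * norm (\<xi>::real^'n)))" for k \<xi>
    have g: "integrable lborel g"
      unfolding g_def by (intro integrable_mult_right integrable_cis_mult ff) measurable
    have disp: "(\<lambda>t. dispersive \<Phi> t f x) = osc_integral \<Phi> g"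
    proof
      fix t
      show "dispersive \<Phi> t f x = osc_integral \<Phi> g t"
        unfolding dispersive_def osc_integral_def g_def
        by (simp add: cis_mult[symmetric] mult_ac flip: integral_mult_right_zero)
    qed
    have disp_k: "(\<lambda>t. dispersive \<Phi> t (LP_space \<phi> k f) x) = osc_integral \<Phi> (\<lambda>\<xi>. s k \<xi> * g \<xi>)" for k
    proof
      fix t
      show "dispersive \<Phi> t (LP_space \<phi> k f) x = osc_integral \<Phi> (\<lambda>\<xi>. s k \<xi> * g \<xi>) t"
        unfolding dispersive_def osc_integral_def g_def s_def fourier_LP_space[OF phi f]
        by (simp add: cis_mult[symmetric] mult_ac flip: integral_mult_right_zero)
    qed
    have s_meas [measurable]: "s k \<in> borel_measurable borel" and s_le: "norm (s k \<xi>) \<le> phi_bound" for k \<xi>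
    proof -
      show "s k \<in> borel_measurable borel"
        using cutoff_sym_continuous[OF phi _ _ cutoff_sym_space[OF phi, of k]]
        by (intro borel_measurable_continuous_onI) (simp add: s_def[abs_def])
      show "norm (s k \<xi>) \<le> phi_bound" by (simp add: s_def phi_bound)
    qed
    have sg: "integrable lborel (\<lambda>\<xi>. s k \<xi> * g \<xi>)" for k
    proof (rule Bochner_Integration.integrable_bound[OF integrable_mult_right[OF integrable_norm[OF g], of
        phi_bound]])
      show "(\<lambda>\<xi>. s k \<xi> * g \<xi>) \<in> borel_measurable lborel" using g by measurable
      show "AE \<xi> in lborel. norm (s k \<xi> * g \<xi>) \<le> norm (phi_bound * norm (g \<xi>))"
        using phi_bound_nonneg by (intro AE_I2) (simp add: norm_mult abs_mult s_le mult_right_mono)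
    qed
    define G where "G j k = osc_integral \<Phi> (\<lambda>\<xi>. symb j (\<Phi> \<xi>) * (s k \<xi> * g \<xi>))" for j k
    have LP: "LP_time (time_cutoff m \<phi>) m j (\<lambda>t. dispersive \<Phi> t (LP_space \<phi> k f) x) = G j k" for j k
      unfolding disp_k LP_time_osc_integral[OF phi m Phi sg] G_def symb_def ..
    \<comment> \<open>On the support of \<open>symb j\<close> composed with \<Phi>, the space
      cut-offs with index in \<open>W j\<close> already sum to 1, so the pieces \<open>G j k\<close>
      in the window reassemble the whole time projection.\<close>
    have Gsum: "osc_integral \<Phi> (\<lambda>\<xi>. symb j (\<Phi> \<xi>) * g \<xi>) t = (\<Sum>k\<in>W j. G j k t)" for j t
    proof -
      have "(\<Sum>k\<in>W j. G j k t) = (LINT \<xi>|lborel. (\<Sum>k\<in>W j. cis (t * \<Phi> \<xi>) * (symb j (\<Phi> \<xi>) * (s k \<xi> * g \<xi>))))"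
        unfolding G_def osc_integral_def
        by (rule Bochner_Integration.integral_sum[symmetric])
            (intro integrable_cis_mult integrable_symb_mult Phi sg; measurable)
      also have "\<dots> = (LINT \<xi>|lborel. cis (t * \<Phi> \<xi>) * (symb j (\<Phi> \<xi>) * g \<xi>))"
      proof (rule integral_cong_AE)
        show "AE \<xi> in lborel. (\<Sum>k\<in>W j. cis (t * \<Phi> \<xi>) * (symb j (\<Phi> \<xi>) * (s k \<xi> * g \<xi>)))
            = cis (t * \<Phi> \<xi>) * (symb j (\<Phi> \<xi>) * g \<xi>)"
          using AE_lborel_singleton[of "0 :: real^'n"]
        proof eventually_elim
          case (elim \<xi>)
          show ?case
          proof (cases "symb j (\<Phi> \<xi>) = 0")
            case False
            have "(\<Sum>k\<in>W j. \<phi> (2 powr (- of_int k) * norm \<xi>)) = 1"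
            proof (rule LP_cutoff_sum_eq_1[OF phi _ finW])
              fix k assume "\<phi> (2 powr (- of_int k) * norm \<xi>) \<noteq> 0"
              then have "\<bar>of_int k - log 2 (norm \<xi>)\<bar> < 1"
                using elim by (intro LP_cutoff_log_support[OF phi]) auto
              moreover have "\<bar>of_int j - log 2 \<bar>\<Phi> \<xi>\<bar> / m\<bar> < 1" by (rule symb_support[OF False])
              \<comment> \<open>The 2 in the window is spent here: each cut-off localises its index
                to within 1, and the two scales differ by at most
                \<open>log 2 \<mu> / m\<close>.\<close>
              ultimately show "k \<in> W j"
                using bounds(2)[OF elim] unfolding W L_def of_int_diff by linarith
            qed (use elim in simp)
            then have "(\<Sum>k\<in>W j. s k \<xi>) = 1" unfolding s_def of_real_sum[symmetric] by simp
            moreover have "(\<Sum>k\<in>W j. cis (t * \<Phi> \<xi>) * (symb j (\<Phi> \<xi>) * (s k \<xi> * g \<xi>)))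
                = (\<Sum>k\<in>W j. s k \<xi>) * (cis (t * \<Phi> \<xi>) * (symb j (\<Phi> \<xi>) * g \<xi>))"
              unfolding sum_distrib_right by (simp only: mult_ac)
            ultimately show ?thesis by simp
          qed simp
        qed
      qed (use g in measurable)
      finally show ?thesis by (simp add: osc_integral_def)
    qed
    let ?P = "{(j :: int, k :: int). \<bar>real_of_int (k - j)\<bar> \<le> L}"
    let ?S = "\<lambda>t. \<Sum>\<^sub>\<infinity>(j, k) \<in> ?P. ennreal ((norm (G j k t))\<^sup>2)"
    let ?X = "\<integral>\<^sup>+t. enn_powr (enn_powr (?S t) (1 / 2)) r \<partial>lborel"
    have "(\<integral>\<^sup>+t. ennreal (norm (osc_integral \<Phi> g t) powr r) \<partial>lborel)
        \<le> ennreal (rev_const r) * (ennreal (n powr (r / 2)) * ?X)"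
    proof (rule osc_integral_reverse_square[OF Phi g r])
      show "AE \<xi> in lborel. \<Phi> \<xi> \<noteq> 0"
        using AE_lborel_singleton[of "0 :: real^'n"] by eventually_elim (rule bounds(1))
      fix J :: "int set" assume J: "finite J"
      let ?Q = "\<lambda>t. \<Sum>j\<in>J. (norm (osc_integral \<Phi> (\<lambda>\<xi>. symb j (\<Phi> \<xi>) * g \<xi>) t))\<^sup>2"
      have [measurable]: "osc_integral \<Phi> (\<lambda>\<xi>. symb j (\<Phi> \<xi>) * g \<xi>) \<in> borel_measurable borel" for j
        by (intro borel_measurable_continuous_onI osc_integral_continuous integrable_symb_mult Phi g)
      have Q0: "?Q t \<ge> 0" for t by (simp add: sum_nonneg)
      \<comment> \<open>Cauchy-Schwarz in k for each j; then the finite sum over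
        \<open>Sigma J W\<close> is one of those whose supremum is the infinite sum in
        \<open>ennreal\<close>.\<close>
      have Q_le: "ennreal (?Q t / n) \<le> ?S t" for t
      proof -
        have "?Q t \<le> (\<Sum>j\<in>J. n * (\<Sum>k\<in>W j. (norm (G j k t))\<^sup>2))"
        proof (rule sum_mono)
          fix j
          have "(norm (\<Sum>k\<in>W j. G j k t))\<^sup>2 \<le> (\<Sum>k\<in>W j. norm (G j k t))\<^sup>2"
            by (intro power_mono norm_sum) simp
          also have "\<dots> \<le> n * (\<Sum>k\<in>W j. (norm (G j k t))\<^sup>2)"
            using sum_squared_le_sum_of_squares[of "\<lambda>k. norm (G j k t)" "W j"] by (simp add: cardW mult.commute)
          finally show "(norm (osc_integral \<Phi> (\<lambda>\<xi>. symb j (\<Phi> \<xi>) * g \<xi>) t))\<^sup>2 \<le> n * (\<Sum>k\<in>W j. (norm (G j k t))\<^sup>2)"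
            unfolding Gsum .
        qed
        also have "\<dots> = n * (\<Sum>(j, k)\<in>Sigma J W. (norm (G j k t))\<^sup>2)"
          unfolding sum_distrib_left[symmetric] using J finW by (simp add: sum.Sigma)
        finally have "?Q t / n \<le> (\<Sum>(j, k)\<in>Sigma J W. (norm (G j k t))\<^sup>2)"
          using n by (simp add: divide_le_eq mult.commute)
        then have "ennreal (?Q t / n) \<le> ennreal (\<Sum>(j, k)\<in>Sigma J W. (norm (G j k t))\<^sup>2)"
          by (rule ennreal_leI)
        also have "\<dots> = (\<Sum>(j, k)\<in>Sigma J W. ennreal ((norm (G j k t))\<^sup>2))"
          unfolding split_def by (rule sum_ennreal[symmetric]) simp
        also have "\<dots> \<le> ?S t"
          by (subst nonneg_infsum_complete) (use J finW W in \<open>auto intro!: SUP_upper\<close>)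
        finally show ?thesis .
      qed
      have "(\<integral>\<^sup>+t. ennreal (sqrt (?Q t) powr r) \<partial>lborel)
          = (\<integral>\<^sup>+t. ennreal (n powr (r / 2)) * ennreal ((?Q t / n) powr (r / 2)) \<partial>lborel)"
      proof (rule nn_integral_cong)
        fix t
        have "sqrt (?Q t) powr r = ?Q t powr (r / 2)"
          using Q0[of t] by (simp add: powr_half_sqrt[symmetric] powr_powr)
        also have "\<dots> = n powr (r / 2) * (?Q t / n) powr (r / 2)"
          using n by (simp add: powr_mult[symmetric])
        finally show "ennreal (sqrt (?Q t) powr r) = ennreal (n powr (r / 2)) * ennreal ((?Q t / n) powr (r / 2))"
          by (simp add: ennreal_mult)
      qed
      also have "\<dots> = ennreal (n powr (r / 2)) * (\<integral>\<^sup>+t. ennreal ((?Q t / n) powr (r / 2)) \<partial>lborel)"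
        by (rule nn_integral_cmult) measurable
      also have "\<dots> \<le> ennreal (n powr (r / 2)) * ?X"
      proof (intro mult_left_mono nn_integral_mono)
        fix t
        have "ennreal ((?Q t / n) powr (r / 2)) = enn_powr (enn_powr (ennreal (?Q t / n)) (1 / 2)) r"
          using Q0[of t] n by (simp add: enn_powr_ennreal powr_powr)
        also have "\<dots> \<le> enn_powr (enn_powr (?S t) (1 / 2)) r"
          using r by (intro enn_powr_mono Q_le) auto
        finally show "ennreal ((?Q t / n) powr (r / 2)) \<le> enn_powr (enn_powr (?S t) (1 / 2)) r" .
      qed simp
      finally show "(\<integral>\<^sup>+t. ennreal (sqrt (?Q t) powr r) \<partial>lborel) \<le> ennreal (n powr (r / 2)) * ?X" .
    qed
    also have "\<dots> \<le> ennreal c * ?X"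
      unfolding mult.assoc[symmetric] c_def using rc n
      by (intro mult_right_mono) (auto simp: ennreal_mult[symmetric] intro!: ennreal_leI mult_right_mono)
    finally have main: "(\<integral>\<^sup>+t. enn_powr (ennreal (norm (dispersive \<Phi> t f x))) r \<partial>lborel) \<le> ennreal c * ?X"
      using fun_cong[OF disp] by (simp add: enn_powr_ennreal)
    show "Lr_norm r (\<lambda>t. ennreal (norm (dispersive \<Phi> t f x)))
          \<le> ennreal (c powr (1 / r)) * Lr_norm r (\<lambda>t. enn_powr
               (\<Sum>\<^sub>\<infinity>(j, k) \<in> {(j :: int, k :: int). \<bar>real_of_int (k - j)\<bar> \<le> log 2 \<mu> / m + 2}.
                  ennreal ((norm (LP_time (time_cutoff m \<phi>) m j
                              (\<lambda>s. dispersive \<Phi> s (LP_space \<phi> k f) x) t))\<^sup>2))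
               (1 / 2))"
      unfolding LP L_def[symmetric] using r by (intro Lr_norm_le c main) auto
  qed
qed

end
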